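(* Let $d=p+q$ with $p,q\ge1$ integers, let $\mu\in\mathcal{P}_{2,0}(\mathbb{R}^p)$ and $\nu\in\mathcal{P}_{2,0}(\mathbb{R}^q)$, and let $\pi\in\Gamma(\mu,\nu)$. The Wasserstein dependence coefficients $\tilde{\mathfrak{D}}_r=\tilde{\mathfrak{D}}_r(\,\cdot\,;p,q)$, $r\in\{1,2\}$, satisfy the following properties: (i) $\tilde{\mathfrak{D}}_r(\pi)\in[0,1]$, while $\tilde{\mathfrak{D}}_r(\pi)=0$ if and only if $\pi=\mu\otimes\nu$. (ii) There exists $\pi^{(r)}\in\Gamma(\mu,\nu)$ such that $\tilde{\mathfrak{D}}_r(\pi^{(r)})=1$. (iii) $\tilde{\mathfrak{D}}_r$ is invariant with respect to orthogonal linear transformations within the first $p$ and the last $q$ coordinates: if $O(x,y)=(O_1x,O_2y)$ for $x\in\mathbb{R}^p$, $y\in\mathbb{R}^q$ with orthogonal linear maps $O_1$ of $\mathbb{R}^p$ and $O_2$ of $\mathbb{R}^q$, then $\tilde{\mathfrak{D}}_r(\pi\circ O^{-1})=\tilde{\mathfrak{D}}_r(\pi)$.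
   Context: $\mathcal{P}_2(\mathbb{R}^m)$ is the set of Borel probability measures on $\mathbb{R}^m$ with finite second moments, and $\mathcal{P}_{2,0}(\mathbb{R}^m)$ is the subset of non-degenerate ones (not a point mass). For $\mu\in\mathcal{P}_2(\mathbb{R}^p)$ and $\nu\in\mathcal{P}_2(\mathbb{R}^q)$, $\Gamma(\mu,\nu)$ is the set of couplings, i.e. probability measures on $\mathbb{R}^{p+q}$ with margin $\mu$ on the first $p$ coordinates and $\nu$ on the last $q$ coordinates; $\mu\otimes\nu$ is the product measure. $W_2$ is the 2-Wasserstein distance, $W_2^2(\pi,\pi')=\inf_{\gamma\in\Gamma(\pi,\pi')}\int\|v-v'\|^2\,\mathrm{d}\gamma(v,v')$ for $\pi,\pi'\in\mathcal{P}_2(\mathbb{R}^d)$ (Euclidean norm). $\gamma_m=\mathcal{N}_m(0,I_m)$ is the standard Gaussian distribution on $\mathbb{R}^m$. For $\pi\in\Gamma(\mu,\nu)$ with $\mu\in\mathcal{P}_{2,0}(\mathbb{R}^p)$, $\nu\in\mathcal{P}_{2,0}(\mathbb{R}^q)$, $d=p+q$: $$\tilde{\mathfrak{D}}_1(\pi;p,q)=\frac{W_2^2(\pi,\gamma_d)-W_2^2(\mu,\gamma_p)-W_2^2(\nu,\gamma_q)}{\sup_{\tilde\pi\in\Gamma(\mu,\nu)}W_2^2(\tilde\pi,\gamma_d)-W_2^2(\mu,\gamma_p)-W_2^2(\nu,\gamma_q)},\qquad \tilde{\mathfrak{D}}_2(\pi;p,q)=\frac{W_2^2(\pi,\mu\otimes\nu)}{\sup_{\tilde\pi\in\Gamma(\mu,\nu)}W_2^2(\tilde\pi,\mu\otimes\nu)}.$$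 *)

theory Defs
  imports "HOL-Probability.Probability"
begin

definition P2 :: "'a::euclidean_space measure set" where
  "P2 = {M. prob_space M \<and> sets M = sets borel \<and> integrable M (\<lambda>x. (norm x)\<^sup>2)}"

definition P2_nondeg :: "'a::euclidean_space measure set" where
  "P2_nondeg = {M \<in> P2. \<nexists>x. M = return borel x}"

text \<open>
  The space $R^{p+q}$ is rendered as the product type of $R^p$ and $R^q$; the library's norm on
  product types is the Euclidean one, and the Borel sets of the product type are the product
  sigma-algebra (\<open>borel_prod\<close>).
\<close>

abbreviation margin1 :: "('a::euclidean_space \<times> 'b::euclidean_space) measure \<Rightarrow> 'a measure" where
  "margin1 K \<equiv> distr K borel fst"

abbreviation margin2 :: "('a::euclidean_space \<times> 'b::euclidean_space) measure \<Rightarrow> 'b measure" where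
  "margin2 K \<equiv> distr K borel snd"

definition couplings ::
  "'a::euclidean_space measure \<Rightarrow> 'b::euclidean_space measure \<Rightarrow> ('a \<times> 'b) measure set" where
  "couplings M N = {K. prob_space K \<and> sets K = sets borel \<and>
     margin1 K = M \<and> margin2 K = N}"

text \<open>
  The infimum is taken in the extended nonnegative reals. It is finite for arguments in
  \<open>P2\<close>, so \<open>enn2real\<close> loses nothing there.
\<close>

definition W2 :: "'a::euclidean_space measure \<Rightarrow> 'a measure \<Rightarrow> real" where
  "W2 M N = sqrt (enn2real
     (INF K\<in>couplings M N. \<integral>\<^sup>+ (v, v'). ennreal ((norm (v - v'))\<^sup>2) \<partial>K))"

definition std_gaussian :: "'a::euclidean_space measure" where
  "std_gaussian = density lborel (\<lambda>x. ennreal (\<Prod>b\<in>Basis. std_normal_density (x \<bullet> b)))"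

text \<open>
  The coefficients are functions of the joint distribution \<open>K\<close> alone: the margins in the formulas
  are those of \<open>K\<close>, and $p$, $q$ are carried by its type. When the margins are in \<open>P2\<close>, each
  supremum below is a real supremum over a nonempty set that is bounded above.
\<close>

definition wass_dep1 :: "('a::euclidean_space \<times> 'b::euclidean_space) measure \<Rightarrow> real" where
  "wass_dep1 K = (let M = margin1 K; N = margin2 K in
     ((W2 K std_gaussian)\<^sup>2 - (W2 M std_gaussian)\<^sup>2 - (W2 N std_gaussian)\<^sup>2) /
     ((SUP L\<in>couplings M N. (W2 L std_gaussian)\<^sup>2)
        - (W2 M std_gaussian)\<^sup>2 - (W2 N std_gaussian)\<^sup>2))"

definition wass_dep2 :: "('a::euclidean_space \<times> 'b::euclidean_space) measure \<Rightarrow> real" where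
  "wass_dep2 K = (let M = margin1 K; N = margin2 K in
     (W2 K (M \<Otimes>\<^sub>M N))\<^sup>2 / (SUP L\<in>couplings M N. (W2 L (M \<Otimes>\<^sub>M N))\<^sup>2))"

end

theory Submission
  imports Defs
begin

text \<open>
  On the couplings of \<open>\<mu>\<close> and \<open>\<nu>\<close>, consider the squared Wasserstein distance to a reference
  measure: the standard Gaussian for the first coefficient, \<open>\<mu> \<otimes> \<nu>\<close> for the second. Each
  coefficient is this function, rescaled affinely so that its minimum becomes 0 and its maximum
  becomes 1 (\<open>normalised_coefficient\<close>). Properties (i) and (ii) therefore say that the minimum is
  the value subtracted in the definition and is taken at the product measure only, that the maximum
  is attained, and that the two differ. They differ because non-degenerate margins also have a
  coupling that is not the product (\<open>non_product_coupling\<close>).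

  \<^bold>\<open>The maximum.\<close> A sequence of couplings with fixed margins in \<open>P2\<close> has a subsequence that converges
  in \<open>W2\<close> to a coupling with the same margins (\<open>coupling_compactness\<close>). To see it, code points of
  \<open>R\<^sup>d\<close> by real numbers through a Borel map that has continuous decoders, and apply the selection
  theorem of Helly and the representation theorem of Skorohod on the real line; the decoded random
  vectors converge almost surely. All couplings in question have the same second moment, so that
  almost sure convergence improves to convergence in \<open>L\<^sup>2\<close>. Compactness yields optimal couplings
  (\<open>optimal_coupling_exists\<close>). Together with a triangle inequality, obtained by gluing two couplings
  along small cells (\<open>W2sq_perturb_left\<close>), it also yields a coupling at maximal distance from the
  reference measure (\<open>W2sq_maximal_coupling\<close>).

  \<^bold>\<open>The minimum.\<close> Distance zero means equality, which settles the second coefficient. For the first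
  one, a coupling of \<open>\<pi>\<close> with the Gaussian on the product space splits into a coupling of \<open>\<mu>\<close> and
  one of \<open>\<nu>\<close> with Gaussians, and the costs add up (\<open>W2sq_coupling_ge\<close>). If the minimal value is
  taken, both parts \<open>(X, Z\<^sub>1)\<close> and \<open>(Y, Z\<^sub>2)\<close> of an optimal coupling are optimal. An optimal coupling is
  supported by a comonotone set, for otherwise exchanging first components would lower its cost. A
  comonotone set is single-valued Lebesgue almost everywhere, because along each line in a coordinate
  direction it is an increasing relation. Hence \<open>X\<close> is determined by \<open>Z\<^sub>1\<close> and \<open>Y\<close> by \<open>Z\<^sub>2\<close>
  (\<open>optimal_coupling_events\<close>), and \<open>X\<close>, \<open>Y\<close> are independent since \<open>Z\<^sub>1\<close>, \<open>Z\<^sub>2\<close> are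
  (\<open>product_of_gaussian_additivity\<close>).

  \<^bold>\<open>Invariance.\<close> Orthogonal maps are isometries, preserve the standard Gaussian, and permute the
  couplings compatibly with margins and products (\<open>wass_dep_invariant\<close>).
\<close>

section \<open>Coding points by real numbers\<close>

text \<open>
  A Cantor-type expansion. Base 4 with digits 0 and 2 leaves gaps between the digit cylinders, so
  that the digits are restrictions of continuous functions of the sum; for binary expansions they
  are not.
\<close>
definition cantor_sum :: "(nat \<Rightarrow> real) \<Rightarrow> real" where
  "cantor_sum a = (\<Sum>i. 2 * a i / 4 ^ Suc i)"

text \<open>
  Reads off the leading digit: a sum with leading digit 0 is at most 1/6, one with leading digit 1
  is at least 1/2.
\<close>
definition leading_digit :: "real \<Rightarrow> real" where
  "leading_digit s = max 0 (min 1 (4 * s - 1))"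

definition drop_leading_digit :: "real \<Rightarrow> real" where
  "drop_leading_digit s = 4 * s - 2 * leading_digit s"

lemma cantor_summable:
  assumes "\<And>i. a i \<in> {0, 1::real}"
  shows "summable (\<lambda>i. 2 * a i / 4 ^ Suc i)"
proof (rule summable_comparison_test')
  show "summable (\<lambda>i. 2 * (1/4::real) ^ i)"
    by (intro summable_mult summable_geometric) simp
  show "norm (2 * a n / 4 ^ Suc n) \<le> 2 * (1 / 4) ^ n" for n
  proof -
    have "a n = 0 \<or> a n = 1" using assms[of n] by blast
    thus ?thesis by (auto simp: power_divide field_simps)
  qed
qed

lemma cantor_sum_Suc:
  assumes "\<And>i. a i \<in> {0, 1::real}"
  shows "cantor_sum a = a 0 / 2 + cantor_sum (\<lambda>i. a (Suc i)) / 4"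
proof -
  have s: "summable (\<lambda>i. 2 * a (Suc i) / 4 ^ Suc i)"
    using cantor_summable[of "\<lambda>i. a (Suc i)"] assms by blast
  have "cantor_sum a = (\<Sum>i. 2 * a (Suc i) / 4 ^ Suc (Suc i)) + 2 * a 0 / 4 ^ Suc 0"
    unfolding cantor_sum_def using suminf_split_head[OF cantor_summable[of a, OF assms]] by linarith
  also have "(\<Sum>i. 2 * a (Suc i) / 4 ^ Suc (Suc i)) = (\<Sum>i. (2 * a (Suc i) / 4 ^ Suc i) / 4)"
    by simp
  also have "\<dots> = cantor_sum (\<lambda>i. a (Suc i)) / 4"
    unfolding cantor_sum_def by (rule suminf_divide[OF s])
  finally show ?thesis by simp
qed

lemma cantor_sum_bounds:
  assumes "\<And>i. a i \<in> {0, 1::real}"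
  shows "cantor_sum a \<in> {0..2/3}"
proof -
  have a: "0 \<le> a i \<and> a i \<le> 1" for i using assms[of i] by auto
  have 0: "0 \<le> cantor_sum a"
    unfolding cantor_sum_def by (rule suminf_nonneg[OF cantor_summable[of a, OF assms]]) (use a in simp)
  have g: "(\<lambda>i. (1/2) * (1/4::real) ^ i) sums ((1/2) * (1 / (1 - 1/4)))"
    by (intro sums_mult geometric_sums) simp
  have "cantor_sum a \<le> (\<Sum>i. (1/2) * (1/4::real) ^ i)"
    unfolding cantor_sum_def
    by (rule suminf_le[OF _ cantor_summable[of a, OF assms] sums_summable[OF g]])
       (use a in \<open>simp add: power_divide field_simps\<close>)
  also have "\<dots> = 2/3" using sums_unique[OF g] by simp
  finally show ?thesis using 0 by simp
qed

lemma leading_digit_cantor_sum: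
  assumes "\<And>i. a i \<in> {0, 1::real}"
  shows "leading_digit (cantor_sum a) = a 0" "drop_leading_digit (cantor_sum a) = cantor_sum (\<lambda>i. a (Suc i))"
proof -
  have b: "cantor_sum (\<lambda>i. a (Suc i)) \<in> {0..2/3}" using assms by (intro cantor_sum_bounds)
  show 1: "leading_digit (cantor_sum a) = a 0"
    using assms[of 0] b cantor_sum_Suc[of a, OF assms] by (auto simp: leading_digit_def)
  show "drop_leading_digit (cantor_sum a) = cantor_sum (\<lambda>i. a (Suc i))"
    unfolding drop_leading_digit_def 1 using cantor_sum_Suc[of a, OF assms] by simp
qed

lemma digit_cantor_sum:
  assumes "\<And>i. a i \<in> {0, 1::real}"
  shows "leading_digit ((drop_leading_digit ^^ n) (cantor_sum a)) = a n"
proof -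
  have "(drop_leading_digit ^^ n) (cantor_sum a) = cantor_sum (\<lambda>i. a (i + n))"
  proof (induction n)
    case (Suc n)
    show ?case using leading_digit_cantor_sum(2)[of "\<lambda>i. a (i + n)"] assms Suc by (simp del: funpow.simps add: funpow.simps(2))
  qed simp
  thus ?thesis using leading_digit_cantor_sum(1)[of "\<lambda>i. a (i + n)"] assms by simp
qed

lemma continuous_leading_digit: "continuous_on UNIV leading_digit"
  unfolding leading_digit_def by (intro continuous_intros)

lemma continuous_digit: "continuous_on UNIV (\<lambda>s. leading_digit ((drop_leading_digit ^^ n) s))"
proof -
  have s: "continuous_on UNIV drop_leading_digit"
    unfolding drop_leading_digit_def by (intro continuous_intros continuous_leading_digit)
  have "continuous_on UNIV (drop_leading_digit ^^ n)"
  proof (induction n)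
    case (Suc n)
    have "continuous_on UNIV (drop_leading_digit \<circ> (drop_leading_digit ^^ n))"
      by (rule continuous_on_compose[OF Suc]) (rule continuous_on_subset[OF s subset_UNIV])
    thus ?case by (simp add: comp_def)
  qed (simp add: id_def)
  from continuous_on_compose[OF this continuous_on_subset[OF continuous_leading_digit subset_UNIV]]
  show ?thesis by (simp add: comp_def)
qed

definition bin_digit :: "real \<Rightarrow> nat \<Rightarrow> real" where
  "bin_digit t k = of_int (\<lfloor>2 ^ Suc k * t\<rfloor> - 2 * \<lfloor>2 ^ k * t\<rfloor>)"

lemma bin_digit_01: "bin_digit t k \<in> {0, 1}"
proof -
  define y where "y = 2 ^ k * t"
  have "\<lfloor>2 * y\<rfloor> - 2 * \<lfloor>y\<rfloor> = 0 \<or> \<lfloor>2 * y\<rfloor> - 2 * \<lfloor>y\<rfloor> = 1" by linarith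
  thus ?thesis unfolding bin_digit_def y_def by (auto simp: mult.assoc)
qed

text \<open>
  The partial sums telescope to \<open>\<lfloor>2 ^ k * t\<rfloor> / 2 ^ k\<close>.
\<close>
lemma bin_digit_sums:
  assumes "0 \<le> t" "t < 1"
  shows "(\<lambda>k. bin_digit t k / 2 ^ Suc k) sums t"
proof -
  define f where "f k = of_int \<lfloor>2 ^ k * t\<rfloor> / (2::real) ^ k" for k
  have "f \<longlonglongrightarrow> t"
  proof (rule tendsto_sandwich)
    have "t - (1/2) ^ k \<le> f k \<and> f k \<le> t" for k
    proof -
      have "of_int \<lfloor>2 ^ k * t\<rfloor> \<le> 2 ^ k * t" "2 ^ k * t - 1 \<le> of_int \<lfloor>2 ^ k * t\<rfloor>" by linarith+
      thus ?thesis by (auto simp: f_def le_divide_eq divide_le_eq right_diff_distrib mult.commute power_one_over)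
    qed
    thus "\<forall>\<^sub>F k in sequentially. t - (1/2) ^ k \<le> f k" "\<forall>\<^sub>F k in sequentially. f k \<le> t" by auto
    have "(\<lambda>k. t - (1/2::real) ^ k) \<longlonglongrightarrow> t - 0"
      by (intro tendsto_intros LIMSEQ_realpow_zero) auto
    thus "(\<lambda>k. t - (1/2::real) ^ k) \<longlonglongrightarrow> t" by simp
  qed auto
  from telescope_sums[OF this] have "(\<lambda>k. f (Suc k) - f k) sums (t - f 0)" .
  moreover have "f 0 = 0" using assms by (simp add: f_def floor_eq_iff)
  moreover have "f (Suc k) - f k = bin_digit t k / 2 ^ Suc k" for k
    by (simp add: f_def bin_digit_def field_simps)
  ultimately show ?thesis by simp
qed

text \<open>
  Countably many Borel functions with values in the unit interval can be stored in a single Borel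
  function \<open>e\<close> from which each of them is recovered by a continuous map: interleave their binary
  digits and use these as digits of \<open>cantor_sum\<close>. Continuity of the decoders is what lets
  convergence of codes pass to convergence of the coded points.
\<close>
lemma borel_section_of_continuous_decoders:
  fixes u :: "nat \<Rightarrow> 'a \<Rightarrow> real"
  assumes [measurable]: "\<And>n. u n \<in> borel_measurable M" and u: "\<And>n x. 0 \<le> u n x \<and> u n x < 1"
  shows "\<exists>e D. e \<in> borel_measurable M \<and> (\<forall>x. e x \<in> {0..1::real}) \<and>
    (\<forall>n. continuous_on UNIV (D n)) \<and> (\<forall>n x. D n (e x) = (u n x :: real))"
proof -
  define a where "a x i = bin_digit (u (fst (prod_decode i)) x) (snd (prod_decode i))" for x i
  define e where "e x = cantor_sum (a x)" for x
  define \<phi> where "\<phi> n s = leading_digit ((drop_leading_digit ^^ n) s)" for n s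
  define D where "D n s = (\<Sum>k. \<phi> (prod_encode (n, k)) s / 2 ^ Suc k)" for n s
  have a: "a x i \<in> {0, 1}" for x i unfolding a_def by (rule bin_digit_01)
  have "e \<in> borel_measurable M"
    unfolding e_def cantor_sum_def a_def bin_digit_def by measurable
  moreover have "e x \<in> {0..1}" for x using cantor_sum_bounds[of "a x"] a by (auto simp: e_def)
  moreover have "continuous_on UNIV (D n)" for n
  proof -
    have lim: "uniform_limit UNIV (\<lambda>m s. \<Sum>k<m. \<phi> (prod_encode (n, k)) s / 2 ^ Suc k) (D n) sequentially"
      unfolding D_def
    proof (rule Weierstrass_m_test)
      show "norm (\<phi> (prod_encode (n, k)) s / 2 ^ Suc k) \<le> (1/2) ^ k" for k s
        by (auto simp: \<phi>_def leading_digit_def field_simps power_divide)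
      show "summable (\<lambda>k. (1/2::real) ^ k)" by (rule summable_geometric) simp
    qed
    have "\<forall>\<^sub>F m in sequentially. continuous_on UNIV (\<lambda>s. \<Sum>k<m. \<phi> (prod_encode (n, k)) s / 2 ^ Suc k)"
      unfolding \<phi>_def by (intro always_eventually allI continuous_intros continuous_digit) auto
    from uniform_limit_theorem[OF this lim] show ?thesis by simp
  qed
  moreover have "D n (e x) = u n x" for n x
  proof -
    have "\<phi> (prod_encode (n, k)) (e x) = bin_digit (u n x) k" for k
      using digit_cantor_sum[of "a x" "prod_encode (n, k)"] a by (simp add: \<phi>_def e_def a_def)
    thus ?thesis unfolding D_def using bin_digit_sums[of "u n x"] u[of n x] by (simp add: sums_iff)
  qed
  ultimately show ?thesis by blast
qed

section \<open>Limits of laws\<close>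

text \<open>
  The indicator of a closed set \<open>C\<close> is the decreasing limit of the continuous functions
  \<open>max 0 (1 - k * infdist x C)\<close>, and the closed sets generate the Borel sets.
\<close>
lemma measure_eq_of_bounded_continuous:
  fixes M N :: "'a::metric_space measure"
  assumes "prob_space M" "prob_space N" and sets: "sets M = sets borel" "sets N = sets borel"
    and eq: "\<And>h :: 'a \<Rightarrow> real. continuous_on UNIV h \<Longrightarrow> (\<And>x. \<bar>h x\<bar> \<le> 1) \<Longrightarrow> (\<integral>x. h x \<partial>M) = (\<integral>x. h x \<partial>N)"
  shows "M = N"
proof -
  interpret M: prob_space M by fact
  interpret N: prob_space N by fact
  have closed: "measure M C = measure N C" if C: "closed C" for C
  proof (cases "C = {}")
    case False
    define h where "h k x = max 0 (1 - real k * infdist x C)" for k x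
    have cont: "continuous_on UNIV (h k)" for k
      unfolding h_def by (intro continuous_intros)
    have bd: "\<bar>h k x\<bar> \<le> 1" for k x by (auto simp: h_def infdist_nonneg)
    have lim: "(\<lambda>k. h k x) \<longlonglongrightarrow> indicator C x" for x
    proof (cases "x \<in> C")
      case True thus ?thesis by (simp add: h_def)
    next
      case False
      hence pos: "infdist x C > 0"
        using C \<open>C \<noteq> {}\<close> by (simp add: infdist_nonneg in_closed_iff_infdist_zero order_less_le)
      have "\<forall>\<^sub>F k in sequentially. real k > 1 / infdist x C"
        by (rule eventually_gt_at_top[THEN filterlim_real_sequentially[THEN filterlim_iff[THEN iffD1], rule_format]])
      hence "\<forall>\<^sub>F k in sequentially. h k x = 0"
        by eventually_elim (use pos in \<open>auto simp: h_def field_simps\<close>)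
      thus ?thesis using False by (simp add: tendsto_eventually)
    qed
    have "(\<lambda>k. \<integral>x. h k x \<partial>L) \<longlonglongrightarrow> measure L C" if L: "prob_space L" "sets L = sets borel" for L
    proof -
      interpret L: prob_space L by fact
      have m: "h k \<in> borel_measurable L" for k
        using borel_measurable_continuous_onI[OF cont] measurable_cong_sets[OF L(2) refl] by blast
      have C': "C \<in> sets L" using C L(2) by simp
      have "(\<lambda>k. \<integral>x. h k x \<partial>L) \<longlonglongrightarrow> (\<integral>x. indicator C x \<partial>L)"
        by (rule integral_dominated_convergence[where w = "\<lambda>_. 1"]) (use m C' lim bd in auto)
      thus ?thesis using C' by simp
    qed
    from this[OF assms(1) sets(1)] this[OF assms(2) sets(2)]
    have "(\<lambda>k. \<integral>x. h k x \<partial>M) \<longlonglongrightarrow> measure M C" "(\<lambda>k. \<integral>x. h k x \<partial>M) \<longlonglongrightarrow> measure N C"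
      using eq[OF cont bd] by auto
    thus ?thesis by (rule LIMSEQ_unique)
  qed simp
  show ?thesis
  proof (rule measure_eqI_generator_eq[where E = "Collect closed" and \<Omega> = UNIV and A = "\<lambda>_. UNIV"])
    show "Int_stable (Collect (closed :: 'a set \<Rightarrow> bool))" by (auto simp: Int_stable_def)
    show "emeasure M X = emeasure N X" if "X \<in> Collect closed" for X
      using closed that by (simp add: M.emeasure_eq_measure N.emeasure_eq_measure)
    show "sets M = sigma_sets UNIV (Collect closed)" "sets N = sigma_sets UNIV (Collect closed)"
      using sets by (simp_all add: borel_eq_closed)
  qed (auto)
qed

lemma distr_limit_of_constant_law:
  fixes X :: "nat \<Rightarrow> 'w \<Rightarrow> 'a::{metric_space, second_countable_topology}"
  assumes "prob_space \<Omega>" and [measurable]: "\<And>n. X n \<in> borel_measurable \<Omega>" "Y \<in> borel_measurable \<Omega>"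
    and law: "\<And>n. distr \<Omega> borel (X n) = P"
    and lim: "AE w in \<Omega>. (\<lambda>n. X n w) \<longlonglongrightarrow> Y w"
  shows "distr \<Omega> borel Y = P"
proof -
  interpret prob_space \<Omega> by fact
  have P: "prob_space P" "sets P = sets borel"
    unfolding law[of 0, symmetric] by (rule prob_space_distr, measurable)
  show ?thesis
  proof (rule measure_eq_of_bounded_continuous)
    show "prob_space (distr \<Omega> borel Y)" by (rule prob_space_distr) measurable
    fix h :: "'a \<Rightarrow> real" assume h: "continuous_on UNIV h" "\<And>x. \<bar>h x\<bar> \<le> 1"
    have [measurable]: "h \<in> borel_measurable borel" by (rule borel_measurable_continuous_onI[OF h(1)])
    have "(\<lambda>n. \<integral>w. h (X n w) \<partial>\<Omega>) \<longlonglongrightarrow> (\<integral>w. h (Y w) \<partial>\<Omega>)"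
    proof (rule integral_dominated_convergence[where w = "\<lambda>_. 1"])
      show "AE w in \<Omega>. (\<lambda>n. h (X n w)) \<longlonglongrightarrow> h (Y w)"
        using lim
      proof eventually_elim
        case (elim w)
        have "isCont h (Y w)" using h(1) by (simp add: continuous_on_eq_continuous_at)
        thus ?case by (rule isCont_tendsto_compose[OF _ elim])
      qed
    qed (use h(2) in auto)
    moreover have "(\<integral>w. h (X n w) \<partial>\<Omega>) = (\<integral>x. h x \<partial>P)" for n
      unfolding law[of n, symmetric] by (subst integral_distr) auto
    ultimately have "(\<integral>w. h (Y w) \<partial>\<Omega>) = (\<integral>x. h x \<partial>P)" by (simp add: LIMSEQ_const_iff)
    thus "(\<integral>x. h x \<partial>distr \<Omega> borel Y) = (\<integral>x. h x \<partial>P)" by (subst integral_distr) auto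
  qed (use P in auto)
qed

section \<open>Couplings and transport cost\<close>

lemma borel_measurable_fst_snd [measurable]:
  "(fst :: 'a::second_countable_topology \<times> 'b::second_countable_topology \<Rightarrow> 'a) \<in> borel_measurable borel"
  "(snd :: 'a::second_countable_topology \<times> 'b::second_countable_topology \<Rightarrow> 'b) \<in> borel_measurable borel"
  by (auto intro!: borel_measurable_continuous_onI continuous_intros)

text \<open>
  Second moments, costs and squared distances are kept in \<open>ennreal\<close>, where they are defined
  for all measures and where Fatou's lemma and Tonelli's theorem apply directly.
\<close>
definition second_moment :: "'a::euclidean_space measure \<Rightarrow> ennreal" where
  "second_moment M = (\<integral>\<^sup>+ x. ennreal ((norm x)\<^sup>2) \<partial>M)"

definition transport_cost :: "('a::euclidean_space \<times> 'a) measure \<Rightarrow> ennreal" where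
  "transport_cost K = (\<integral>\<^sup>+ p. ennreal ((norm (fst p - snd p))\<^sup>2) \<partial>K)"

definition W2sq :: "'a::euclidean_space measure \<Rightarrow> 'a measure \<Rightarrow> ennreal" where
  "W2sq M N = (INF K\<in>couplings M N. transport_cost K)"

lemma W2_power2: "(W2 M N)\<^sup>2 = enn2real (W2sq M N)"
  by (simp add: W2_def W2sq_def transport_cost_def case_prod_unfold)

lemma P2_iff: "M \<in> P2 \<longleftrightarrow> prob_space M \<and> sets M = sets borel \<and> second_moment M < \<infinity>"
proof -
  have "integrable M (\<lambda>x. (norm x)\<^sup>2) \<longleftrightarrow> second_moment M < \<infinity>" if "sets M = sets borel"
  proof -
    have "(\<lambda>x::'a. (norm x)\<^sup>2) \<in> borel_measurable M"
      unfolding measurable_cong_sets[OF that refl] by measurable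
    thus ?thesis by (simp add: integrable_iff_bounded second_moment_def)
  qed
  thus ?thesis by (auto simp: P2_def)
qed

lemma P2D:
  assumes "M \<in> P2" shows "prob_space M" "sets M = sets borel" "second_moment M < \<infinity>"
  using assms by (auto simp: P2_iff)

lemma couplingsD:
  assumes "K \<in> couplings M N"
  shows "prob_space K" "sets K = sets borel" "distr K borel fst = M" "distr K borel snd = N"
  using assms by (auto simp: couplings_def)

lemma couplings_margins:
  fixes K :: "('a::euclidean_space \<times> 'b::euclidean_space) measure"
  assumes "K \<in> couplings M N"
  shows "prob_space M" "sets M = sets borel" "prob_space N" "sets N = sets borel"
proof -
  interpret prob_space K using couplingsD[OF assms] by blast
  have [measurable_cong]: "sets K = sets borel" using couplingsD[OF assms] by blast
  have "prob_space (distr K borel fst)" "sets (distr K borel fst) = sets borel"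
    by (rule prob_space_distr, simp_all)
  moreover have "prob_space (distr K borel snd)" "sets (distr K borel snd) = sets borel"
    by (rule prob_space_distr, simp_all)
  ultimately show "prob_space M" "sets M = sets borel" "prob_space N" "sets N = sets borel"
    using couplingsD[OF assms] by auto
qed

text \<open>
  Couplings are built below as joint laws of two random vectors on a common probability space; the
  cost is then the mean square distance of these vectors.
\<close>
lemma coupling_of_variables:
  fixes X :: "'w \<Rightarrow> 'a::euclidean_space" and Y :: "'w \<Rightarrow> 'b::euclidean_space"
  assumes "prob_space \<Omega>" and [measurable]: "X \<in> borel_measurable \<Omega>" "Y \<in> borel_measurable \<Omega>"
  shows "distr \<Omega> borel (\<lambda>w. (X w, Y w)) \<in> couplings (distr \<Omega> borel X) (distr \<Omega> borel Y)"
proof -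
  interpret prob_space \<Omega> by fact
  have [measurable]: "(\<lambda>w. (X w, Y w)) \<in> borel_measurable \<Omega>" by (rule borel_measurable_Pair) measurable
  have "prob_space (distr \<Omega> borel (\<lambda>w. (X w, Y w)))" by (rule prob_space_distr) measurable
  moreover have "distr (distr \<Omega> borel (\<lambda>w. (X w, Y w))) borel fst = distr \<Omega> borel X"
    by (subst distr_distr) (auto simp: comp_def)
  moreover have "distr (distr \<Omega> borel (\<lambda>w. (X w, Y w))) borel snd = distr \<Omega> borel Y"
    by (subst distr_distr) (auto simp: comp_def)
  ultimately show ?thesis by (simp add: couplings_def)
qed

lemma transport_cost_of_variables:
  fixes X Y :: "'w \<Rightarrow> 'a::euclidean_space"
  assumes [measurable]: "X \<in> borel_measurable \<Omega>" "Y \<in> borel_measurable \<Omega>"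
  shows "transport_cost (distr \<Omega> borel (\<lambda>w. (X w, Y w))) = (\<integral>\<^sup>+ w. ennreal ((norm (X w - Y w))\<^sup>2) \<partial>\<Omega>)"
proof -
  have [measurable]: "(\<lambda>w. (X w, Y w)) \<in> borel_measurable \<Omega>" by (rule borel_measurable_Pair) measurable
  show ?thesis unfolding transport_cost_def by (subst nn_integral_distr) auto
qed

lemma W2sq_le_of_variables:
  fixes X Y :: "'w \<Rightarrow> 'a::euclidean_space"
  assumes "prob_space \<Omega>" "X \<in> borel_measurable \<Omega>" "Y \<in> borel_measurable \<Omega>"
    and "distr \<Omega> borel X = M" "distr \<Omega> borel Y = N"
  shows "W2sq M N \<le> (\<integral>\<^sup>+ w. ennreal ((norm (X w - Y w))\<^sup>2) \<partial>\<Omega>)"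
  unfolding W2sq_def transport_cost_of_variables[OF assms(2,3), symmetric]
  by (rule INF_lower) (use coupling_of_variables[OF assms(1-3)] assms(4,5) in simp)

lemma product_coupling:
  fixes M :: "'a::euclidean_space measure" and N :: "'b::euclidean_space measure"
  assumes "prob_space M" "sets M = sets borel" "prob_space N" "sets N = sets borel"
  shows "M \<Otimes>\<^sub>M N \<in> couplings M N"
proof -
  interpret M: prob_space M by fact
  interpret N: prob_space N by fact
  interpret MN: pair_prob_space M N ..
  have [measurable_cong]: "sets M = sets borel" "sets N = sets borel" by fact+
  have s: "sets (M \<Otimes>\<^sub>M N) = sets borel"
    using sets_pair_measure_cong[OF assms(2,4)] unfolding borel_prod .
  have "distr (M \<Otimes>\<^sub>M N) borel fst = distr (M \<Otimes>\<^sub>M N) M fst" using assms(2) by (intro distr_cong) auto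
  also have "\<dots> = M" by (rule N.distr_pair_fst)
  finally have 1: "distr (M \<Otimes>\<^sub>M N) borel fst = M" .
  have "distr (M \<Otimes>\<^sub>M N) borel snd = N"
  proof (rule measure_eqI)
    fix A assume "A \<in> sets (distr (M \<Otimes>\<^sub>M N) borel snd)"
    hence A: "A \<in> sets N" using assms by simp
    have "emeasure (distr (M \<Otimes>\<^sub>M N) borel snd) A = emeasure (M \<Otimes>\<^sub>M N) (space M \<times> A)"
      using A assms(4) sets.sets_into_space[OF A]
      by (subst emeasure_distr) (auto simp: space_pair_measure intro!: arg_cong[where f = "emeasure _"])
    also have "\<dots> = emeasure N A" using A by (simp add: N.emeasure_pair_measure_Times M.emeasure_space_1)
    finally show "emeasure (distr (M \<Otimes>\<^sub>M N) borel snd) A = emeasure N A" .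
  qed (use assms in simp)
  with 1 s MN.prob_space_axioms show ?thesis by (simp add: couplings_def)
qed

lemma second_moment_distr:
  assumes [measurable]: "X \<in> borel_measurable \<Omega>"
  shows "second_moment (distr \<Omega> borel X) = (\<integral>\<^sup>+ w. ennreal ((norm (X w))\<^sup>2) \<partial>\<Omega>)"
  unfolding second_moment_def by (subst nn_integral_distr) auto

text \<open>
  The second moment of a coupling is fixed by its margins. This is why sequences of couplings lose
  no mass of \<open>norm\<^sup>2\<close> at infinity.
\<close>
lemma second_moment_coupling:
  fixes K :: "('a::euclidean_space \<times> 'b::euclidean_space) measure"
  assumes "K \<in> couplings M N"
  shows "second_moment K = second_moment M + second_moment N"
proof -
  have [measurable_cong]: "sets K = sets borel" by (rule couplingsD[OF assms])
  have "second_moment K = (\<integral>\<^sup>+ p. ennreal ((norm (fst p))\<^sup>2) + ennreal ((norm (snd p))\<^sup>2) \<partial>K)"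
    unfolding second_moment_def by (simp add: norm_prod_def ennreal_plus)
  also have "\<dots> = second_moment (distr K borel fst) + second_moment (distr K borel snd)"
    by (subst nn_integral_add) (auto simp: second_moment_distr)
  finally show ?thesis using couplingsD[OF assms] by simp
qed

lemma couplings_P2:
  assumes "M \<in> P2" "N \<in> P2" "K \<in> couplings M N" shows "K \<in> P2"
  using assms second_moment_coupling[OF assms(3)] couplingsD[OF assms(3)] by (auto simp: P2_iff)

lemma transport_cost_le:
  assumes "K \<in> couplings M N"
  shows "transport_cost K \<le> 2 * (second_moment M + second_moment N)"
proof -
  have [measurable_cong]: "sets K = sets borel" by (rule couplingsD[OF assms])
  have "transport_cost K \<le> (\<integral>\<^sup>+ p. 2 * ennreal ((norm p)\<^sup>2) \<partial>K)"
    unfolding transport_cost_def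
  proof (rule nn_integral_mono)
    fix p :: "'a \<times> 'a"
    have "(norm (fst p - snd p))\<^sup>2 \<le> (norm (fst p) + norm (snd p))\<^sup>2"
      by (intro power_mono norm_triangle_ineq4) auto
    also have "\<dots> \<le> 2 * ((norm (fst p))\<^sup>2 + (norm (snd p))\<^sup>2)"
      using sum_squares_bound[of "norm (fst p)" "norm (snd p)"] by (simp add: power2_sum)
    also have "(norm (fst p))\<^sup>2 + (norm (snd p))\<^sup>2 = (norm p)\<^sup>2" by (simp add: norm_prod_def)
    finally have "ennreal ((norm (fst p - snd p))\<^sup>2) \<le> ennreal (2 * (norm p)\<^sup>2)" by (rule ennreal_leI)
    also have "\<dots> = 2 * ennreal ((norm p)\<^sup>2)" by (simp add: ennreal_mult)
    finally show "ennreal ((norm (fst p - snd p))\<^sup>2) \<le> 2 * ennreal ((norm p)\<^sup>2)" .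
  qed
  also have "\<dots> = 2 * second_moment K" unfolding second_moment_def by (rule nn_integral_cmult) measurable
  finally show ?thesis using second_moment_coupling[OF assms] by simp
qed

lemma W2sq_le_second_moments:
  assumes "M \<in> P2" "N \<in> P2"
  shows "W2sq M N \<le> 2 * (second_moment M + second_moment N)"
proof -
  have "M \<Otimes>\<^sub>M N \<in> couplings M N" using P2D[OF assms(1)] P2D[OF assms(2)] by (intro product_coupling)
  hence "W2sq M N \<le> transport_cost (M \<Otimes>\<^sub>M N)" unfolding W2sq_def by (rule INF_lower)
  thus ?thesis using transport_cost_le[OF \<open>M \<Otimes>\<^sub>M N \<in> couplings M N\<close>] by simp
qed

lemma W2sq_finite:
  assumes "M \<in> P2" "N \<in> P2" shows "W2sq M N < \<infinity>"
proof -
  have "2 * (second_moment M + second_moment N) < \<infinity>"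
    using P2D(3)[OF assms(1)] P2D(3)[OF assms(2)] by (simp add: ennreal_mult_less_top)
  with W2sq_le_second_moments[OF assms] show ?thesis by (rule le_less_trans)
qed

section \<open>Compactness of the set of couplings\<close>

text \<open>
  Fatou's lemma for the nonnegative functions
  \<open>2 * (norm (V n))\<^sup>2 + 2 * (norm U)\<^sup>2 - (norm (V n - U))\<^sup>2\<close>: their pointwise limit integrates to
  \<open>4 * c\<close>, whereas the integrals are \<open>4 * c\<close> minus the integral that is to vanish.
\<close>
lemma L2_convergence_of_constant_norm:
  fixes V :: "nat \<Rightarrow> 'w \<Rightarrow> 'a::euclidean_space"
  assumes [measurable]: "\<And>n. V n \<in> borel_measurable \<Omega>" "U \<in> borel_measurable \<Omega>"
    and lim: "AE w in \<Omega>. (\<lambda>n. V n w) \<longlonglongrightarrow> U w"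
    and c: "\<And>n. (\<integral>\<^sup>+ w. ennreal ((norm (V n w))\<^sup>2) \<partial>\<Omega>) = c" "(\<integral>\<^sup>+ w. ennreal ((norm (U w))\<^sup>2) \<partial>\<Omega>) = c" "c < \<infinity>"
  shows "(\<lambda>n. \<integral>\<^sup>+ w. ennreal ((norm (V n w - U w))\<^sup>2) \<partial>\<Omega>) \<longlonglongrightarrow> 0"
proof -
  define d where "d n = (\<integral>\<^sup>+ w. ennreal ((norm (V n w - U w))\<^sup>2) \<partial>\<Omega>)" for n
  define g where "g n w = 2 * (norm (V n w))\<^sup>2 + 2 * (norm (U w))\<^sup>2 - (norm (V n w - U w))\<^sup>2" for n w
  have g0: "0 \<le> g n w" for n w
  proof -
    have "(norm (V n w - U w))\<^sup>2 \<le> (norm (V n w) + norm (U w))\<^sup>2"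
      by (intro power_mono norm_triangle_ineq4) auto
    thus ?thesis using sum_squares_bound[of "norm (V n w)" "norm (U w)"] by (simp add: g_def power2_sum)
  qed
  have sum: "(\<integral>\<^sup>+ w. ennreal (g n w) \<partial>\<Omega>) + d n = 4 * c" for n
  proof -
    have "(\<integral>\<^sup>+ w. ennreal (g n w) \<partial>\<Omega>) + d n = (\<integral>\<^sup>+ w. ennreal (g n w) + ennreal ((norm (V n w - U w))\<^sup>2) \<partial>\<Omega>)"
      unfolding d_def g_def by (rule nn_integral_add[symmetric]) measurable
    also have "\<dots> = (\<integral>\<^sup>+ w. 2 * ennreal ((norm (V n w))\<^sup>2) + 2 * ennreal ((norm (U w))\<^sup>2) \<partial>\<Omega>)"
    proof (rule nn_integral_cong)
      fix w
      have "ennreal (g n w) + ennreal ((norm (V n w - U w))\<^sup>2) = ennreal (2 * (norm (V n w))\<^sup>2 + 2 * (norm (U w))\<^sup>2)"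
        by (subst ennreal_plus[symmetric]) (use g0 in \<open>auto simp: g_def\<close>)
      thus "ennreal (g n w) + ennreal ((norm (V n w - U w))\<^sup>2) = 2 * ennreal ((norm (V n w))\<^sup>2) + 2 * ennreal ((norm (U w))\<^sup>2)"
        by (simp add: ennreal_plus ennreal_mult)
    qed
    also have "\<dots> = 2 * c + 2 * c" by (simp add: nn_integral_add nn_integral_cmult c)
    finally show ?thesis by (simp flip: distrib_right)
  qed
  have dfin: "d n \<le> 4 * c" for n using sum[of n] by (metis add.commute le_iff_add)
  have "4 * c = (\<integral>\<^sup>+ w. ennreal (4 * (norm (U w))\<^sup>2) \<partial>\<Omega>)"
    by (simp add: ennreal_mult nn_integral_cmult c)
  also have "\<dots> = (\<integral>\<^sup>+ w. liminf (\<lambda>n. ennreal (g n w)) \<partial>\<Omega>)"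
  proof (rule nn_integral_cong_AE, use lim in eventually_elim)
    fix w assume l: "(\<lambda>n. V n w) \<longlonglongrightarrow> U w"
    have "(\<lambda>n. g n w) \<longlonglongrightarrow> 2 * (norm (U w))\<^sup>2 + 2 * (norm (U w))\<^sup>2 - (norm (U w - U w))\<^sup>2"
      unfolding g_def by (intro tendsto_intros l)
    hence "(\<lambda>n. ennreal (g n w)) \<longlonglongrightarrow> ennreal (4 * (norm (U w))\<^sup>2)" by (intro tendsto_ennrealI) simp
    thus "ennreal (4 * (norm (U w))\<^sup>2) = liminf (\<lambda>n. ennreal (g n w))"
      by (simp add: lim_imp_Liminf)
  qed
  also have "\<dots> \<le> liminf (\<lambda>n. \<integral>\<^sup>+ w. ennreal (g n w) \<partial>\<Omega>)"
    unfolding g_def by (rule nn_integral_liminf) measurable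
  finally have fatou: "4 * c \<le> liminf (\<lambda>n. \<integral>\<^sup>+ w. ennreal (g n w) \<partial>\<Omega>)" .
  define c' where "c' = enn2real (4 * c)"
  define d' where "d' n = enn2real (d n)" for n
  have cfin: "4 * c < \<infinity>" using c(3) by (simp add: ennreal_mult_less_top)
  have c': "4 * c = ennreal c'" and d': "d n = ennreal (d' n)" for n
    using cfin dfin[of n] by (auto simp: c'_def d'_def ennreal_enn2real_if top_unique)
  have gint: "(\<integral>\<^sup>+ w. ennreal (g n w) \<partial>\<Omega>) = ennreal (c' - d' n)" for n
  proof -
    have "(\<integral>\<^sup>+ w. ennreal (g n w) \<partial>\<Omega>) = 4 * c - d n"
      using sum[of n] d'[of n] by (metis ennreal_add_diff_cancel_right ennreal_neq_top infinity_ennreal_def)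
    thus ?thesis unfolding c' d' by (simp add: ennreal_minus d'_def)
  qed
  have "d' \<longlonglongrightarrow> 0"
  proof (rule LIMSEQ_I)
    fix e :: real assume e: "e > 0"
    have "\<forall>\<^sub>F n in sequentially. d' n < e"
    proof (cases "c' < e")
      case True
      have "d' n < e" for n using dfin[of n] True unfolding c' d' by (simp add: d'_def c'_def)
      thus ?thesis by simp
    next
      case False
      hence "ennreal (c' - e) < ennreal c'" using e by (simp add: ennreal_less_iff)
      also have "\<dots> \<le> liminf (\<lambda>n. ennreal (c' - d' n))" using fatou unfolding gint c' .
      finally have "\<forall>\<^sub>F n in sequentially. ennreal (c' - e) < ennreal (c' - d' n)"
        by (rule less_LiminfD)
      thus ?thesis by eventually_elim (use False in \<open>auto simp: ennreal_less_iff\<close>)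
    qed
    thus "\<exists>no. \<forall>n\<ge>no. norm (d' n - 0) < e"
      by (auto simp: eventually_sequentially d'_def)
  qed
  hence "(\<lambda>n. ennreal (d' n)) \<longlonglongrightarrow> ennreal 0" by (rule tendsto_ennrealI)
  thus ?thesis unfolding d'[symmetric] d_def by simp
qed

text \<open>
  The codes of the couplings are probability measures on the unit interval, so a subsequence
  converges weakly and is represented by pointwise convergent variables. Decoding is continuous
  except where a coordinate escapes to infinity. That has probability zero in the limit, since each
  coordinate belongs to one of the two factors and so has the same law along the whole sequence.
\<close>
lemma coupling_compactness:
  fixes K :: "nat \<Rightarrow> ('a::euclidean_space \<times> 'b::euclidean_space) measure"
  assumes M: "M \<in> P2" and N: "N \<in> P2" and K: "\<And>n. K n \<in> couplings M N"
  shows "\<exists>r L G. strict_mono (r :: nat \<Rightarrow> nat) \<and> L \<in> couplings M N \<and>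
    (\<forall>n. G n \<in> couplings (K (r n)) L) \<and> (\<lambda>n. transport_cost (G n)) \<longlonglongrightarrow> 0"
proof -
  have [measurable_cong]: "sets (K n) = sets borel" for n by (rule couplingsD[OF K])
  have prK: "prob_space (K n)" for n by (rule couplingsD[OF K])
  \<comment> \<open>The coordinates, squeezed into the open unit interval.\<close>
  define u :: "nat \<Rightarrow> 'a \<times> 'b \<Rightarrow> real" where "u i v = 1/2 + arctan (v \<bullet> from_nat_into Basis i) / pi" for i v
  have u01: "0 < u i v" "u i v < 1" for i v
    using arctan_lbound[of "v \<bullet> from_nat_into Basis i"] arctan_ubound[of "v \<bullet> from_nat_into Basis i"] pi_gt_zero
    by (auto simp: u_def field_simps)
  have u_meas: "u i \<in> borel_measurable borel" for i
    unfolding u_def by (intro borel_measurable_continuous_onI continuous_intros) auto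
  have "\<exists>e D. e \<in> borel_measurable borel \<and> (\<forall>v. e v \<in> {0..1::real}) \<and>
      (\<forall>i. continuous_on UNIV (D i)) \<and> (\<forall>i v. D i (e v) = u i v)"
    by (rule borel_section_of_continuous_decoders) (use u_meas u01 in \<open>auto intro: less_imp_le\<close>)
  then obtain e D where e[measurable]: "e \<in> borel_measurable borel" and e01: "\<And>v. e v \<in> {0..1::real}"
    and D: "\<And>i. continuous_on UNIV (D i)" and De: "\<And>i v. D i (e v) = u i v"
    by blast
  have D_meas[measurable]: "D i \<in> borel_measurable borel" for i
    by (rule borel_measurable_continuous_onI[OF D])
  define idx where "idx b = to_nat_on (Basis :: ('a \<times> 'b) set) b" for b
  have idx: "from_nat_into Basis (idx b) = b" if "b \<in> Basis" for b :: "'a \<times> 'b"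
    unfolding idx_def using that by (intro from_nat_into_to_nat_on countable_finite) auto
  define F :: "real \<Rightarrow> 'a \<times> 'b" where "F s = (\<Sum>b\<in>Basis. tan (pi * (D (idx b) s - 1/2)) *\<^sub>R b)" for s
  have F_meas[measurable]: "F \<in> borel_measurable borel"
    unfolding F_def tan_def by measurable
  have Fe: "F (e v) = v" for v
  proof -
    have "F (e v) = (\<Sum>b\<in>Basis. (v \<bullet> b) *\<^sub>R b)"
      unfolding F_def De by (rule sum.cong) (auto simp: u_def idx tan_arctan)
    thus ?thesis by (simp add: euclidean_representation)
  qed
  define \<mu> where "\<mu> n = distr (K n) borel e" for n
  have rd: "real_distribution (\<mu> n)" for n
    unfolding \<mu>_def by (rule prob_space.real_distribution_distr[OF prK]) measurable
  have "tight \<mu>"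
    unfolding tight_def
  proof (intro conjI allI impI rd)
    fix \<epsilon> :: real assume "\<epsilon> > 0"
    have "measure (\<mu> n) {-1<..1} = 1" for n
    proof -
      have "e -` {-1<..1} \<inter> space (K n) = space (K n)"
      proof -
        have "-1 < e v \<and> e v \<le> 1" for v using e01[of v] by auto
        thus ?thesis by auto
      qed
      thus ?thesis unfolding \<mu>_def using prob_space.prob_space[OF prK] by (subst measure_distr) auto
    qed
    thus "\<exists>a b. a < b \<and> (\<forall>n. 1 - \<epsilon> < measure (\<mu> n) {a<..b})" using \<open>\<epsilon> > 0\<close>
      by (intro exI[of _ "-1"] exI[of _ 1]) auto
  qed
  from tight_imp_convergent_subsubsequence[OF this strict_mono_id] obtain r Q
    where r: "strict_mono r" and Q: "real_distribution Q" and wc: "weak_conv_m (\<lambda>n. \<mu> (r n)) Q"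
    by (auto simp: comp_def)
  from Skorohod[of "\<lambda>n. \<mu> (r n)", OF rd Q wc] obtain \<Omega> :: "real measure" and Y Z where
    sk: "prob_space \<Omega> \<and> (\<forall>n. Y n \<in> measurable \<Omega> borel) \<and> (\<forall>n. distr \<Omega> borel (Y n) = \<mu> (r n)) \<and>
      Z \<in> measurable \<Omega> lborel \<and> distr \<Omega> borel Z = Q \<and> (\<forall>w\<in>space \<Omega>. (\<lambda>n. Y n w) \<longlonglongrightarrow> Z w)"
    by (elim exE)
  have \<Omega>: "prob_space \<Omega>" and Y[measurable]: "\<And>n. Y n \<in> borel_measurable \<Omega>"
    and lawY: "\<And>n. distr \<Omega> borel (Y n) = \<mu> (r n)" and Z: "Z \<in> borel_measurable \<Omega>"
    and lim: "\<And>w. w \<in> space \<Omega> \<Longrightarrow> (\<lambda>n. Y n w) \<longlonglongrightarrow> Z w"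
    using sk by (simp_all add: measurable_lborel2)
  note Z[measurable]
  define V where "V n w = F (Y n w)" for n w
  define U where "U w = F (Z w)" for w
  have VU[measurable]: "V n \<in> borel_measurable \<Omega>" "U \<in> borel_measurable \<Omega>" for n
    unfolding V_def U_def by measurable
  have transfer: "distr \<Omega> borel (\<lambda>w. f (Y n w)) = distr (K (r n)) borel (\<lambda>v. f (e v))"
    if [measurable]: "f \<in> borel_measurable borel" for f :: "real \<Rightarrow> 'c::topological_space" and n
  proof -
    have "distr \<Omega> borel (\<lambda>w. f (Y n w)) = distr (distr \<Omega> borel (Y n)) borel f"
      by (subst distr_distr) (auto simp: comp_def)
    also have "\<dots> = distr (K (r n)) borel (\<lambda>v. f (e v))"
      unfolding lawY \<mu>_def by (subst distr_distr) (auto simp: comp_def)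
    finally show ?thesis .
  qed
  have lawV: "distr \<Omega> borel (V n) = K (r n)" for n
  proof -
    have "distr \<Omega> borel (V n) = distr (K (r n)) borel (\<lambda>v. v)"
      unfolding V_def transfer[OF F_meas] Fe ..
    also have "\<dots> = K (r n)" by (rule distr_id2) (simp add: couplingsD[OF K])
    finally show ?thesis .
  qed
  \<comment> \<open>A coordinate depends on one factor only, so its law does not vary with the coupling.\<close>
  have lawu: "distr (K n) borel (u (idx b)) = distr (K 0) borel (u (idx b))" if b: "b \<in> Basis" for b n
  proof -
    define h :: "real \<Rightarrow> real" where "h s = 1/2 + arctan s / pi" for s
    have h[measurable]: "h \<in> borel_measurable borel"
      unfolding h_def by (intro borel_measurable_continuous_onI continuous_intros) auto
    have uh: "u (idx b) = (\<lambda>v. h (v \<bullet> b))" by (simp add: fun_eq_iff u_def h_def idx[OF b])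
    show ?thesis
    proof (cases "snd b = 0")
      case True
      have "distr (K n) borel (u (idx b)) = distr M borel (\<lambda>x. h (x \<bullet> fst b))" for n
        unfolding couplingsD(3)[OF K[of n], symmetric]
        by (subst distr_distr) (auto simp: uh comp_def inner_prod_def True)
      thus ?thesis by simp
    next
      case False
      hence F0: "fst b = 0" using b by (auto simp: Basis_prod_def)
      have "distr (K n) borel (u (idx b)) = distr N borel (\<lambda>x. h (x \<bullet> snd b))" for n
        unfolding couplingsD(4)[OF K[of n], symmetric]
        by (subst distr_distr) (auto simp: uh comp_def inner_prod_def F0)
      thus ?thesis by simp
    qed
  qed
  \<comment> \<open>The limit stays off the values 0 and 1, which code infinite coordinates.\<close>
  have AE01: "AE w in \<Omega>. 0 < D (idx b) (Z w) \<and> D (idx b) (Z w) < 1" if b: "b \<in> Basis" for b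
  proof -
    have lawZ: "distr \<Omega> borel (\<lambda>w. D (idx b) (Z w)) = distr (K 0) borel (u (idx b))"
    proof (rule distr_limit_of_constant_law[OF \<Omega>])
      show "distr \<Omega> borel (\<lambda>w. D (idx b) (Y n w)) = distr (K 0) borel (u (idx b))" for n
        unfolding transfer[OF D_meas] De using lawu[OF b, of "r n"] by simp
      show "AE w in \<Omega>. (\<lambda>n. D (idx b) (Y n w)) \<longlonglongrightarrow> D (idx b) (Z w)"
      proof (rule AE_I2)
        fix w assume "w \<in> space \<Omega>"
        have "isCont (D (idx b)) (Z w)" using D by (simp add: continuous_on_eq_continuous_at)
        thus "(\<lambda>n. D (idx b) (Y n w)) \<longlonglongrightarrow> D (idx b) (Z w)"
          by (rule isCont_tendsto_compose[OF _ lim[OF \<open>w \<in> space \<Omega>\<close>]])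
      qed
    qed measurable
    have "AE s in distr \<Omega> borel (\<lambda>w. D (idx b) (Z w)). 0 < s \<and> s < 1"
      unfolding lawZ using u_meas by (subst AE_distr_iff) (auto simp: u01)
    thus ?thesis by (subst (asm) AE_distr_iff) auto
  qed
  have "AE w in \<Omega>. \<forall>b\<in>Basis. 0 < D (idx b) (Z w) \<and> D (idx b) (Z w) < 1"
    by (rule AE_finite_allI) (use AE01 in auto)
  hence limV: "AE w in \<Omega>. (\<lambda>n. V n w) \<longlonglongrightarrow> U w"
    using AE_space
  proof eventually_elim
    case (elim w)
    have "(\<lambda>n. tan (pi * (D (idx b) (Y n w) - 1/2)) *\<^sub>R b) \<longlonglongrightarrow> tan (pi * (D (idx b) (Z w) - 1/2)) *\<^sub>R b"
      if b: "b \<in> Basis" for b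
    proof -
      have "isCont (D (idx b)) (Z w)" using D by (simp add: continuous_on_eq_continuous_at)
      hence l: "(\<lambda>n. D (idx b) (Y n w)) \<longlonglongrightarrow> D (idx b) (Z w)"
        by (rule isCont_tendsto_compose[OF _ lim[OF elim(2)]])
      have "- (pi / 2) < pi * (D (idx b) (Z w) - 1/2)" "pi * (D (idx b) (Z w) - 1/2) < pi / 2"
        using elim(1) b by (auto simp: field_simps)
      from cos_gt_zero_pi[OF this] have "cos (pi * (D (idx b) (Z w) - 1/2)) \<noteq> 0" by simp
      thus ?thesis by (intro tendsto_scaleR tendsto_const isCont_tendsto_compose[OF isCont_tan] tendsto_mult tendsto_diff l)
    qed
    thus ?case unfolding V_def U_def F_def by (rule tendsto_sum)
  qed
  define L where "L = distr \<Omega> borel U"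
  have "distr \<Omega> borel (\<lambda>w. fst (U w)) = M"
  proof (rule distr_limit_of_constant_law[OF \<Omega>])
    show "distr \<Omega> borel (\<lambda>w. fst (V n w)) = M" for n
      using couplingsD(3)[OF K[of "r n"]] unfolding lawV[symmetric]
      by (subst (asm) distr_distr) (auto simp: comp_def)
    show "AE w in \<Omega>. (\<lambda>n. fst (V n w)) \<longlonglongrightarrow> fst (U w)"
      using limV by eventually_elim (rule tendsto_fst)
  qed measurable
  moreover have "distr \<Omega> borel (\<lambda>w. snd (U w)) = N"
  proof (rule distr_limit_of_constant_law[OF \<Omega>])
    show "distr \<Omega> borel (\<lambda>w. snd (V n w)) = N" for n
      using couplingsD(4)[OF K[of "r n"]] unfolding lawV[symmetric]
      by (subst (asm) distr_distr) (auto simp: comp_def)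
    show "AE w in \<Omega>. (\<lambda>n. snd (V n w)) \<longlonglongrightarrow> snd (U w)"
      using limV by eventually_elim (rule tendsto_snd)
  qed measurable
  ultimately have L: "L \<in> couplings M N"
    using coupling_of_variables[OF \<Omega>, of "\<lambda>w. fst (U w)" "\<lambda>w. snd (U w)"] by (simp add: L_def)
  define G where "G n = distr \<Omega> borel (\<lambda>w. (V n w, U w))" for n
  have "G n \<in> couplings (K (r n)) L" for n
    using coupling_of_variables[OF \<Omega> VU] unfolding lawV L_def G_def .
  moreover have "(\<lambda>n. transport_cost (G n)) \<longlonglongrightarrow> 0"
    unfolding G_def transport_cost_of_variables[OF VU]
  proof (rule L2_convergence_of_constant_norm[OF VU limV])
    show "(\<integral>\<^sup>+ w. ennreal ((norm (V n w))\<^sup>2) \<partial>\<Omega>) = second_moment M + second_moment N" for n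
      using second_moment_coupling[OF K[of "r n"]] unfolding lawV[symmetric] by (simp add: second_moment_distr)
    show "(\<integral>\<^sup>+ w. ennreal ((norm (U w))\<^sup>2) \<partial>\<Omega>) = second_moment M + second_moment N"
      using second_moment_coupling[OF L] by (simp add: L_def second_moment_distr)
    show "second_moment M + second_moment N < \<infinity>" using P2D(3)[OF M] P2D(3)[OF N] by simp
  qed
  ultimately show ?thesis using r L by blast
qed

text \<open>
  This weighted inequality takes the place of Minkowski's inequality in \<open>L\<^sup>2\<close>: with
  \<open>\<delta>\<close> tending to 0 it shows that a perturbation of vanishing cost does not change a cost in the limit.
\<close>
lemma norm_add_power2_le:
  fixes u v :: "'a::real_inner"
  assumes "\<delta> > 0"
  shows "(norm (u + v))\<^sup>2 \<le> (1 + \<delta>) * (norm u)\<^sup>2 + (1 + 1/\<delta>) * (norm v)\<^sup>2"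
proof -
  have "2 * (norm u * norm v) \<le> \<delta> * (norm u)\<^sup>2 + (norm v)\<^sup>2 / \<delta>"
    using sum_squares_bound[of "sqrt \<delta> * norm u" "norm v / sqrt \<delta>"] assms
    by (simp add: power_mult_distrib power_divide)
  moreover have "(norm (u + v))\<^sup>2 \<le> (norm u + norm v)\<^sup>2" by (intro power_mono norm_triangle_ineq) auto
  ultimately show ?thesis by (simp add: power2_sum algebra_simps)
qed

lemma ennreal_combination:
  assumes "0 \<le> a" "0 \<le> b" "0 \<le> x" "0 \<le> y"
  shows "ennreal (a * x + b * y) = ennreal a * ennreal x + ennreal b * ennreal y"
  using assms by (simp add: ennreal_mult)

lemma ennreal_le_of_factors:
  fixes x y :: ennreal
  assumes "\<And>\<delta>::real. \<delta> > 0 \<Longrightarrow> x \<le> ennreal (1 + \<delta>) * y"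
  shows "x \<le> y"
proof (cases "y = \<infinity>")
  case False
  then obtain y' where y: "y = ennreal y'" "y' \<ge> 0" by (cases y) auto
  have "(\<lambda>n. (1 + 1 / real (Suc n)) * y') \<longlonglongrightarrow> (1 + 0) * y'"
    by (intro tendsto_intros LIMSEQ_Suc lim_1_over_n)
  hence "(\<lambda>n. ennreal ((1 + 1 / real (Suc n)) * y')) \<longlonglongrightarrow> ennreal y'" by (intro tendsto_ennrealI) simp
  hence "(\<lambda>n. ennreal (1 + 1 / real (Suc n)) * y) \<longlonglongrightarrow> y" by (simp add: y ennreal_mult)
  thus ?thesis by (rule LIMSEQ_le_const) (use assms in auto)
qed simp

lemma le_of_limits_with_factors:
  fixes x y :: ennreal
  assumes x: "f \<longlonglongrightarrow> x" and y: "h \<longlonglongrightarrow> y" and g: "g \<longlonglongrightarrow> 0" and fin: "y < \<infinity>"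
    and le: "\<And>(\<delta>::real) n. \<delta> > 0 \<Longrightarrow> f n \<le> ennreal (1 + \<delta>) * h n + ennreal (2 * (1 + 1/\<delta>)) * g n"
  shows "x \<le> y"
proof (rule ennreal_le_of_factors)
  fix \<delta> :: real assume \<delta>: "\<delta> > 0"
  have "(\<lambda>n. ennreal (1 + \<delta>) * h n + ennreal (2 * (1 + 1/\<delta>)) * g n) \<longlonglongrightarrow>
      ennreal (1 + \<delta>) * y + ennreal (2 * (1 + 1/\<delta>)) * 0"
    by (intro tendsto_add ennreal_tendsto_cmult y g) auto
  hence "(\<lambda>n. ennreal (1 + \<delta>) * h n + ennreal (2 * (1 + 1/\<delta>)) * g n) \<longlonglongrightarrow> ennreal (1 + \<delta>) * y" by simp
  with x show "x \<le> ennreal (1 + \<delta>) * y" by (rule LIMSEQ_le) (use le[OF \<delta>] in auto)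
qed

text \<open>
  Take the limit of a minimising sequence. The cost of a coupling changes little under a small
  perturbation in \<open>W2\<close> of the coupling itself, viewed as a measure on the product space.
\<close>
lemma optimal_coupling_exists:
  fixes M N :: "'a::euclidean_space measure"
  assumes "M \<in> P2" "N \<in> P2"
  shows "\<exists>K\<in>couplings M N. transport_cost K = W2sq M N"
proof -
  have "couplings M N \<noteq> {}" using product_coupling P2D[OF assms(1)] P2D[OF assms(2)] by blast
  then obtain f :: "nat \<Rightarrow> ennreal" where f: "decseq f" "range f \<subseteq> transport_cost ` couplings M N"
    and inf: "W2sq M N = (INF i. f i)"
    using ennreal_Inf_countable_INF[of "transport_cost ` couplings M N"] unfolding W2sq_def by auto
  have lim: "f \<longlonglongrightarrow> W2sq M N" unfolding inf by (rule LIMSEQ_INF[OF f(1)])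
  have "\<forall>n. \<exists>K. K \<in> couplings M N \<and> transport_cost K = f n"
    using f(2) by (simp add: image_subset_iff image_iff Bex_def) metis
  then obtain K where K: "\<And>n. K n \<in> couplings M N" "\<And>n. transport_cost (K n) = f n"
    by metis
  obtain r L G where r: "strict_mono (r::nat\<Rightarrow>nat)" and L: "L \<in> couplings M N"
    and G: "\<And>n. G n \<in> couplings (K (r n)) L" and G0: "(\<lambda>n. transport_cost (G n)) \<longlonglongrightarrow> 0"
    using coupling_compactness[OF assms, of K] K(1) by blast
  have "transport_cost L \<le> W2sq M N"
  proof (rule le_of_limits_with_factors[OF tendsto_const LIMSEQ_subseq_LIMSEQ[OF lim r] G0 W2sq_finite[OF assms]])
    fix \<delta> :: real and n assume \<delta>: "\<delta> > 0"
    have [measurable_cong]: "sets (G n) = sets borel" by (rule couplingsD[OF G])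
    have 1: "transport_cost L = (\<integral>\<^sup>+ p. ennreal ((norm (fst (snd p) - snd (snd p)))\<^sup>2) \<partial>G n)"
      unfolding couplingsD(4)[OF G[of n], symmetric] transport_cost_def by (subst nn_integral_distr) auto
    have 2: "transport_cost (K (r n)) = (\<integral>\<^sup>+ p. ennreal ((norm (fst (fst p) - snd (fst p)))\<^sup>2) \<partial>G n)"
      unfolding couplingsD(3)[OF G[of n], symmetric] transport_cost_def by (subst nn_integral_distr) auto
    have "transport_cost L \<le> (\<integral>\<^sup>+ p. ennreal (1 + \<delta>) * ennreal ((norm (fst (fst p) - snd (fst p)))\<^sup>2) +
        ennreal (2 * (1 + 1/\<delta>)) * ennreal ((norm (fst p - snd p))\<^sup>2) \<partial>G n)"
      unfolding 1
    proof (rule nn_integral_mono)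
      fix p :: "('a \<times> 'a) \<times> 'a \<times> 'a"
      define q where "q = snd p - fst p"
      have "(norm (fst q - snd q))\<^sup>2 \<le> (1 + 1) * (norm (fst q))\<^sup>2 + (1 + 1/1) * (norm (- snd q))\<^sup>2"
        using norm_add_power2_le[of 1 "fst q" "- snd q"] by simp
      also have "\<dots> = 2 * (norm (fst p - snd p))\<^sup>2"
        by (simp add: norm_prod_def q_def norm_minus_commute)
      finally have q: "(norm (fst q - snd q))\<^sup>2 \<le> 2 * (norm (fst p - snd p))\<^sup>2" .
      have "(norm (fst (snd p) - snd (snd p)))\<^sup>2 = (norm ((fst (fst p) - snd (fst p)) + (fst q - snd q)))\<^sup>2"
        by (simp add: q_def algebra_simps)
      also have "\<dots> \<le> (1 + \<delta>) * (norm (fst (fst p) - snd (fst p)))\<^sup>2 + (1 + 1/\<delta>) * (norm (fst q - snd q))\<^sup>2"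
        by (rule norm_add_power2_le[OF \<delta>])
      also have "\<dots> \<le> (1 + \<delta>) * (norm (fst (fst p) - snd (fst p)))\<^sup>2 + 2 * (1 + 1/\<delta>) * (norm (fst p - snd p))\<^sup>2"
        using mult_left_mono[OF q, of "1 + 1/\<delta>"] \<delta> by (simp add: algebra_simps)
      finally have "ennreal ((norm (fst (snd p) - snd (snd p)))\<^sup>2) \<le> ennreal \<dots>" by (rule ennreal_leI)
      also have "\<dots> = ennreal (1 + \<delta>) * ennreal ((norm (fst (fst p) - snd (fst p)))\<^sup>2) +
        ennreal (2 * (1 + 1/\<delta>)) * ennreal ((norm (fst p - snd p))\<^sup>2)"
        by (rule ennreal_combination) (use \<delta> in auto)
      finally show "ennreal ((norm (fst (snd p) - snd (snd p)))\<^sup>2) \<le> \<dots>" .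
    qed
    also have "\<dots> = ennreal (1 + \<delta>) * transport_cost (K (r n)) + ennreal (2 * (1 + 1/\<delta>)) * transport_cost (G n)"
      unfolding 2 transport_cost_def[of "G n"] by (simp add: nn_integral_add nn_integral_cmult)
    finally show "transport_cost L \<le> ennreal (1 + \<delta>) * (f \<circ> r) n + ennreal (2 * (1 + 1/\<delta>)) * transport_cost (G n)"
      by (simp add: K(2))
  qed
  moreover have "W2sq M N \<le> transport_cost L" unfolding W2sq_def by (rule INF_lower[OF L])
  ultimately show ?thesis using L by (intro bexI[of _ L]) auto
qed

section \<open>Gluing couplings and the farthest coupling\<close>

lemma small_cells:
  fixes \<epsilon> :: real
  assumes "\<epsilon> > 0"
  shows "\<exists>cell :: 'a::{metric_space, second_countable_topology} \<Rightarrow> nat.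
    cell \<in> measurable borel (count_space UNIV) \<and> (\<forall>x y. cell x = cell y \<longrightarrow> dist x y \<le> \<epsilon>)"
proof -
  obtain D :: "'a set" where D: "countable D" "\<And>X. open X \<Longrightarrow> X \<noteq> {} \<Longrightarrow> \<exists>d\<in>D. d \<in> X"
    using countable_dense_exists by blast
  have "D \<noteq> {}" using D(2)[of UNIV] by auto
  define s where "s = from_nat_into D"
  have ex: "\<exists>n. dist x (s n) < \<epsilon>/2" for x
  proof -
    obtain d where "d \<in> D" "d \<in> ball x (\<epsilon>/2)" using D(2)[of "ball x (\<epsilon>/2)"] assms by auto
    moreover obtain n where "s n = d"
      using \<open>d \<in> D\<close> D(1) from_nat_into_surj[of D d] by (auto simp: s_def)
    ultimately show ?thesis by auto
  qed
  define cell where "cell x = (LEAST n. dist x (s n) < \<epsilon>/2)" for x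
  have "cell \<in> measurable borel (count_space UNIV)"
    unfolding cell_def by (rule measurable_Least) measurable
  moreover have "dist x y \<le> \<epsilon>" if "cell x = cell y" for x y
  proof -
    have "dist x (s (cell x)) < \<epsilon>/2" "dist y (s (cell y)) < \<epsilon>/2"
      unfolding cell_def using LeastI_ex[OF ex] by auto
    thus ?thesis using that dist_triangle2[of x y "s (cell x)"] by simp
  qed
  ultimately show ?thesis by blast
qed

text \<open>
  Couplings of \<open>A, B\<close> and of \<open>B, C\<close> can be put on one probability space such that the two copies of
  the \<open>B\<close>-variable stay within \<open>\<epsilon>\<close> of each other: make the couplings conditionally independent given
  that both copies lie in the same small cell. Exact gluing would call for a disintegration; here
  the joint law has the explicit density \<open>h\<close> with respect to the product.
\<close>
lemma approximate_gluing:
  fixes G :: "('a::euclidean_space \<times> 'b::euclidean_space) measure"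
    and H :: "('b \<times> 'c::euclidean_space) measure"
  assumes G: "G \<in> couplings A B" and H: "H \<in> couplings B C" and \<epsilon>: "\<epsilon> > 0"
  shows "\<exists>\<Theta>\<in>couplings G H. AE w in \<Theta>. dist (snd (fst w)) (fst (snd w)) \<le> \<epsilon>"
proof -
  interpret G: prob_space G by (rule couplingsD[OF G])
  interpret H: prob_space H by (rule couplingsD[OF H])
  interpret GH: pair_prob_space G H ..
  interpret B: prob_space B by (rule couplings_margins[OF G])
  have [measurable_cong]: "sets G = sets borel" "sets H = sets borel"
    using couplingsD[OF G] couplingsD[OF H] by auto
  have sB[measurable_cong]: "sets B = sets borel" using couplings_margins[OF G] by auto
  obtain cell :: "'b \<Rightarrow> nat" where cell[measurable]: "cell \<in> measurable borel (count_space UNIV)"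
    and small: "\<And>x y. cell x = cell y \<Longrightarrow> dist x y \<le> \<epsilon>"
    using small_cells[OF \<epsilon>] by metis
  define p where "p k = measure B {b. cell b = k}" for k
  have cell_set[measurable]: "{b. cell b = k} \<in> sets borel" for k
    using measurable_sets[OF cell, of "{k}"] by (simp add: vimage_def)
  \<comment> \<open>Cells of mass 0, where the density divides by 0, are met with probability 0.\<close>
  have p_pos: "AE b in B. p (cell b) > 0"
  proof -
    have "{b. p (cell b) = 0} = (\<Union>k\<in>{k. p k = 0}. {b. cell b = k})" by auto
    moreover have "{b. cell b = k} \<in> null_sets B" if "p k = 0" for k
      using that cell_set[of k] sB by (simp add: null_sets_def p_def B.emeasure_eq_measure)
    ultimately have "{b. p (cell b) = 0} \<in> null_sets B"
      by (simp only:) (intro null_sets_UN' countableI_type, auto)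
    from AE_not_in[OF this] show ?thesis
      by eventually_elim (simp add: p_def zero_less_measure_iff measure_nonneg order_less_le)
  qed
  define h where "h w = (if cell (snd (fst w)) = cell (fst (snd w)) then ennreal (1 / p (cell (snd (fst w)))) else 0)"
    for w :: "('a \<times> 'b) \<times> 'b \<times> 'c"
  have [measurable]: "p \<in> measurable (count_space UNIV) borel" by simp
  have spGH: "space G = UNIV" "space H = UNIV"
    using sets_eq_imp_space_eq[OF \<open>sets G = sets borel\<close>] sets_eq_imp_space_eq[OF \<open>sets H = sets borel\<close>] by simp_all
  have sets_GH: "sets (G \<Otimes>\<^sub>M H) = sets borel"
    using sets_pair_measure_cong[OF \<open>sets G = sets borel\<close> \<open>sets H = sets borel\<close>] unfolding borel_prod .
  have if_meas: "(\<lambda>w. if c w = c' w then ennreal (1 / p (c w)) else 0) \<in> borel_measurable borel"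
    if [measurable]: "c \<in> measurable borel (count_space UNIV)" "c' \<in> measurable borel (count_space UNIV)"
    for c c' :: "('a \<times> 'b) \<times> 'b \<times> 'c \<Rightarrow> nat"
  proof (rule measurable_If)
    show "(\<lambda>w. ennreal (1 / p (c w))) \<in> borel_measurable borel"
      by (rule measurable_compose[OF that(1)]) simp
    have "{w. c w = c' w} = (\<Union>k. (c -` {k} \<inter> space borel) \<inter> (c' -` {k} \<inter> space borel))" by auto
    also have "\<dots> \<in> sets borel"
      by (intro sets.countable_UN'' sets.Int measurable_sets[OF that(1)] measurable_sets[OF that(2)]) auto
    finally show "{w \<in> space borel. c w = c' w} \<in> sets borel" by simp
  qed simp
  have cells: "(\<lambda>w :: ('a \<times> 'b) \<times> 'b \<times> 'c. cell (snd (fst w))) \<in> measurable borel (count_space UNIV)"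
    "(\<lambda>w :: ('a \<times> 'b) \<times> 'b \<times> 'c. cell (fst (snd w))) \<in> measurable borel (count_space UNIV)"
    by (intro measurable_compose[OF _ cell] borel_measurable_continuous_onI continuous_intros)+
  have h_borel: "h \<in> borel_measurable borel"
    unfolding h_def by (rule if_meas[OF cells])
  hence h_meas[measurable]: "h \<in> borel_measurable (G \<Otimes>\<^sub>M H)"
    unfolding measurable_cong_sets[OF sets_GH refl] .
  define \<Theta> where "\<Theta> = density (G \<Otimes>\<^sub>M H) h"
  have sets_\<Theta>: "sets \<Theta> = sets borel"
    unfolding \<Theta>_def sets_density by (rule sets_GH)
  have mass: "emeasure B {b. cell b = k} * ennreal (1 / p k) = 1" if "p k > 0" for k
    using that by (simp add: B.emeasure_eq_measure flip: p_def ennreal_mult)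
  have AE_G: "AE g in G. p (cell (snd g)) > 0"
    using p_pos unfolding couplingsD(4)[OF G, symmetric] by (subst (asm) AE_distr_iff) auto
  have AE_H: "AE k in H. p (cell (fst k)) > 0"
    using p_pos unfolding couplingsD(3)[OF H, symmetric] by (subst (asm) AE_distr_iff) auto
  have int1: "(\<integral>\<^sup>+ k. h (g, k) \<partial>H) = 1" if "p (cell (snd g)) > 0" for g
  proof -
    have "(\<integral>\<^sup>+ k. h (g, k) \<partial>H) = (\<integral>\<^sup>+ k. indicator {b. cell b = cell (snd g)} (fst k) * ennreal (1 / p (cell (snd g))) \<partial>H)"
      by (rule nn_integral_cong) (auto simp: h_def indicator_def)
    also have "\<dots> = (\<integral>\<^sup>+ b. indicator {b. cell b = cell (snd g)} b * ennreal (1 / p (cell (snd g))) \<partial>B)"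
      unfolding couplingsD(3)[OF H, symmetric] by (subst nn_integral_distr) auto
    also have "\<dots> = emeasure B {b. cell b = cell (snd g)} * ennreal (1 / p (cell (snd g)))"
      by (subst nn_integral_multc) (auto simp: sB)
    finally show ?thesis using mass[OF that] by simp
  qed
  have int2: "(\<integral>\<^sup>+ g. h (g, k) \<partial>G) = 1" if "p (cell (fst k)) > 0" for k
  proof -
    have "(\<integral>\<^sup>+ g. h (g, k) \<partial>G) = (\<integral>\<^sup>+ g. indicator {b. cell b = cell (fst k)} (snd g) * ennreal (1 / p (cell (fst k))) \<partial>G)"
      by (rule nn_integral_cong) (auto simp: h_def indicator_def)
    also have "\<dots> = (\<integral>\<^sup>+ b. indicator {b. cell b = cell (fst k)} b * ennreal (1 / p (cell (fst k))) \<partial>B)"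
      unfolding couplingsD(4)[OF G, symmetric] by (subst nn_integral_distr) auto
    also have "\<dots> = emeasure B {b. cell b = cell (fst k)} * ennreal (1 / p (cell (fst k)))"
      by (subst nn_integral_multc) (auto simp: sB)
    finally show ?thesis using mass[OF that] by simp
  qed
  have [measurable_cong]: "sets \<Theta> = sets (G \<Otimes>\<^sub>M H)" by (simp add: \<Theta>_def)
  have first: "distr \<Theta> borel fst = G"
  proof (rule measure_eqI)
    fix S assume "S \<in> sets (distr \<Theta> borel fst)"
    hence S[measurable]: "S \<in> sets borel" by simp
    have "emeasure (distr \<Theta> borel fst) S = (\<integral>\<^sup>+ w. indicator S (fst w) \<partial>\<Theta>)"
      by (subst nn_integral_indicator[symmetric], simp, subst nn_integral_distr) (auto simp: sets_\<Theta>)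
    also have "\<dots> = (\<integral>\<^sup>+ w. h w * indicator S (fst w) \<partial>(G \<Otimes>\<^sub>M H))"
      unfolding \<Theta>_def by (rule nn_integral_density) measurable
    also have "\<dots> = (\<integral>\<^sup>+ g. (\<integral>\<^sup>+ k. h (g, k) * indicator S g \<partial>H) \<partial>G)"
      by (subst H.nn_integral_fst[symmetric]) auto
    also have "\<dots> = (\<integral>\<^sup>+ g. indicator S g \<partial>G)"
    proof (rule nn_integral_cong_AE, use AE_G in eventually_elim)
      fix g :: "'a \<times> 'b" assume g: "p (cell (snd g)) > 0"
      show "(\<integral>\<^sup>+ k. h (g, k) * indicator S g \<partial>H) = indicator S g"
        using int1[OF g] measurable_Pair2[OF h_meas, of g] by (subst nn_integral_multc) (auto simp: spGH)
    qed
    finally show "emeasure (distr \<Theta> borel fst) S = emeasure G S" by (simp add: couplingsD(2)[OF G])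
  qed (simp add: couplingsD(2)[OF G])
  have second: "distr \<Theta> borel snd = H"
  proof (rule measure_eqI)
    fix S assume "S \<in> sets (distr \<Theta> borel snd)"
    hence S[measurable]: "S \<in> sets borel" by simp
    have "emeasure (distr \<Theta> borel snd) S = (\<integral>\<^sup>+ w. indicator S (snd w) \<partial>\<Theta>)"
      by (subst nn_integral_indicator[symmetric], simp, subst nn_integral_distr) (auto simp: sets_\<Theta>)
    also have "\<dots> = (\<integral>\<^sup>+ w. h w * indicator S (snd w) \<partial>(G \<Otimes>\<^sub>M H))"
      unfolding \<Theta>_def by (rule nn_integral_density) measurable
    also have "\<dots> = (\<integral>\<^sup>+ k. (\<integral>\<^sup>+ g. h (g, k) * indicator S k \<partial>G) \<partial>H)"
      by (subst GH.nn_integral_snd[symmetric]) auto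
    also have "\<dots> = (\<integral>\<^sup>+ k. indicator S k \<partial>H)"
    proof (rule nn_integral_cong_AE, use AE_H in eventually_elim)
      fix k :: "'b \<times> 'c" assume k: "p (cell (fst k)) > 0"
      show "(\<integral>\<^sup>+ g. h (g, k) * indicator S k \<partial>G) = indicator S k"
        using int2[OF k] measurable_Pair1[OF h_meas, of k] by (subst nn_integral_multc) (auto simp: spGH)
    qed
    finally show "emeasure (distr \<Theta> borel snd) S = emeasure H S" by (simp add: couplingsD(2)[OF H])
  qed (simp add: couplingsD(2)[OF H])
  have "prob_space \<Theta>"
    by (rule prob_space_distrD[of fst _ borel]) (simp_all add: first G.prob_space_axioms sets_\<Theta>)
  hence "\<Theta> \<in> couplings G H" using first second sets_\<Theta> by (simp add: couplings_def)
  moreover have "AE w in \<Theta>. dist (snd (fst w)) (fst (snd w)) \<le> \<epsilon>"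
    unfolding \<Theta>_def by (subst AE_density) (auto simp: h_def split: if_splits intro!: small)
  ultimately show ?thesis by blast
qed

text \<open>
  The triangle inequality for \<open>W2\<close> through \<open>B\<close>, in the weighted form of \<open>norm_add_power2_le\<close>. The
  error \<open>\<epsilon>\<close> of the gluing is sent to 0 at the end.
\<close>
lemma W2sq_perturb_left:
  fixes A B C :: "'a::euclidean_space measure"
  assumes G: "G \<in> couplings A B" and H: "H \<in> couplings B C" and \<delta>: "\<delta> > 0"
  shows "W2sq A C \<le> ennreal (1 + \<delta>) * transport_cost H + ennreal (2 * (1 + 1/\<delta>)) * transport_cost G"
proof -
  define R where "R = ennreal (1 + \<delta>) * transport_cost H + ennreal (2 * (1 + 1/\<delta>)) * transport_cost G"
  have bound: "W2sq A C \<le> R + ennreal (2 * (1 + 1/\<delta>)) * ennreal (\<epsilon>\<^sup>2)" if \<epsilon>: "\<epsilon> > 0" for \<epsilon> :: real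
  proof -
    obtain \<Theta> where \<Theta>: "\<Theta> \<in> couplings G H" and near: "AE w in \<Theta>. dist (snd (fst w)) (fst (snd w)) \<le> \<epsilon>"
      using approximate_gluing[OF G H \<epsilon>] by blast
    interpret prob_space \<Theta> by (rule couplingsD[OF \<Theta>])
    have [measurable_cong]: "sets \<Theta> = sets borel" by (rule couplingsD[OF \<Theta>])
    have lawA: "distr \<Theta> borel (\<lambda>w. fst (fst w)) = A"
      unfolding couplingsD(3)[OF G, symmetric] couplingsD(3)[OF \<Theta>, symmetric]
      by (subst distr_distr) (auto simp: comp_def)
    have lawC: "distr \<Theta> borel (\<lambda>w. snd (snd w)) = C"
      unfolding couplingsD(4)[OF H, symmetric] couplingsD(4)[OF \<Theta>, symmetric]
      by (subst distr_distr) (auto simp: comp_def)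
    have costG: "transport_cost G = (\<integral>\<^sup>+ w. ennreal ((norm (fst (fst w) - snd (fst w)))\<^sup>2) \<partial>\<Theta>)"
      unfolding couplingsD(3)[OF \<Theta>, symmetric] transport_cost_def by (subst nn_integral_distr) auto
    have costH: "transport_cost H = (\<integral>\<^sup>+ w. ennreal ((norm (fst (snd w) - snd (snd w)))\<^sup>2) \<partial>\<Theta>)"
      unfolding couplingsD(4)[OF \<Theta>, symmetric] transport_cost_def by (subst nn_integral_distr) auto
    have "W2sq A C \<le> (\<integral>\<^sup>+ w. ennreal ((norm (fst (fst w) - snd (snd w)))\<^sup>2) \<partial>\<Theta>)"
      by (rule W2sq_le_of_variables[OF prob_space_axioms _ _ lawA lawC]) auto
    also have "\<dots> \<le> (\<integral>\<^sup>+ w. ennreal (1 + \<delta>) * ennreal ((norm (fst (snd w) - snd (snd w)))\<^sup>2) +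
        ennreal (2 * (1 + 1/\<delta>)) * ennreal ((norm (fst (fst w) - snd (fst w)))\<^sup>2 + \<epsilon>\<^sup>2) \<partial>\<Theta>)"
    proof (rule nn_integral_mono_AE, use near in eventually_elim)
      fix w :: "('a \<times> 'a) \<times> 'a \<times> 'a"
      assume w: "dist (snd (fst w)) (fst (snd w)) \<le> \<epsilon>"
      obtain a b b' c where abc: "w = ((a, b), b', c)" by (metis surj_pair)
      have "(norm ((a - b) + (b - b')))\<^sup>2 \<le> 2 * (norm (a - b))\<^sup>2 + 2 * (norm (b - b'))\<^sup>2"
        using norm_add_power2_le[of 1 "a - b" "b - b'"] by simp
      also have "\<dots> \<le> 2 * ((norm (a - b))\<^sup>2 + \<epsilon>\<^sup>2)"
        using power_mono[of "norm (b - b')" \<epsilon> 2] w by (simp add: abc dist_norm)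
      finally have ab: "(norm ((a - b) + (b - b')))\<^sup>2 \<le> 2 * ((norm (a - b))\<^sup>2 + \<epsilon>\<^sup>2)" .
      have "(norm (a - c))\<^sup>2 \<le> (1 + \<delta>) * (norm (b' - c))\<^sup>2 + (1 + 1/\<delta>) * (norm ((a - b) + (b - b')))\<^sup>2"
        using norm_add_power2_le[OF \<delta>, of "b' - c" "(a - b) + (b - b')"] by simp
      also have "\<dots> \<le> (1 + \<delta>) * (norm (b' - c))\<^sup>2 + 2 * (1 + 1/\<delta>) * ((norm (a - b))\<^sup>2 + \<epsilon>\<^sup>2)"
        using mult_left_mono[OF ab, of "1 + 1/\<delta>"] \<delta> by (simp add: algebra_simps)
      finally have "ennreal ((norm (a - c))\<^sup>2) \<le> ennreal \<dots>" by (rule ennreal_leI)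
      also have "\<dots> = ennreal (1 + \<delta>) * ennreal ((norm (b' - c))\<^sup>2) + ennreal (2 * (1 + 1/\<delta>)) * ennreal ((norm (a - b))\<^sup>2 + \<epsilon>\<^sup>2)"
        by (rule ennreal_combination) (use \<delta> in auto)
      finally show "ennreal ((norm (fst (fst w) - snd (snd w)))\<^sup>2) \<le> ennreal (1 + \<delta>) * ennreal ((norm (fst (snd w) - snd (snd w)))\<^sup>2) +
        ennreal (2 * (1 + 1/\<delta>)) * ennreal ((norm (fst (fst w) - snd (fst w)))\<^sup>2 + \<epsilon>\<^sup>2)"
        by (simp only: abc fst_conv snd_conv)
    qed
    also have "\<dots> = ennreal (1 + \<delta>) * transport_cost H + ennreal (2 * (1 + 1/\<delta>)) * (transport_cost G + ennreal (\<epsilon>\<^sup>2))"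
      unfolding costG costH by (simp add: nn_integral_add nn_integral_cmult emeasure_space_1)
    also have "\<dots> = R + ennreal (2 * (1 + 1/\<delta>)) * ennreal (\<epsilon>\<^sup>2)" by (simp only: R_def distrib_left add.assoc)
    finally show ?thesis .
  qed
  have "(\<lambda>n. R + ennreal (2 * (1 + 1/\<delta>)) * ennreal ((1 / real (Suc n))\<^sup>2)) \<longlonglongrightarrow> R + ennreal (2 * (1 + 1/\<delta>)) * ennreal (0\<^sup>2)"
    by (intro tendsto_add tendsto_const ennreal_tendsto_cmult tendsto_ennrealI tendsto_power LIMSEQ_Suc lim_1_over_n) auto
  hence "(\<lambda>n. R + ennreal (2 * (1 + 1/\<delta>)) * ennreal ((1 / real (Suc n))\<^sup>2)) \<longlonglongrightarrow> R" by simp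
  hence "W2sq A C \<le> R" by (rule LIMSEQ_le_const) (use bound in auto)
  thus ?thesis by (simp add: R_def)
qed

text \<open>
  Along a maximising sequence that converges to \<open>L\<close>, the triangle inequality bounds the distances to
  \<open>P\<close> by the one of \<open>L\<close> up to a vanishing error.
\<close>
lemma W2sq_maximal_coupling:
  fixes M :: "'a::euclidean_space measure" and N :: "'b::euclidean_space measure"
  assumes M: "M \<in> P2" and N: "N \<in> P2" and P: "P \<in> P2"
  shows "\<exists>L\<in>couplings M N. \<forall>K\<in>couplings M N. W2sq K P \<le> W2sq L P"
proof -
  define S where "S = (SUP K\<in>couplings M N. W2sq K P)"
  have "couplings M N \<noteq> {}" using product_coupling P2D[OF M] P2D[OF N] by blast
  then obtain f :: "nat \<Rightarrow> ennreal" where f: "incseq f" "range f \<subseteq> (\<lambda>K. W2sq K P) ` couplings M N"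
    and sup: "S = (SUP i. f i)"
    using ennreal_Sup_countable_SUP[of "(\<lambda>K. W2sq K P) ` couplings M N"] unfolding S_def by auto
  have lim: "f \<longlonglongrightarrow> S" unfolding sup by (rule LIMSEQ_SUP[OF f(1)])
  have "\<forall>n. \<exists>K. K \<in> couplings M N \<and> W2sq K P = f n"
    using f(2) by (simp add: image_subset_iff image_iff Bex_def) metis
  then obtain K where K: "\<And>n. K n \<in> couplings M N" "\<And>n. W2sq (K n) P = f n"
    by metis
  obtain r L G where r: "strict_mono (r::nat\<Rightarrow>nat)" and L: "L \<in> couplings M N"
    and G: "\<And>n. G n \<in> couplings (K (r n)) L" and G0: "(\<lambda>n. transport_cost (G n)) \<longlonglongrightarrow> 0"
    using coupling_compactness[OF M N, of K] K(1) by blast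
  have LP2: "L \<in> P2" by (rule couplings_P2[OF M N L])
  obtain H where H: "H \<in> couplings L P" "transport_cost H = W2sq L P"
    using optimal_coupling_exists[OF LP2 P] by blast
  have "S \<le> W2sq L P"
  proof (rule le_of_limits_with_factors[OF LIMSEQ_subseq_LIMSEQ[OF lim r] tendsto_const G0 W2sq_finite[OF LP2 P]])
    fix \<delta> :: real and n assume \<delta>: "\<delta> > 0"
    show "(f \<circ> r) n \<le> ennreal (1 + \<delta>) * W2sq L P + ennreal (2 * (1 + 1/\<delta>)) * transport_cost (G n)"
      using W2sq_perturb_left[OF G[of n] H(1) \<delta>] by (simp only: H(2) K(2) comp_apply)
  qed
  moreover have "W2sq K P \<le> S" if "K \<in> couplings M N" for K
    unfolding S_def by (rule SUP_upper[OF that])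
  ultimately show ?thesis using L by (meson order_trans)
qed

section \<open>The standard Gaussian measure\<close>

text \<open>
  The density is a function of the norm, of exponential type in its square. This accounts for both
  the rotation invariance and the product structure of the standard Gaussian.
\<close>
lemma std_gaussian_density_norm:
  fixes x :: "'a::euclidean_space"
  shows "(\<Prod>b\<in>Basis. std_normal_density (x \<bullet> b)) = (1 / sqrt (2 * pi)) ^ DIM('a) * exp (- (norm x)\<^sup>2 / 2)"
proof -
  have "(norm x)\<^sup>2 = (\<Sum>b\<in>Basis. (x \<bullet> b)\<^sup>2)"
    unfolding power2_norm_eq_inner by (subst euclidean_inner) (simp add: power2_eq_square)
  hence "exp (- (norm x)\<^sup>2 / 2) = (\<Prod>b\<in>Basis. exp (- (x \<bullet> b)\<^sup>2 / 2))"
    by (simp add: sum_negf sum_divide_distrib flip: exp_sum)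
  thus ?thesis by (simp add: std_normal_density_def prod_dividef power_divide)
qed

lemma sets_std_gaussian [measurable_cong, simp]: "sets std_gaussian = sets borel"
  by (simp add: std_gaussian_def)

lemma nn_integral_std_gaussian:
  assumes [measurable]: "f \<in> borel_measurable borel"
  shows "(\<integral>\<^sup>+ x. f x \<partial>std_gaussian) =
    (\<integral>\<^sup>+ x. ennreal (\<Prod>b\<in>Basis. std_normal_density (x \<bullet> b)) * f x \<partial>lborel)"
  unfolding std_gaussian_def by (rule nn_integral_density) measurable

lemma null_sets_std_gaussian: "A \<in> null_sets lborel \<Longrightarrow> A \<in> null_sets std_gaussian"
  unfolding std_gaussian_def
  by (rule absolutely_continuousI_density[unfolded absolutely_continuous_def, THEN subsetD]) auto

lemma nn_integral_std_normal: "(\<integral>\<^sup>+ t. ennreal (std_normal_density t) \<partial>lborel) = 1"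
  using prob_space.emeasure_space_1[OF prob_space_normal_density[of 1 0]]
  by (simp add: emeasure_density)

lemma nn_integral_std_normal_square: "(\<integral>\<^sup>+ t. ennreal (std_normal_density t * t\<^sup>2) \<partial>lborel) < \<infinity>"
  using integrable_std_normal_moment[of 2] by (simp add: integrable_iff_bounded)

lemma std_gaussian_P2: "(std_gaussian :: 'a::euclidean_space measure) \<in> P2"
proof -
  have "emeasure (std_gaussian :: 'a measure) UNIV = (\<integral>\<^sup>+ x. 1 \<partial>(std_gaussian :: 'a measure))"
    by (simp add: sets_eq_imp_space_eq[OF sets_std_gaussian])
  also have "\<dots> = (\<integral>\<^sup>+ x. (\<Prod>b\<in>Basis. ennreal (std_normal_density (x \<bullet> b))) \<partial>(lborel :: 'a measure))"
    by (subst nn_integral_std_gaussian) (auto simp: prod_ennreal)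
  also have "\<dots> = 1"
    by (subst nn_integral_lborel_prod) (auto simp: nn_integral_std_normal)
  finally have pr: "prob_space (std_gaussian :: 'a measure)"
    by (intro prob_spaceI) (simp add: sets_eq_imp_space_eq[OF sets_std_gaussian])
  have coord: "(\<integral>\<^sup>+ x. ennreal ((x \<bullet> b)\<^sup>2) \<partial>(std_gaussian :: 'a measure)) < \<infinity>" if b: "b \<in> Basis" for b :: 'a
  proof -
    define f where "f c t = (if c = b then ennreal (std_normal_density t * t\<^sup>2) else ennreal (std_normal_density t))" for c :: 'a and t
    have "(\<integral>\<^sup>+ x. ennreal ((x \<bullet> b)\<^sup>2) \<partial>(std_gaussian :: 'a measure)) =
      (\<integral>\<^sup>+ x. (\<Prod>c\<in>Basis. f c (x \<bullet> c)) \<partial>(lborel :: 'a measure))"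
    proof (subst nn_integral_std_gaussian)
      have "ennreal (\<Prod>c\<in>Basis. std_normal_density (x \<bullet> c)) * ennreal ((x \<bullet> b)\<^sup>2) = (\<Prod>c\<in>Basis. f c (x \<bullet> c))" for x :: 'a
      proof -
        have "(\<Prod>c\<in>Basis - {b}. f c (x \<bullet> c)) = (\<Prod>c\<in>Basis - {b}. ennreal (std_normal_density (x \<bullet> c)))"
          by (rule prod.cong) (auto simp: f_def)
        thus ?thesis using b
          by (simp add: prod.remove[of Basis b] f_def ennreal_mult prod_ennreal prod_nonneg mult_ac)
      qed
      thus "(\<integral>\<^sup>+ x. ennreal (\<Prod>b\<in>Basis. std_normal_density (x \<bullet> b)) * ennreal ((x \<bullet> b)\<^sup>2) \<partial>lborel) =
        (\<integral>\<^sup>+ x. (\<Prod>c\<in>Basis. f c (x \<bullet> c)) \<partial>(lborel :: 'a measure))" by simp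
    qed measurable
    also have "\<dots> = (\<Prod>c\<in>Basis. \<integral>\<^sup>+ t. f c t \<partial>lborel)"
      by (rule nn_integral_lborel_prod) (auto simp: f_def)
    also have "\<dots> < \<infinity>"
    proof -
      have fin: "(\<integral>\<^sup>+ t. f c t \<partial>lborel) < \<infinity>" for c
        using nn_integral_std_normal nn_integral_std_normal_square by (cases "c = b") (simp_all add: f_def)
      have "(\<Prod>c\<in>S. \<integral>\<^sup>+ t. f c t \<partial>lborel) < \<infinity>" if "finite S" for S
        using that
      proof (induction S rule: finite_induct)
        case (insert c S)
        thus ?case using fin[of c] by (simp add: ennreal_mult_less_top)
      qed simp
      thus ?thesis by simp
    qed
    finally show ?thesis .
  qed
  have "second_moment (std_gaussian :: 'a measure) = (\<integral>\<^sup>+ x. (\<Sum>b\<in>Basis. ennreal ((x \<bullet> b)\<^sup>2)) \<partial>(std_gaussian :: 'a measure))"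
    unfolding second_moment_def
  proof (rule nn_integral_cong)
    fix x :: 'a
    have "(norm x)\<^sup>2 = (\<Sum>b\<in>Basis. (x \<bullet> b)\<^sup>2)"
      unfolding power2_norm_eq_inner by (subst euclidean_inner) (simp add: power2_eq_square)
    thus "ennreal ((norm x)\<^sup>2) = (\<Sum>b\<in>Basis. ennreal ((x \<bullet> b)\<^sup>2))" by (simp add: sum_ennreal)
  qed
  also have "\<dots> = (\<Sum>b\<in>Basis. \<integral>\<^sup>+ x. ennreal ((x \<bullet> b)\<^sup>2) \<partial>(std_gaussian :: 'a measure))"
    by (rule nn_integral_sum) measurable
  also have "\<dots> < \<infinity>" using coord by simp
  finally show ?thesis using pr by (simp add: P2_iff)
qed

lemma std_gaussian_pair:
  "std_gaussian \<Otimes>\<^sub>M std_gaussian = (std_gaussian :: ('a::euclidean_space \<times> 'b::euclidean_space) measure)"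
proof -
  have eq: "(\<Prod>b\<in>Basis. std_normal_density (fst z \<bullet> b)) * (\<Prod>b\<in>Basis. std_normal_density (snd z \<bullet> b)) =
     (\<Prod>b\<in>Basis. std_normal_density (z \<bullet> b))" for z :: "'a \<times> 'b"
    unfolding std_gaussian_density_norm
    by (simp add: power_add norm_prod_def exp_add[symmetric] add_divide_distrib[symmetric])
  have "std_gaussian \<Otimes>\<^sub>M std_gaussian = density (lborel \<Otimes>\<^sub>M lborel)
      (\<lambda>(x::'a, y::'b). ennreal (\<Prod>b\<in>Basis. std_normal_density (x \<bullet> b)) * ennreal (\<Prod>b\<in>Basis. std_normal_density (y \<bullet> b)))"
    unfolding std_gaussian_def
  proof (rule pair_measure_density)
    show "sigma_finite_measure (lborel :: 'b measure)" by (rule sigma_finite_lborel)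
    show "sigma_finite_measure (density lborel (\<lambda>x::'b. ennreal (\<Prod>b\<in>Basis. std_normal_density (x \<bullet> b))))"
      using P2D(1)[OF std_gaussian_P2] unfolding std_gaussian_def by (rule prob_space_imp_sigma_finite)
  qed measurable
  also have "\<dots> = std_gaussian"
    unfolding lborel_prod std_gaussian_def
    by (rule density_cong) (auto simp: eq[symmetric] ennreal_mult prod_nonneg case_prod_beta)
  finally show ?thesis .
qed

lemma std_gaussian_coupling:
  "(std_gaussian :: ('a::euclidean_space \<times> 'b::euclidean_space) measure) \<in> couplings std_gaussian std_gaussian"
  unfolding std_gaussian_pair[symmetric]
  by (rule product_coupling) (use P2D(1)[OF std_gaussian_P2] in auto)

lemma orthogonal_transformation_borel:
  fixes f :: "'a::euclidean_space \<Rightarrow> 'a"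
  assumes "orthogonal_transformation f"
  shows "f \<in> borel_measurable borel"
  by (intro borel_measurable_continuous_onI linear_continuous_on linear_conv_bounded_linear[THEN iffD1]
      orthogonal_transformation_linear assms)

lemma orthogonal_transformation_inverse:
  fixes f :: "'a::euclidean_space \<Rightarrow> 'a"
  assumes "orthogonal_transformation f"
  shows "\<exists>g. orthogonal_transformation g \<and> (\<forall>x. g (f x) = x) \<and> (\<forall>x. f (g x) = x)"
  using orthogonal_transformation_inv[OF assms] orthogonal_transformation_inj[OF assms]
    orthogonal_transformation_surj[OF assms]
  by (intro exI[of _ "inv f"]) (auto simp: surj_f_inv_f)

text \<open>
  The image \<open>\<nu>\<close> of Lebesgue measure is again translation invariant and gives the unit ball \<open>B\<close> the
  same mass. Evaluating the double integral of \<open>indicator A x * indicator B (x - y)\<close> over \<open>\<nu>\<close> in \<open>x\<close>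
  and Lebesgue measure in \<open>y\<close> in both orders gives \<open>\<nu> A * vol B = vol A * \<nu> B\<close>.
\<close>
lemma distr_lborel_orthogonal:
  fixes f :: "'a::euclidean_space \<Rightarrow> 'a"
  assumes f: "orthogonal_transformation f"
  shows "distr lborel borel f = lborel"
proof -
  have lin: "linear f" using f by (rule orthogonal_transformation_linear)
  have [measurable]: "f \<in> borel_measurable borel" by (rule orthogonal_transformation_borel[OF f])
  define \<nu> where "\<nu> = distr lborel borel f"
  have [measurable_cong]: "sets \<nu> = sets borel" by (simp add: \<nu>_def)
  define B where "B = ball (0::'a) 1"
  have B: "B \<in> sets borel" by (simp add: B_def)
  have preB: "f -` B = B" using orthogonal_transformation_norm[OF f] by (auto simp: B_def)
  have vB: "emeasure \<nu> B = emeasure lborel B"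
    unfolding \<nu>_def by (subst emeasure_distr) (use B preB in auto)
  have B_pos: "emeasure lborel B \<noteq> 0"
    using content_ball_pos[of 1 "0::'a"] by (auto simp: B_def measure_def)
  have B_fin: "emeasure lborel B < \<infinity>" unfolding B_def by (rule emeasure_lborel_ball_finite)
  obtain g where g: "orthogonal_transformation g" "\<And>x. g (f x) = x" "\<And>x. f (g x) = x"
    using orthogonal_transformation_inverse[OF f] by blast
  have [measurable]: "g \<in> borel_measurable borel" by (rule orthogonal_transformation_borel[OF g(1)])
  have sf: "sigma_finite_measure \<nu>"
  proof (rule sigma_finite_measure_distr)
    show "sigma_finite_measure (distr \<nu> borel g)"
    proof -
      have "distr \<nu> borel g = lborel"
        unfolding \<nu>_def by (subst distr_distr) (auto simp: comp_def g distr_id2)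
      thus ?thesis by (simp add: sigma_finite_lborel)
    qed
  qed measurable
  interpret V: sigma_finite_measure \<nu> by fact
  interpret pair_sigma_finite lborel \<nu> ..
  \<comment> \<open>Translation invariance of \<open>\<nu>\<close>: a shift by \<open>y\<close> after \<open>f\<close> is a shift by \<open>g y\<close> before it.\<close>
  have shift: "(\<integral>\<^sup>+ x. h (x + y) \<partial>\<nu>) = (\<integral>\<^sup>+ x. h x \<partial>\<nu>)"
    if [measurable]: "h \<in> borel_measurable borel" for h :: "'a \<Rightarrow> ennreal" and y
  proof -
    have "(\<integral>\<^sup>+ x. h (x + y) \<partial>\<nu>) = (\<integral>\<^sup>+ x. h (f x + f (g y)) \<partial>lborel)"
      unfolding \<nu>_def by (subst nn_integral_distr) (auto simp: g)
    also have "\<dots> = (\<integral>\<^sup>+ x. h (f (g y + x)) \<partial>lborel)" by (simp add: linear_add[OF lin] add.commute)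
    also have "\<dots> = (\<integral>\<^sup>+ x. h (f x) \<partial>distr lborel borel ((+) (g y)))"
      by (subst nn_integral_distr) auto
    also have "\<dots> = (\<integral>\<^sup>+ x. h x \<partial>\<nu>)"
      unfolding lborel_distr_plus \<nu>_def by (subst nn_integral_distr) auto
    finally show ?thesis .
  qed
  have "emeasure \<nu> A = emeasure lborel A" if A[measurable]: "A \<in> sets borel" for A
  proof -
    have [measurable]: "B \<in> sets borel" by (rule B)
    have "emeasure \<nu> A * emeasure lborel B = (\<integral>\<^sup>+ x. indicator A x * (\<integral>\<^sup>+ y. indicator B (x - y) \<partial>lborel) \<partial>\<nu>)"
    proof -
      have "(\<integral>\<^sup>+ y. indicator B (x - y) \<partial>lborel) = emeasure lborel B" for x
      proof -
        have "(\<integral>\<^sup>+ y. indicator B (x - y) \<partial>lborel) = (\<integral>\<^sup>+ y. indicator B (y - x) \<partial>lborel)"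
          by (rule nn_integral_cong) (auto simp: B_def indicator_def norm_minus_commute)
        also have "\<dots> = (\<integral>\<^sup>+ y. indicator B (y - x) \<partial>distr lborel borel ((+) x))"
          by (simp only: lborel_distr_plus)
        also have "\<dots> = emeasure lborel B" by (subst nn_integral_distr) auto
        finally show ?thesis .
      qed
      thus ?thesis by (simp add: nn_integral_multc)
    qed
    also have "\<dots> = (\<integral>\<^sup>+ x. (\<integral>\<^sup>+ y. indicator A x * indicator B (x - y) \<partial>lborel) \<partial>\<nu>)"
      by (simp add: nn_integral_cmult)
    also have "\<dots> = (\<integral>\<^sup>+ y. (\<integral>\<^sup>+ x. indicator A x * indicator B (x - y) \<partial>\<nu>) \<partial>lborel)"
      by (rule Fubini') measurable
    also have "\<dots> = (\<integral>\<^sup>+ y. (\<integral>\<^sup>+ x. indicator A (x + y) * indicator B x \<partial>\<nu>) \<partial>lborel)"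
    proof (rule nn_integral_cong)
      fix y :: 'a
      show "(\<integral>\<^sup>+ x. indicator A x * indicator B (x - y) \<partial>\<nu>) = (\<integral>\<^sup>+ x. indicator A (x + y) * indicator B x \<partial>\<nu>)"
        using shift[of "\<lambda>x. indicator A x * indicator B (x - y)" y] by simp
    qed
    also have "\<dots> = (\<integral>\<^sup>+ x. (\<integral>\<^sup>+ y. indicator A (x + y) * indicator B x \<partial>lborel) \<partial>\<nu>)"
      by (rule Fubini'[symmetric]) measurable
    also have "\<dots> = (\<integral>\<^sup>+ x. emeasure lborel A * indicator B x \<partial>\<nu>)"
    proof (rule nn_integral_cong)
      fix x :: 'a
      have "(\<integral>\<^sup>+ y. indicator A (x + y) \<partial>lborel) = (\<integral>\<^sup>+ y. indicator A y \<partial>distr lborel borel ((+) x))"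
        by (subst nn_integral_distr) auto
      also have "\<dots> = emeasure lborel A" by (simp add: lborel_distr_plus)
      finally show "(\<integral>\<^sup>+ y. indicator A (x + y) * indicator B x \<partial>lborel) = emeasure lborel A * indicator B x"
        by (simp add: nn_integral_multc)
    qed
    also have "\<dots> = emeasure lborel A * emeasure lborel B"
      by (simp add: nn_integral_cmult vB)
    finally have "emeasure \<nu> A * emeasure lborel B / emeasure lborel B = emeasure lborel A * emeasure lborel B / emeasure lborel B"
      by simp
    thus ?thesis using B_pos B_fin by (simp add: ennreal_mult_divide_eq)
  qed
  thus ?thesis unfolding \<nu>_def[symmetric] by (intro measure_eqI) (auto simp: \<nu>_def)
qed

lemma distr_std_gaussian_orthogonal:
  fixes f :: "'a::euclidean_space \<Rightarrow> 'a"
  assumes f: "orthogonal_transformation f"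
  shows "distr std_gaussian borel f = std_gaussian"
proof (rule measure_eqI)
  have [measurable]: "f \<in> borel_measurable borel" by (rule orthogonal_transformation_borel[OF f])
  define d where "d x = ennreal (\<Prod>b\<in>Basis. std_normal_density (x \<bullet> b))" for x :: 'a
  have [measurable]: "d \<in> borel_measurable borel" unfolding d_def by measurable
  have df: "d (f x) = d x" for x
    unfolding d_def std_gaussian_density_norm using orthogonal_transformation_norm[OF f] by simp
  fix A assume "A \<in> sets (distr std_gaussian borel f)"
  hence A[measurable]: "A \<in> sets borel" by simp
  have "emeasure (distr std_gaussian borel f) A = (\<integral>\<^sup>+ x. indicator A (f x) \<partial>std_gaussian)"
    by (subst nn_integral_indicator[symmetric], simp, subst nn_integral_distr) auto
  also have "\<dots> = (\<integral>\<^sup>+ x. d (f x) * indicator A (f x) \<partial>lborel)"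
    by (subst nn_integral_std_gaussian) (auto simp: df, simp add: d_def)
  also have "\<dots> = (\<integral>\<^sup>+ x. d x * indicator A x \<partial>distr lborel borel f)"
    by (subst nn_integral_distr) auto
  also have "\<dots> = (\<integral>\<^sup>+ x. indicator A x \<partial>std_gaussian)"
    unfolding distr_lborel_orthogonal[OF f] by (subst nn_integral_std_gaussian) (auto simp: d_def)
  finally show "emeasure (distr std_gaussian borel f) A = emeasure std_gaussian A" by simp
qed simp

section \<open>A coupling other than the product\<close>

text \<open>
  If every event has probability 0 or 1, then for each \<open>n\<close> some cell of diameter at most \<open>1/n\<close> has
  probability 1; these cells meet in a single point, which carries all the mass.
\<close>
lemma nontrivial_event:
  fixes M :: "'a::euclidean_space measure"
  assumes "M \<in> P2_nondeg"
  shows "\<exists>A\<in>sets borel. 0 < measure M A \<and> measure M A < 1"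
proof (rule ccontr)
  assume neg: "\<not> ?thesis"
  have "M \<in> P2" and nondeg: "\<nexists>x. M = return borel x" using assms by (auto simp: P2_nondeg_def)
  interpret prob_space M by (rule P2D(1)[OF \<open>M \<in> P2\<close>])
  have sM[measurable_cong, simp]: "sets M = sets borel" by (rule P2D[OF \<open>M \<in> P2\<close>])
  have spM[simp]: "space M = UNIV" using sets_eq_imp_space_eq[OF sM] by simp
  have zero_one: "prob A = 0 \<or> prob A = 1" if "A \<in> sets borel" for A
    using neg that prob_le_1[of A] measure_nonneg[of M A] by (metis less_eq_real_def)
  have "\<exists>C. (AE y in M. y \<in> C) \<and> (\<forall>y\<in>C. \<forall>z\<in>C. dist y z \<le> 1 / real (Suc n))" for n
  proof -
    obtain cell :: "'a \<Rightarrow> nat" where cell: "cell \<in> measurable borel (count_space UNIV)"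
      and small: "\<And>x y. cell x = cell y \<Longrightarrow> dist x y \<le> 1 / real (Suc n)"
      using small_cells[of "1 / real (Suc n)"] by auto
    have sets_cell: "cell -` {k} \<in> sets borel" for k
      using measurable_sets[OF cell, of "{k}"] by simp
    have "\<exists>k. prob (cell -` {k}) \<noteq> 0"
    proof (rule ccontr)
      assume "\<not> ?thesis"
      hence "(\<Union>k. cell -` {k}) \<in> null_sets M"
        using sets_cell by (intro null_sets_UN) (auto simp: null_sets_def emeasure_eq_measure)
      moreover have "(\<Union>k. cell -` {k}) = space M" by auto
      ultimately show False using emeasure_space_1 by (auto simp: null_sets_def)
    qed
    then obtain k where "prob (cell -` {k}) = 1" using zero_one[OF sets_cell] by blast
    hence "AE y in M. y \<in> cell -` {k}" using sets_cell[of k] by (intro AE_prob_1) auto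
    thus ?thesis using small by (intro exI[of _ "cell -` {k}"]) auto
  qed
  then obtain C where C: "\<And>n. AE y in M. y \<in> C n"
    and small: "\<And>n y z. y \<in> C n \<Longrightarrow> z \<in> C n \<Longrightarrow> dist y z \<le> 1 / real (Suc n)"
    by metis
  have all: "AE y in M. \<forall>n. y \<in> C n" using C by (simp add: AE_all_countable)
  have "\<exists>x. \<forall>n. x \<in> C n"
  proof (rule ccontr)
    assume no: "\<not> (\<exists>x. \<forall>n. x \<in> C n)"
    have "AE y in M. False" using all by eventually_elim (use no in blast)
    thus False by simp
  qed
  then obtain x where x: "\<And>n. x \<in> C n" by blast
  have AEx: "AE y in M. y = x"
    using all
  proof eventually_elim
    case (elim y)
    have "dist y x \<le> 1 / real (Suc n)" for n using small x elim by blast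
    hence "dist y x \<le> 0"
      by (intro LIMSEQ_le_const[OF LIMSEQ_Suc[OF lim_1_over_n]]) auto
    thus ?case by simp
  qed
  have "M = return borel x"
  proof (rule measure_eqI)
    fix A assume "A \<in> sets M"
    hence A: "A \<in> sets borel" by simp
    have "emeasure M A = (\<integral>\<^sup>+ y. indicator A y \<partial>M)" using A by simp
    also have "\<dots> = (\<integral>\<^sup>+ y. indicator A x \<partial>M)"
      by (rule nn_integral_cong_AE, use AEx in eventually_elim) simp
    finally show "emeasure M A = emeasure (return borel x) A" using A emeasure_space_1 by simp
  qed simp
  with nondeg show False by blast
qed

text \<open>
  Choose events \<open>A\<close>, \<open>B\<close> with probabilities strictly between 0 and 1 and perturb the product by
  the density \<open>1 + (1\<^sub>A - M A) * (1\<^sub>B - N B)\<close>. The perturbation integrates to 0 in each variable, so the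
  margins are kept, but \<open>A \<times> B\<close> gains mass.
\<close>
lemma non_product_coupling:
  fixes M :: "'a::euclidean_space measure" and N :: "'b::euclidean_space measure"
  assumes M: "M \<in> P2_nondeg" and N: "N \<in> P2_nondeg"
  shows "\<exists>K\<in>couplings M N. K \<noteq> M \<Otimes>\<^sub>M N"
proof -
  have MP: "M \<in> P2" and NP: "N \<in> P2" using M N by (auto simp: P2_nondeg_def)
  interpret M: prob_space M by (rule P2D(1)[OF MP])
  interpret N: prob_space N by (rule P2D(1)[OF NP])
  interpret MN: pair_prob_space M N ..
  have sM[measurable_cong]: "sets M = sets borel" and sN[measurable_cong]: "sets N = sets borel"
    using P2D[OF MP] P2D[OF NP] by auto
  have spM: "space M = UNIV" and spN: "space N = UNIV"
    using sets_eq_imp_space_eq[OF sM] sets_eq_imp_space_eq[OF sN] by auto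
  have sMN: "sets (M \<Otimes>\<^sub>M N) = sets borel"
    using sets_pair_measure_cong[OF sM sN] unfolding borel_prod .
  obtain A where A[measurable]: "A \<in> sets borel" and A01: "0 < measure M A" "measure M A < 1"
    using nontrivial_event[OF M] by blast
  obtain B where B[measurable]: "B \<in> sets borel" and B01: "0 < measure N B" "measure N B < 1"
    using nontrivial_event[OF N] by blast
  define f where "f x = indicator A x - measure M A" for x :: 'a
  define g where "g y = indicator B y - measure N B" for y :: 'b
  have [measurable]: "f \<in> borel_measurable borel" "g \<in> borel_measurable borel"
    unfolding f_def g_def by measurable
  have f1: "\<bar>f x\<bar> \<le> 1" for x using A01 by (auto simp: f_def indicator_def)
  have g1: "\<bar>g y\<bar> \<le> 1" for y using B01 by (auto simp: g_def indicator_def)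
  have fg: "0 \<le> 1 + f x * g y" for x y
  proof -
    have "\<bar>f x * g y\<bar> \<le> 1" using mult_mono[OF f1[of x] g1[of y]] by (simp add: abs_mult)
    thus ?thesis by linarith
  qed
  have fint: "integrable M f" by (rule M.integrable_const_bound[of _ 1]) (use f1 in auto)
  have gint: "integrable N g" by (rule N.integrable_const_bound[of _ 1]) (use g1 in auto)
  have f0: "(\<integral>x. f x \<partial>M) = 0"
    unfolding f_def using A sM
    by (subst Bochner_Integration.integral_diff) (simp_all add: M.prob_space M.emeasure_eq_measure)
  have g0: "(\<integral>y. g y \<partial>N) = 0"
    unfolding g_def using B sN
    by (subst Bochner_Integration.integral_diff) (simp_all add: N.prob_space N.emeasure_eq_measure)
  define h where "h z = ennreal (1 + f (fst z) * g (snd z))" for z :: "'a \<times> 'b"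
  have [measurable]: "h \<in> borel_measurable (M \<Otimes>\<^sub>M N)" unfolding h_def by measurable
  define K where "K = density (M \<Otimes>\<^sub>M N) h"
  have sK: "sets K = sets borel" unfolding K_def sets_density by (rule sMN)
  have [measurable_cong]: "sets K = sets (M \<Otimes>\<^sub>M N)" by (simp add: K_def)
  have inner1: "(\<integral>\<^sup>+ y. h (x, y) \<partial>N) = 1" for x
  proof -
    have "(\<integral>\<^sup>+ y. h (x, y) \<partial>N) = ennreal (\<integral>y. 1 + f x * g y \<partial>N)"
      unfolding h_def fst_conv snd_conv
      by (rule nn_integral_eq_integral) (use gint fg in auto)
    also have "(\<integral>y. 1 + f x * g y \<partial>N) = 1" using gint g0 by (simp add: N.prob_space)
    finally show ?thesis by simp
  qed
  have inner2: "(\<integral>\<^sup>+ x. h (x, y) \<partial>M) = 1" for y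
  proof -
    have "(\<integral>\<^sup>+ x. h (x, y) \<partial>M) = ennreal (\<integral>x. 1 + f x * g y \<partial>M)"
      unfolding h_def fst_conv snd_conv
      by (rule nn_integral_eq_integral) (use fint fg in auto)
    also have "(\<integral>x. 1 + f x * g y \<partial>M) = 1" using fint f0 by (simp add: M.prob_space)
    finally show ?thesis by simp
  qed
  have hx: "(\<lambda>y. h (x, y)) \<in> borel_measurable N" for x unfolding h_def by measurable
  have hy: "(\<lambda>x. h (x, y)) \<in> borel_measurable M" for y unfolding h_def by measurable
  have first: "distr K borel fst = M"
  proof (rule measure_eqI)
    fix S assume "S \<in> sets (distr K borel fst)"
    hence S[measurable]: "S \<in> sets borel" by simp
    have "emeasure (distr K borel fst) S = (\<integral>\<^sup>+ w. indicator S (fst w) \<partial>K)"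
      by (subst nn_integral_indicator[symmetric], simp, subst nn_integral_distr) auto
    also have "\<dots> = (\<integral>\<^sup>+ w. h w * indicator S (fst w) \<partial>(M \<Otimes>\<^sub>M N))"
      unfolding K_def by (rule nn_integral_density) measurable
    also have "\<dots> = (\<integral>\<^sup>+ x. (\<integral>\<^sup>+ y. h (x, y) * indicator S x \<partial>N) \<partial>M)"
      by (subst N.nn_integral_fst[symmetric]) auto
    also have "\<dots> = (\<integral>\<^sup>+ x. indicator S x \<partial>M)"
      using hx inner1 by (simp add: nn_integral_multc)
    finally show "emeasure (distr K borel fst) S = emeasure M S" by (simp add: sM)
  qed (simp add: sM)
  have second: "distr K borel snd = N"
  proof (rule measure_eqI)
    fix S assume "S \<in> sets (distr K borel snd)"
    hence S[measurable]: "S \<in> sets borel" by simp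
    have "emeasure (distr K borel snd) S = (\<integral>\<^sup>+ w. indicator S (snd w) \<partial>K)"
      by (subst nn_integral_indicator[symmetric], simp, subst nn_integral_distr) auto
    also have "\<dots> = (\<integral>\<^sup>+ w. h w * indicator S (snd w) \<partial>(M \<Otimes>\<^sub>M N))"
      unfolding K_def by (rule nn_integral_density) measurable
    also have "\<dots> = (\<integral>\<^sup>+ y. (\<integral>\<^sup>+ x. h (x, y) * indicator S y \<partial>M) \<partial>N)"
      by (subst MN.nn_integral_snd[symmetric]) auto
    also have "\<dots> = (\<integral>\<^sup>+ y. indicator S y \<partial>N)"
      using hy inner2 by (simp add: nn_integral_multc)
    finally show "emeasure (distr K borel snd) S = emeasure N S" by (simp add: sN)
  qed (simp add: sN)
  have "prob_space K"
    by (rule prob_space_distrD[of fst _ borel]) (simp_all add: first M.prob_space_axioms)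
  hence KC: "K \<in> couplings M N" using first second sK by (simp add: couplings_def)
  have AB: "A \<times> B \<in> sets (M \<Otimes>\<^sub>M N)" by (rule pair_measureI) (simp_all add: sM sN)
  define c where "c = 1 + (1 - measure M A) * (1 - measure N B)"
  have "emeasure K (A \<times> B) = (\<integral>\<^sup>+ w. h w * indicator (A \<times> B) w \<partial>(M \<Otimes>\<^sub>M N))"
    unfolding K_def by (rule emeasure_density) (use AB in auto)
  also have "\<dots> = (\<integral>\<^sup>+ w. ennreal c * indicator (A \<times> B) w \<partial>(M \<Otimes>\<^sub>M N))"
    by (rule nn_integral_cong) (auto simp: h_def f_def g_def c_def indicator_def)
  also have "\<dots> = ennreal c * emeasure (M \<Otimes>\<^sub>M N) (A \<times> B)"
    using AB by (simp add: nn_integral_cmult_indicator)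
  also have "emeasure (M \<Otimes>\<^sub>M N) (A \<times> B) = ennreal (measure M A * measure N B)"
    by (subst N.emeasure_pair_measure_Times)
       (simp_all add: sM sN M.emeasure_eq_measure N.emeasure_eq_measure ennreal_mult)
  finally have KAB: "emeasure K (A \<times> B) = ennreal (c * (measure M A * measure N B))"
    using A01 B01 by (simp add: ennreal_mult c_def)
  have "K \<noteq> M \<Otimes>\<^sub>M N"
  proof
    assume "K = M \<Otimes>\<^sub>M N"
    hence "ennreal (c * (measure M A * measure N B)) = ennreal (measure M A * measure N B)"
      using KAB \<open>emeasure (M \<Otimes>\<^sub>M N) (A \<times> B) = _\<close> by simp
    hence "c * (measure M A * measure N B) = measure M A * measure N B"
      using A01 B01 by (subst (asm) ennreal_inj) (auto simp: c_def)
    thus False using A01 B01 by (simp add: c_def)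
  qed
  with KC show ?thesis by blast
qed

section \<open>Optimal couplings are comonotone\<close>

definition comonotone :: "('a::real_inner \<times> 'a) set \<Rightarrow> bool" where
  "comonotone A \<longleftrightarrow> (\<forall>p\<in>A. \<forall>q\<in>A. 0 \<le> (fst p - fst q) \<bullet> (snd p - snd q))"

text \<open>
  Draw two independent pairs \<open>(x, z)\<close> and \<open>(x', z')\<close> from the optimal coupling. On the symmetric event
  \<open>S\<close> where \<open>(x - x') \<bullet> (z - z') < 0\<close>, replace \<open>x\<close> by \<open>x'\<close>. By symmetry the law of the new
  first component is unchanged, so its joint law with \<open>z\<close> is again a coupling. On \<open>S\<close> the sum of the
  costs of the exchanged pairs is smaller by \<open>- 2 * (x - x') \<bullet> (z - z')\<close>, and optimality forces \<open>S\<close>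
  to be a null set.
\<close>
lemma optimal_coupling_monotone_AE:
  fixes K :: "('a::euclidean_space \<times> 'a) measure"
  assumes M: "M \<in> P2" and N: "N \<in> P2" and K: "K \<in> couplings M N" and opt: "transport_cost K = W2sq M N"
  shows "AE w in K \<Otimes>\<^sub>M K. 0 \<le> (fst (fst w) - fst (snd w)) \<bullet> (snd (fst w) - snd (snd w))"
proof -
  interpret K: prob_space K by (rule couplingsD[OF K])
  interpret KK: pair_prob_space K K ..
  have sK: "sets K = sets borel" by (rule couplingsD[OF K])
  have sKK: "sets (K \<Otimes>\<^sub>M K) = sets borel"
    using sets_pair_measure_cong[OF sK sK] unfolding borel_prod .
  have meas: "f \<in> borel_measurable (K \<Otimes>\<^sub>M K)" if "f \<in> borel_measurable borel" for f :: "_ \<Rightarrow> 'c::topological_space"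
    using that unfolding measurable_cong_sets[OF sKK refl] .
  have contm: "f \<in> borel_measurable (K \<Otimes>\<^sub>M K)" if "continuous_on UNIV f" for f :: "_ \<Rightarrow> 'c::topological_space"
    by (rule meas[OF borel_measurable_continuous_onI[OF that]])
  define x z x' z' where "x w = fst (fst w)" and "z w = snd (fst w)" and "x' w = fst (snd w)" and "z' w = snd (snd w)"
    for w :: "('a \<times> 'a) \<times> 'a \<times> 'a"
  have [measurable]: "x \<in> borel_measurable (K \<Otimes>\<^sub>M K)" "z \<in> borel_measurable (K \<Otimes>\<^sub>M K)"
     "x' \<in> borel_measurable (K \<Otimes>\<^sub>M K)" "z' \<in> borel_measurable (K \<Otimes>\<^sub>M K)"
    unfolding x_def z_def x'_def z'_def by (intro contm continuous_intros)+
  define S where "S = {w. (x w - x' w) \<bullet> (z w - z' w) < 0}"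
  have [measurable]: "Measurable.pred (K \<Otimes>\<^sub>M K) (\<lambda>w. w \<in> S)"
    unfolding S_def mem_Collect_eq by measurable
  define s where "s w = (snd w, fst w)" for w :: "('a \<times> 'a) \<times> 'a \<times> 'a"
  have s: "x (s w) = x' w" "z (s w) = z' w" "x' (s w) = x w" "z' (s w) = z w" for w
    by (simp_all add: s_def x_def z_def x'_def z'_def)
  have sS: "s w \<in> S \<longleftrightarrow> w \<in> S" for w
  proof -
    have "(x' w - x w) \<bullet> (z' w - z w) = (x w - x' w) \<bullet> (z w - z' w)"
      by (simp add: inner_diff_left inner_diff_right)
    thus ?thesis unfolding S_def mem_Collect_eq s by simp
  qed
  have swap: "(\<integral>\<^sup>+ w. f (s w) \<partial>(K \<Otimes>\<^sub>M K)) = (\<integral>\<^sup>+ w. f w \<partial>(K \<Otimes>\<^sub>M K))"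
    if [measurable]: "f \<in> borel_measurable (K \<Otimes>\<^sub>M K)" for f :: "_ \<Rightarrow> ennreal"
  proof -
    have "(\<integral>\<^sup>+ w. f w \<partial>(K \<Otimes>\<^sub>M K)) = (\<integral>\<^sup>+ w. f w \<partial>distr (K \<Otimes>\<^sub>M K) (K \<Otimes>\<^sub>M K) (\<lambda>(x, y). (y, x)))"
      using KK.distr_pair_swap by simp
    also have "\<dots> = (\<integral>\<^sup>+ w. f (s w) \<partial>(K \<Otimes>\<^sub>M K))"
      by (subst nn_integral_distr) (auto simp: s_def case_prod_beta measurable_pair_swap')
    finally show ?thesis ..
  qed
  \<comment> \<open>Integrals over the symmetric set \<open>S\<close> do not change when the two pairs are exchanged.\<close>
  have restr: "(\<integral>\<^sup>+ w. (if w \<in> S then f w else 0) \<partial>(K \<Otimes>\<^sub>M K)) = (\<integral>\<^sup>+ w. (if w \<in> S then f (s w) else 0) \<partial>(K \<Otimes>\<^sub>M K))"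
    if [measurable]: "f \<in> borel_measurable (K \<Otimes>\<^sub>M K)" for f :: "_ \<Rightarrow> ennreal"
    using swap[of "\<lambda>w. if w \<in> S then f w else 0"] by (simp add: sS)
  have firstK: "(\<integral>\<^sup>+ w. f (fst w) \<partial>(K \<Otimes>\<^sub>M K)) = (\<integral>\<^sup>+ p. f p \<partial>K)"
    if [measurable]: "f \<in> borel_measurable K" for f :: "_ \<Rightarrow> ennreal"
    by (subst K.nn_integral_fst[symmetric]) (auto simp: K.emeasure_space_1)
  define X where "X w = (if w \<in> S then x' w else x w)" for w
  have [measurable]: "X \<in> borel_measurable (K \<Otimes>\<^sub>M K)" unfolding X_def by measurable
  have split: "(\<integral>\<^sup>+ w. f w \<partial>(K \<Otimes>\<^sub>M K)) = (\<integral>\<^sup>+ w. (if w \<in> S then f w else 0) \<partial>(K \<Otimes>\<^sub>M K)) + (\<integral>\<^sup>+ w. (if w \<in> S then 0 else f w) \<partial>(K \<Otimes>\<^sub>M K))"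
    if [measurable]: "f \<in> borel_measurable (K \<Otimes>\<^sub>M K)" for f :: "_ \<Rightarrow> ennreal"
    by (subst nn_integral_add[symmetric]) (auto intro!: nn_integral_cong)
  have lawX: "distr (K \<Otimes>\<^sub>M K) borel X = M"
  proof (rule measure_eqI)
    fix A assume "A \<in> sets (distr (K \<Otimes>\<^sub>M K) borel X)"
    hence A[measurable]: "A \<in> sets borel" by simp
    have fstK: "fst \<in> borel_measurable K" unfolding measurable_cong_sets[OF sK refl] by measurable
    have "emeasure (distr (K \<Otimes>\<^sub>M K) borel X) A = (\<integral>\<^sup>+ w. indicator A (X w) \<partial>(K \<Otimes>\<^sub>M K))"
      by (subst nn_integral_indicator[symmetric], simp, subst nn_integral_distr) auto
    also have "\<dots> = (\<integral>\<^sup>+ w. (if w \<in> S then indicator A (x' w) else 0) \<partial>(K \<Otimes>\<^sub>M K)) + (\<integral>\<^sup>+ w. (if w \<in> S then 0 else indicator A (x w)) \<partial>(K \<Otimes>\<^sub>M K))"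
      by (subst split) (auto simp: X_def cong: if_cong)
    also have "(\<integral>\<^sup>+ w. (if w \<in> S then indicator A (x' w) else 0) \<partial>(K \<Otimes>\<^sub>M K)) = (\<integral>\<^sup>+ w. (if w \<in> S then indicator A (x w) else 0) \<partial>(K \<Otimes>\<^sub>M K))"
      by (subst restr) (auto simp: s cong: if_cong)
    also have "\<dots> + (\<integral>\<^sup>+ w. (if w \<in> S then 0 else indicator A (x w)) \<partial>(K \<Otimes>\<^sub>M K)) = (\<integral>\<^sup>+ w. indicator A (x w) \<partial>(K \<Otimes>\<^sub>M K))"
      by (subst split[symmetric]) auto
    also have "\<dots> = (\<integral>\<^sup>+ p. indicator A (fst p) \<partial>K)"
      unfolding x_def using fstK by (subst firstK[symmetric]) auto
    also have "\<dots> = (\<integral>\<^sup>+ p. indicator A p \<partial>distr K borel fst)"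
      using fstK by (subst nn_integral_distr) auto
    also have "\<dots> = emeasure M A"
      unfolding couplingsD(3)[OF K] using P2D(2)[OF M] by simp
    finally show "emeasure (distr (K \<Otimes>\<^sub>M K) borel X) A = emeasure M A" .
  qed (simp add: P2D(2)[OF M])
  have lawz: "distr (K \<Otimes>\<^sub>M K) borel z = N"
  proof (rule measure_eqI)
    fix A assume "A \<in> sets (distr (K \<Otimes>\<^sub>M K) borel z)"
    hence A[measurable]: "A \<in> sets borel" by simp
    have sndK: "snd \<in> borel_measurable K" unfolding measurable_cong_sets[OF sK refl] by measurable
    have "emeasure (distr (K \<Otimes>\<^sub>M K) borel z) A = (\<integral>\<^sup>+ w. indicator A (z w) \<partial>(K \<Otimes>\<^sub>M K))"
      by (subst nn_integral_indicator[symmetric], simp, subst nn_integral_distr) auto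
    also have "\<dots> = (\<integral>\<^sup>+ p. indicator A (snd p) \<partial>K)"
      unfolding z_def using sndK by (subst firstK[symmetric]) auto
    also have "\<dots> = (\<integral>\<^sup>+ p. indicator A p \<partial>distr K borel snd)"
      using sndK by (subst nn_integral_distr) auto
    also have "\<dots> = emeasure N A"
      unfolding couplingsD(4)[OF K] using P2D(2)[OF N] by simp
    finally show "emeasure (distr (K \<Otimes>\<^sub>M K) borel z) A = emeasure N A" .
  qed (simp add: P2D(2)[OF N])
  define a b where "a w = ennreal ((norm (x w - z w))\<^sup>2)" and "b w = ennreal ((norm (x' w - z w))\<^sup>2)" for w
  have [measurable]: "a \<in> borel_measurable (K \<Otimes>\<^sub>M K)" "b \<in> borel_measurable (K \<Otimes>\<^sub>M K)"
    unfolding a_def b_def by measurable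
  have sm[measurable]: "s \<in> measurable (K \<Otimes>\<^sub>M K) (K \<Otimes>\<^sub>M K)"
    using measurable_pair_swap'[of K K] by (simp add: s_def[abs_def] case_prod_beta')
  define Aout Ain Bin where "Aout = (\<integral>\<^sup>+ w. (if w \<in> S then 0 else a w) \<partial>(K \<Otimes>\<^sub>M K))"
    and "Ain = (\<integral>\<^sup>+ w. (if w \<in> S then a w else 0) \<partial>(K \<Otimes>\<^sub>M K))"
    and "Bin = (\<integral>\<^sup>+ w. (if w \<in> S then b w else 0) \<partial>(K \<Otimes>\<^sub>M K))"
  have cost: "transport_cost K = Ain + Aout"
  proof -
    have "(\<lambda>p. ennreal ((norm (fst p - snd p))\<^sup>2)) \<in> borel_measurable K"
      unfolding measurable_cong_sets[OF sK refl] by measurable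
    hence "transport_cost K = (\<integral>\<^sup>+ w. a w \<partial>(K \<Otimes>\<^sub>M K))"
      unfolding transport_cost_def by (subst firstK[symmetric]) (auto simp: a_def[abs_def] x_def z_def)
    thus ?thesis unfolding Ain_def Aout_def by (subst (asm) split) auto
  qed
  have "W2sq M N \<le> (\<integral>\<^sup>+ w. ennreal ((norm (X w - z w))\<^sup>2) \<partial>(K \<Otimes>\<^sub>M K))"
    by (rule W2sq_le_of_variables[OF KK.prob_space_axioms _ _ lawX lawz]) measurable
  also have "\<dots> = Bin + Aout"
    unfolding Bin_def Aout_def
    by (subst split) (auto simp: X_def a_def b_def intro!: arg_cong2[where f = "(+)"] nn_integral_cong)
  finally have le: "Ain + Aout \<le> Bin + Aout" using opt cost by simp
  have fin: "Ain + Aout < \<infinity>" using cost opt W2sq_finite[OF M N] by simp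
  hence AinBin: "Ain \<le> Bin" using le by (auto simp: ennreal_add_left_cancel_le add.commute)
  define d where "d w = ennreal (2 * - ((x w - x' w) \<bullet> (z w - z' w)))" for w
  have [measurable]: "d \<in> borel_measurable (K \<Otimes>\<^sub>M K)" unfolding d_def by measurable
  have pt: "b w + b (s w) + d w = a w + a (s w)" if "w \<in> S" for w
  proof -
    have neg: "(x w - x' w) \<bullet> (z w - z' w) < 0" using that by (simp add: S_def)
    have "(norm (x' w - z w))\<^sup>2 + (norm (x w - z' w))\<^sup>2 + 2 * - ((x w - x' w) \<bullet> (z w - z' w)) =
       (norm (x w - z w))\<^sup>2 + (norm (x' w - z' w))\<^sup>2"
      by (simp add: power2_norm_eq_inner inner_diff_left inner_diff_right inner_commute)
    thus ?thesis unfolding a_def b_def d_def s using neg by (simp flip: ennreal_plus)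
  qed
  have dbl: "(\<integral>\<^sup>+ w. (if w \<in> S then f w + f (s w) else 0) \<partial>(K \<Otimes>\<^sub>M K)) = 2 * (\<integral>\<^sup>+ w. (if w \<in> S then f w else 0) \<partial>(K \<Otimes>\<^sub>M K))"
    if [measurable]: "f \<in> borel_measurable (K \<Otimes>\<^sub>M K)" for f :: "_ \<Rightarrow> ennreal"
  proof -
    have "(\<integral>\<^sup>+ w. (if w \<in> S then f w + f (s w) else 0) \<partial>(K \<Otimes>\<^sub>M K)) =
      (\<integral>\<^sup>+ w. (if w \<in> S then f w else 0) \<partial>(K \<Otimes>\<^sub>M K)) + (\<integral>\<^sup>+ w. (if w \<in> S then f (s w) else 0) \<partial>(K \<Otimes>\<^sub>M K))"
      by (subst nn_integral_add[symmetric]) (auto intro!: nn_integral_cong)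
    thus ?thesis using restr[OF that] by (simp add: mult_2)
  qed
  have "2 * Bin + (\<integral>\<^sup>+ w. (if w \<in> S then d w else 0) \<partial>(K \<Otimes>\<^sub>M K)) = 2 * Ain"
  proof -
    have "2 * Bin + (\<integral>\<^sup>+ w. (if w \<in> S then d w else 0) \<partial>(K \<Otimes>\<^sub>M K)) =
       (\<integral>\<^sup>+ w. (if w \<in> S then b w + b (s w) else 0) + (if w \<in> S then d w else 0) \<partial>(K \<Otimes>\<^sub>M K))"
      unfolding Bin_def by (subst nn_integral_add) (auto simp: dbl)
    also have "\<dots> = (\<integral>\<^sup>+ w. (if w \<in> S then a w + a (s w) else 0) \<partial>(K \<Otimes>\<^sub>M K))"
      by (rule nn_integral_cong) (use pt in auto)
    finally show ?thesis unfolding Ain_def by (subst (asm) dbl[of a]) auto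
  qed
  also have "2 * Ain \<le> 2 * Bin + 0" using AinBin by (simp add: mult_left_mono)
  finally have "(\<integral>\<^sup>+ w. (if w \<in> S then d w else 0) \<partial>(K \<Otimes>\<^sub>M K)) = 0 \<or> 2 * Bin = \<infinity>"
    by (auto simp: ennreal_add_left_cancel_le)
  moreover have "2 * Bin \<noteq> \<infinity>"
  proof -
    have "2 * Bin \<le> 2 * Ain"
      using \<open>2 * Bin + _ = 2 * Ain\<close> by (metis le_iff_add)
    moreover have "2 * Ain < \<infinity>" using fin by (simp add: ennreal_mult_less_top)
    ultimately show ?thesis by auto
  qed
  ultimately have "AE w in K \<Otimes>\<^sub>M K. (if w \<in> S then d w else 0) = 0"
    by (subst nn_integral_0_iff_AE[symmetric]) auto
  thus ?thesis
    by eventually_elim (auto simp: d_def S_def x_def x'_def z_def z'_def not_less split: if_splits)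
qed

definition measure_support :: "'a::topological_space measure \<Rightarrow> 'a set" where
  "measure_support K = {p. \<forall>U. open U \<longrightarrow> p \<in> U \<longrightarrow> emeasure K U \<noteq> 0}"

lemma closed_measure_support: "closed (measure_support K)"
proof -
  have "- measure_support K = \<Union>{U. open U \<and> emeasure K U = 0}" by (auto simp: measure_support_def)
  moreover have "open (\<Union>{U. open U \<and> emeasure K U = 0})" by (rule open_Union) auto
  ultimately show ?thesis by (simp add: closed_def)
qed

lemma AE_measure_support:
  fixes K :: "'a::second_countable_topology measure"
  assumes sK: "sets K = sets borel"
  shows "AE p in K. p \<in> measure_support K"
proof -
  obtain \<B> :: "'a set set" where B: "countable \<B>" "topological_basis \<B>"
    using ex_countable_basis by blast
  have "(\<Union>U\<in>{U \<in> \<B>. emeasure K U = 0}. U) \<in> null_sets K"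
  proof (rule null_sets_UN')
    show "countable {U \<in> \<B>. emeasure K U = 0}" using B(1) by simp
    show "U \<in> null_sets K" if "U \<in> {U \<in> \<B>. emeasure K U = 0}" for U
      using that topological_basis_open[OF B(2), of U] sK by (auto simp: null_sets_def)
  qed
  from AE_not_in[OF this] show ?thesis
  proof eventually_elim
    case (elim p)
    show ?case unfolding measure_support_def
    proof (intro CollectI allI impI notI)
      fix U assume U: "open U" "p \<in> U" "emeasure K U = 0"
      obtain V where V: "V \<in> \<B>" "p \<in> V" "V \<subseteq> U" using topological_basisE[OF B(2) U(1,2)] by blast
      have "emeasure K V \<le> emeasure K U" using V(3) U(1) sK by (intro emeasure_mono) auto
      thus False using elim V U(3) by auto
    qed
  qed
qed

text \<open>
  A violating pair of support points would have product neighbourhoods consisting of violating pairs,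
  and these have positive probability.
\<close>
lemma optimal_coupling_comonotone_support:
  fixes K :: "('a::euclidean_space \<times> 'a) measure"
  assumes M: "M \<in> P2" and N: "N \<in> P2" and K: "K \<in> couplings M N" and opt: "transport_cost K = W2sq M N"
  shows "comonotone (measure_support K)"
  unfolding comonotone_def
proof (intro ballI, rule ccontr)
  fix p q assume p: "p \<in> measure_support K" and q: "q \<in> measure_support K"
    and neg: "\<not> 0 \<le> (fst p - fst q) \<bullet> (snd p - snd q)"
  interpret K: prob_space K by (rule couplingsD[OF K])
  have sK: "sets K = sets borel" by (rule couplingsD[OF K])
  define W where "W = {w :: ('a \<times> 'a) \<times> ('a \<times> 'a). (fst (fst w) - fst (snd w)) \<bullet> (snd (fst w) - snd (snd w)) < 0}"
  have "open W" unfolding W_def by (intro open_Collect_less continuous_intros)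
  moreover have "(p, q) \<in> W" using neg by (simp add: W_def)
  ultimately obtain U V where UV: "open U" "open V" "p \<in> U" "q \<in> V" "U \<times> V \<subseteq> W"
    by (metis open_prod_elim mem_Sigma_iff)
  have "AE w in K \<Otimes>\<^sub>M K. w \<notin> U \<times> V"
    using optimal_coupling_monotone_AE[OF M N K opt]
    by eventually_elim (use UV(5) in \<open>force simp: W_def\<close>)
  hence "emeasure (K \<Otimes>\<^sub>M K) (U \<times> V) = 0"
    using UV(1,2) sK by (subst (asm) AE_iff_measurable[where N = "U \<times> V"])
      (auto simp: space_pair_measure sets_eq_imp_space_eq[OF sK])
  hence "emeasure K U * emeasure K V = 0"
    using UV(1,2) sK by (subst (asm) K.emeasure_pair_measure_Times) auto
  thus False using p q UV by (auto simp: measure_support_def)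
qed

section \<open>Comonotone sets are single-valued almost everywhere\<close>

text \<open>
  A closed set is a countable union of compact sets. This makes projections of closed sets Borel,
  although projections of Borel sets need not be.
\<close>
lemma closed_image_borel:
  fixes f :: "'a::euclidean_space \<Rightarrow> 'b::euclidean_space"
  assumes "closed A" "continuous_on UNIV f"
  shows "f ` A \<in> sets borel"
proof -
  have "f ` A = (\<Union>n. f ` (A \<inter> cball 0 (real n)))"
  proof -
    have "A = (\<Union>n. A \<inter> cball 0 (real n))"
      using real_arch_simple by (auto simp: dist_norm)
    thus ?thesis by (metis image_UN)
  qed
  moreover have "compact (f ` (A \<inter> cball 0 (real n)))" for n
    by (intro compact_continuous_image closed_Int_compact assms compact_cball continuous_on_subset[OF assms(2)]) auto
  ultimately show ?thesis by (simp only:) (intro sets.countable_UN'' borel_compact, auto)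
qed

text \<open>
  By translation invariance the volume of \<open>A\<close> equals the mean over \<open>t\<close> in the unit interval of the
  volume of \<open>A\<close> shifted by \<open>t *\<^sub>R b\<close>; exchange the integrals.
\<close>
lemma null_set_of_countable_lines:
  fixes A :: "'a::euclidean_space set"
  assumes A: "A \<in> sets borel" and lines: "\<And>z. countable {t. z + t *\<^sub>R b \<in> A}"
  shows "A \<in> null_sets lborel"
proof -
  have [measurable]: "A \<in> sets borel" by (rule A)
  have "emeasure lborel A = (\<integral>\<^sup>+ t. emeasure lborel A * indicator {0..1} t \<partial>(lborel :: real measure))"
    by (simp add: nn_integral_cmult)
  also have "\<dots> = (\<integral>\<^sup>+ t. (\<integral>\<^sup>+ z. indicator A (z + t *\<^sub>R b) * indicator {0..1} t \<partial>lborel) \<partial>lborel)"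
  proof (rule nn_integral_cong)
    fix t :: real
    have "emeasure lborel A = (\<integral>\<^sup>+ z. indicator A z \<partial>distr lborel borel ((+) (t *\<^sub>R b)))"
      by (simp add: lborel_distr_plus)
    also have "\<dots> = (\<integral>\<^sup>+ z. indicator A (z + t *\<^sub>R b) \<partial>lborel)"
      by (subst nn_integral_distr) (auto simp: add.commute)
    finally show "emeasure lborel A * indicator {0..1} t = (\<integral>\<^sup>+ z. indicator A (z + t *\<^sub>R b) * indicator {0..1} t \<partial>lborel)"
      by (simp add: nn_integral_multc)
  qed
  also have "\<dots> = (\<integral>\<^sup>+ z. (\<integral>\<^sup>+ t. indicator A (z + t *\<^sub>R b) * indicator {0..1} t \<partial>lborel) \<partial>lborel)"
    by (rule lborel_pair.Fubini') measurable
  also have "\<dots> = (\<integral>\<^sup>+ z. 0 \<partial>(lborel :: 'a measure))"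
  proof (rule nn_integral_cong)
    fix z :: 'a
    have "AE t in lborel. t \<notin> {t. z + t *\<^sub>R b \<in> A}"
      by (rule AE_not_in[OF countable_imp_null_set_lborel[OF lines]])
    hence "(\<integral>\<^sup>+ t. indicator A (z + t *\<^sub>R b) * indicator {0..1} t \<partial>lborel) = (\<integral>\<^sup>+ t. 0 \<partial>(lborel :: real measure))"
      by (intro nn_integral_cong_AE, eventually_elim) auto
    thus "(\<integral>\<^sup>+ t. indicator A (z + t *\<^sub>R b) * indicator {0..1} t \<partial>lborel) = 0" by simp
  qed
  finally show ?thesis using A by (simp add: null_sets_def)
qed

text \<open>
  Two values over the same \<open>z\<close> differ in some coordinate \<open>b\<close>. Over the line through \<open>z\<close> in direction \<open>b\<close>,
  comonotonicity makes the coordinate \<open>x \<bullet> b\<close> an increasing relation of the parameter, so its jumps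
  are disjoint open intervals, and there are only countably many of them.
\<close>
lemma comonotone_multivalued_null:
  fixes A :: "('a::euclidean_space \<times> 'a) set"
  assumes closed: "closed A" and mono: "comonotone A"
  shows "{z. \<exists>x x'. (x, z) \<in> A \<and> (x', z) \<in> A \<and> x \<noteq> x'} \<in> null_sets lborel"
proof -
  \<comment> \<open>Bounding the gap below makes \<open>T b n\<close> closed, so that its projection is Borel.\<close>
  define T where "T b n = {((x, x'), z). (x, z) \<in> A \<and> (x', z) \<in> A \<and> 1 / real (Suc n) \<le> (x - x') \<bullet> b}" for b :: 'a and n
  have T_null: "snd ` T b n \<in> null_sets lborel" for b n
  proof (rule null_set_of_countable_lines)
    have "T b n = (\<lambda>w. (fst (fst w), snd w)) -` A \<inter> (\<lambda>w. (snd (fst w), snd w)) -` A \<inter>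
        {w. 1 / real (Suc n) \<le> (fst (fst w) - snd (fst w)) \<bullet> b}"
      by (auto simp: T_def)
    moreover have "closed \<dots>"
      by (intro closed_Int closed_vimage closed closed_Collect_le continuous_intros)
    ultimately have "closed (T b n)" by simp
    thus "snd ` T b n \<in> sets borel" by (rule closed_image_borel) (intro continuous_intros)
    fix z :: 'a
    define I where "I = {t. z + t *\<^sub>R b \<in> snd ` T b n}"
    have "\<exists>l u. l < u \<and> (\<exists>x x'. (x, z + t *\<^sub>R b) \<in> A \<and> (x', z + t *\<^sub>R b) \<in> A \<and> l = x' \<bullet> b \<and> u = x \<bullet> b)" if tI: "t \<in> I" for t
    proof -
      obtain x x' where x: "(x, z + t *\<^sub>R b) \<in> A" "(x', z + t *\<^sub>R b) \<in> A" and gap: "1 / real (Suc n) \<le> (x - x') \<bullet> b"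
        using tI by (auto simp: I_def T_def)
      have "0 < (x - x') \<bullet> b" by (rule less_le_trans[OF _ gap]) simp
      hence "x' \<bullet> b < x \<bullet> b" by (simp add: inner_diff_left)
      with x show ?thesis by blast
    qed
    then obtain l u where lu: "\<And>t. t \<in> I \<Longrightarrow> l t < u t"
      and pts: "\<And>t. t \<in> I \<Longrightarrow> \<exists>x x'. (x, z + t *\<^sub>R b) \<in> A \<and> (x', z + t *\<^sub>R b) \<in> A \<and> l t = x' \<bullet> b \<and> u t = x \<bullet> b"
      by metis
    have ord: "u t \<le> l t'" if tt: "t \<in> I" "t' \<in> I" "t < t'" for t t'
    proof -
      obtain x y' where x: "(x, z + t *\<^sub>R b) \<in> A" "u t = x \<bullet> b" and y: "(y', z + t' *\<^sub>R b) \<in> A" "l t' = y' \<bullet> b"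
        using pts[OF tt(1)] pts[OF tt(2)] by blast
      have "0 \<le> (y' - x) \<bullet> ((z + t' *\<^sub>R b) - (z + t *\<^sub>R b))"
        using mono x(1) y(1) unfolding comonotone_def by fastforce
      also have "\<dots> = (t' - t) * ((y' - x) \<bullet> b)" by (simp add: algebra_simps inner_diff_right)
      finally have "0 \<le> (y' - x) \<bullet> b" using tt(3) by (simp add: zero_le_mult_iff)
      thus ?thesis using x y by (simp add: inner_diff_left)
    qed
    have "\<exists>q :: rat. l t < of_rat q \<and> of_rat q < u t" if "t \<in> I" for t
      using of_rat_dense[OF lu[OF that]] by blast
    then obtain q :: "real \<Rightarrow> rat" where q: "\<And>t. t \<in> I \<Longrightarrow> l t < of_rat (q t) \<and> of_rat (q t) < u t"
      by metis
    have "inj_on q I"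
    proof (rule linorder_inj_onI)
      fix t t' assume "t < t'" "t \<in> I" "t' \<in> I"
      hence "real_of_rat (q t) < of_rat (q t')" using q[of t] q[of t'] ord[of t t'] by linarith
      thus "q t \<noteq> q t'" by auto
    qed (rule linear)
    thus "countable {t. z + t *\<^sub>R b \<in> snd ` T b n}"
      unfolding I_def[symmetric] by (rule countableI')
  qed
  have "{z. \<exists>x x'. (x, z) \<in> A \<and> (x', z) \<in> A \<and> x \<noteq> x'} = (\<Union>b\<in>Basis. \<Union>n. snd ` T b n)"
  proof (intro equalityI subsetI)
    fix z assume "z \<in> {z. \<exists>x x'. (x, z) \<in> A \<and> (x', z) \<in> A \<and> x \<noteq> x'}"
    then obtain x x' where xx: "(x, z) \<in> A" "(x', z) \<in> A" "x \<noteq> x'" by blast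
    then obtain b where b: "b \<in> Basis" "x \<bullet> b \<noteq> x' \<bullet> b" using euclidean_eqI by blast
    obtain y y' where y: "(y, z) \<in> A" "(y', z) \<in> A" "0 < (y - y') \<bullet> b"
      using xx b(2) by (metis diff_gt_0_iff_gt inner_diff_left linorder_neqE_linordered_idom)
    obtain n where "1 / real (Suc n) < (y - y') \<bullet> b" using nat_approx_posE[OF y(3)] by blast
    hence "((y, y'), z) \<in> T b n" using y by (simp add: T_def)
    thus "z \<in> (\<Union>b\<in>Basis. \<Union>n. snd ` T b n)" using b(1) by force
  next
    fix z assume "z \<in> (\<Union>b\<in>Basis. \<Union>n. snd ` T b n)"
    then obtain b n x x' where "(x, z) \<in> A" "(x', z) \<in> A" "1 / real (Suc n) \<le> (x - x') \<bullet> b"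
      by (auto simp: T_def)
    moreover have "x \<noteq> x'" using calculation(3) by (auto simp: field_simps)
    ultimately show "z \<in> {z. \<exists>x x'. (x, z) \<in> A \<and> (x', z) \<in> A \<and> x \<noteq> x'}" by blast
  qed
  moreover have "(\<Union>b\<in>Basis. \<Union>n. snd ` T b n) \<in> null_sets lborel"
    by (rule null_sets_UN'[OF countable_finite[OF finite_Basis]]) (rule null_sets_UN[OF T_null])
  ultimately show ?thesis by simp
qed

text \<open>
  The first component of an optimal coupling is determined by the second one when the second margin
  is absolutely continuous. In terms of events: every event about the first component is almost
  surely an event about the second one. For closed \<open>C\<close> the event is the projection of the part of the
  support over \<open>C\<close>; the general case follows because such \<open>C\<close> form a \<open>\<sigma>\<close>-algebra. This form avoids
  a measurable selection of the transport map.
\<close>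
lemma optimal_coupling_events:
  fixes K :: "('a::euclidean_space \<times> 'a) measure"
  assumes M: "M \<in> P2" and N: "N \<in> P2" and K: "K \<in> couplings M N" and opt: "transport_cost K = W2sq M N"
    and ac: "\<And>S. S \<in> null_sets lborel \<Longrightarrow> S \<in> null_sets N" and C: "C \<in> sets borel"
  shows "\<exists>C'\<in>sets borel. AE w in K. fst w \<in> C \<longleftrightarrow> snd w \<in> C'"
proof -
  have sK: "sets K = sets borel" by (rule couplingsD[OF K])
  define A where "A = measure_support K"
  have A: "closed A" "comonotone A" "AE w in K. w \<in> A"
    unfolding A_def using closed_measure_support optimal_coupling_comonotone_support[OF M N K opt] AE_measure_support[OF sK]
    by auto
  define Z where "Z = {z. \<exists>x x'. (x, z) \<in> A \<and> (x', z) \<in> A \<and> x \<noteq> x'}"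
  have "Z \<in> null_sets N" unfolding Z_def by (rule ac[OF comonotone_multivalued_null[OF A(1,2)]])
  hence "AE z in distr K borel snd. z \<notin> Z" unfolding couplingsD(4)[OF K] by (rule AE_not_in)
  hence single: "AE w in K. snd w \<notin> Z"
    by (rule AE_distrD[rotated]) (simp add: measurable_cong_sets[OF sK refl])
  have closed_case: "\<exists>C'\<in>sets borel. AE w in K. fst w \<in> C \<longleftrightarrow> snd w \<in> C'" if "closed C" for C
  proof (rule bexI)
    show "snd ` (A \<inter> C \<times> UNIV) \<in> sets borel"
      by (rule closed_image_borel) (auto intro!: closed_Int A(1) closed_Times that continuous_intros)
    show "AE w in K. fst w \<in> C \<longleftrightarrow> snd w \<in> snd ` (A \<inter> C \<times> UNIV)"
      using A(3) single
    proof eventually_elim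
      case (elim w)
      show ?case
      proof
        assume "fst w \<in> C"
        thus "snd w \<in> snd ` (A \<inter> C \<times> UNIV)" using elim(1) by (intro image_eqI[of _ _ w]) (auto simp: mem_Times_iff)
      next
        assume "snd w \<in> snd ` (A \<inter> C \<times> UNIV)"
        then obtain x where "(x, snd w) \<in> A" "x \<in> C" by auto
        moreover have "(fst w, snd w) \<in> A" using elim(1) by simp
        ultimately show "fst w \<in> C" using elim(2) unfolding Z_def by blast
      qed
    qed
  qed
  have "C \<in> sigma_sets UNIV (Collect closed)" using C by (simp add: borel_eq_closed)
  thus ?thesis
  proof (induction rule: sigma_sets.induct)
    case (Basic C)
    thus ?case using closed_case by simp
  next
    case Empty
    show ?case by (intro bexI[of _ "{}"]) auto
  next
    case (Compl C)
    then obtain C' where "C' \<in> sets borel" "AE w in K. fst w \<in> C \<longleftrightarrow> snd w \<in> C'" by blast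
    thus ?case by (intro bexI[of _ "- C'"]) auto
  next
    case (Union C)
    hence "\<forall>i. \<exists>C'. C' \<in> sets borel \<and> (AE w in K. fst w \<in> C i \<longleftrightarrow> snd w \<in> C')" by blast
    then obtain C' where C': "\<And>i. C' i \<in> sets borel" "\<And>i. AE w in K. fst w \<in> C i \<longleftrightarrow> snd w \<in> C' i" by metis
    have "AE w in K. \<forall>i. fst w \<in> C i \<longleftrightarrow> snd w \<in> C' i" using C'(2) by (simp add: AE_all_countable)
    hence "AE w in K. fst w \<in> (\<Union>i. C i) \<longleftrightarrow> snd w \<in> (\<Union>i. C' i)" by eventually_elim auto
    thus ?case using C'(1) by (intro bexI[of _ "\<Union>i. C' i"]) auto
  qed
qed

section \<open>Additivity of the squared distance\<close>

text \<open>
  The squared norm on the product is the sum of the squared norms, and a coupling of the joint laws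
  projects to couplings of the margins.
\<close>
lemma W2sq_coupling_ge:
  fixes K L :: "('a::euclidean_space \<times> 'b::euclidean_space) measure"
  assumes K: "K \<in> couplings M N" and L: "L \<in> couplings P Q"
  shows "W2sq M P + W2sq N Q \<le> W2sq K L"
  unfolding W2sq_def[of K L]
proof (rule INF_greatest)
  fix J assume J: "J \<in> couplings K L"
  interpret prob_space J by (rule couplingsD[OF J])
  have sJ: "sets J = sets borel" by (rule couplingsD[OF J])
  have m: "f \<in> borel_measurable J" if "continuous_on UNIV f" for f :: "_ \<Rightarrow> 'c::euclidean_space"
    unfolding measurable_cong_sets[OF sJ refl] by (rule borel_measurable_continuous_onI[OF that])
  have [measurable]: "(\<lambda>w. fst (fst w)) \<in> borel_measurable J" "(\<lambda>w. fst (snd w)) \<in> borel_measurable J"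
    "(\<lambda>w. snd (fst w)) \<in> borel_measurable J" "(\<lambda>w. snd (snd w)) \<in> borel_measurable J"
    "fst \<in> borel_measurable J" "snd \<in> borel_measurable J"
    by (intro m continuous_intros)+
  have laws: "distr J borel (\<lambda>w. fst (fst w)) = M" "distr J borel (\<lambda>w. snd (fst w)) = N"
    "distr J borel (\<lambda>w. fst (snd w)) = P" "distr J borel (\<lambda>w. snd (snd w)) = Q"
    unfolding couplingsD(3)[OF K, symmetric] couplingsD(4)[OF K, symmetric] couplingsD(3)[OF L, symmetric]
      couplingsD(4)[OF L, symmetric] couplingsD(3)[OF J, symmetric] couplingsD(4)[OF J, symmetric]
    by (subst distr_distr; auto simp: comp_def)+
  have "W2sq M P + W2sq N Q \<le> (\<integral>\<^sup>+ w. ennreal ((norm (fst (fst w) - fst (snd w)))\<^sup>2) \<partial>J) +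
      (\<integral>\<^sup>+ w. ennreal ((norm (snd (fst w) - snd (snd w)))\<^sup>2) \<partial>J)"
    by (intro add_mono W2sq_le_of_variables[OF prob_space_axioms] laws) measurable
  also have "\<dots> = (\<integral>\<^sup>+ w. ennreal ((norm (fst (fst w) - fst (snd w)))\<^sup>2) + ennreal ((norm (snd (fst w) - snd (snd w)))\<^sup>2) \<partial>J)"
    by (rule nn_integral_add[symmetric]) measurable
  also have "\<dots> = transport_cost J"
    unfolding transport_cost_def by (rule nn_integral_cong) (simp add: norm_prod_def ennreal_plus)
  finally show "W2sq M P + W2sq N Q \<le> transport_cost J" .
qed

lemma pair_measure_distr_borel:
  fixes f :: "'a \<Rightarrow> 'c::euclidean_space" and g :: "'b \<Rightarrow> 'd::euclidean_space"
  assumes "prob_space N" and f: "f \<in> borel_measurable M" and g: "g \<in> borel_measurable N"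
  shows "distr (M \<Otimes>\<^sub>M N) borel (\<lambda>w. (f (fst w), g (snd w))) = distr M borel f \<Otimes>\<^sub>M distr N borel g"
proof -
  interpret N: prob_space N by fact
  interpret D: prob_space "distr N borel g" by (rule N.prob_space_distr[OF g])
  show ?thesis
    unfolding pair_measure_distr[OF f g D.sigma_finite_measure_axioms] borel_prod
    by (simp add: case_prod_beta')
qed

lemma W2sq_product_le:
  assumes M: "M \<in> P2" and N: "N \<in> P2" and P: "P \<in> P2" and Q: "Q \<in> P2"
  shows "W2sq (M \<Otimes>\<^sub>M N) (P \<Otimes>\<^sub>M Q) \<le> W2sq M P + W2sq N Q"
proof -
  obtain K1 where K1: "K1 \<in> couplings M P" "transport_cost K1 = W2sq M P" using optimal_coupling_exists[OF M P] by blast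
  obtain K2 where K2: "K2 \<in> couplings N Q" "transport_cost K2 = W2sq N Q" using optimal_coupling_exists[OF N Q] by blast
  interpret K1: prob_space K1 by (rule couplingsD[OF K1(1)])
  interpret K2: prob_space K2 by (rule couplingsD[OF K2(1)])
  interpret KK: pair_prob_space K1 K2 ..
  have [measurable_cong]: "sets K1 = sets borel" "sets K2 = sets borel"
    using couplingsD[OF K1(1)] couplingsD[OF K2(1)] by auto
  have m1[measurable]: "fst \<in> borel_measurable K1" "snd \<in> borel_measurable K1"
    "fst \<in> borel_measurable K2" "snd \<in> borel_measurable K2" by measurable
  have laws: "distr (K1 \<Otimes>\<^sub>M K2) borel (\<lambda>w. (fst (fst w), fst (snd w))) = M \<Otimes>\<^sub>M N"
     "distr (K1 \<Otimes>\<^sub>M K2) borel (\<lambda>w. (snd (fst w), snd (snd w))) = P \<Otimes>\<^sub>M Q"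
    using pair_measure_distr_borel[OF K2.prob_space_axioms m1(1,3)] pair_measure_distr_borel[OF K2.prob_space_axioms m1(2,4)]
      couplingsD[OF K1(1)] couplingsD[OF K2(1)] by simp_all
  have [measurable]: "(\<lambda>w. fst (fst w)) \<in> borel_measurable (K1 \<Otimes>\<^sub>M K2)" "(\<lambda>w. fst (snd w)) \<in> borel_measurable (K1 \<Otimes>\<^sub>M K2)"
    "(\<lambda>w. snd (fst w)) \<in> borel_measurable (K1 \<Otimes>\<^sub>M K2)" "(\<lambda>w. snd (snd w)) \<in> borel_measurable (K1 \<Otimes>\<^sub>M K2)"
    by (rule measurable_compose[OF measurable_fst m1(1)] measurable_compose[OF measurable_snd m1(3)]
      measurable_compose[OF measurable_fst m1(2)] measurable_compose[OF measurable_snd m1(4)])+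
  have "W2sq (M \<Otimes>\<^sub>M N) (P \<Otimes>\<^sub>M Q) \<le> (\<integral>\<^sup>+ w. ennreal ((norm ((fst (fst w), fst (snd w)) - (snd (fst w), snd (snd w))))\<^sup>2) \<partial>(K1 \<Otimes>\<^sub>M K2))"
    by (rule W2sq_le_of_variables[OF KK.prob_space_axioms _ _ laws]) measurable
  also have "\<dots> = (\<integral>\<^sup>+ w. ennreal ((norm (fst (fst w) - snd (fst w)))\<^sup>2) + ennreal ((norm (fst (snd w) - snd (snd w)))\<^sup>2) \<partial>(K1 \<Otimes>\<^sub>M K2))"
    by (rule nn_integral_cong) (simp add: norm_prod_def ennreal_plus)
  also have "\<dots> = (\<integral>\<^sup>+ w. ennreal ((norm (fst (fst w) - snd (fst w)))\<^sup>2) \<partial>(K1 \<Otimes>\<^sub>M K2)) +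
      (\<integral>\<^sup>+ w. ennreal ((norm (fst (snd w) - snd (snd w)))\<^sup>2) \<partial>(K1 \<Otimes>\<^sub>M K2))"
    by (rule nn_integral_add) measurable
  also have "(\<integral>\<^sup>+ w. ennreal ((norm (fst (fst w) - snd (fst w)))\<^sup>2) \<partial>(K1 \<Otimes>\<^sub>M K2)) = W2sq M P"
    unfolding K1(2)[symmetric] transport_cost_def
    by (subst K2.nn_integral_fst[symmetric]) (auto simp: K2.emeasure_space_1)
  also have "(\<integral>\<^sup>+ w. ennreal ((norm (fst (snd w) - snd (snd w)))\<^sup>2) \<partial>(K1 \<Otimes>\<^sub>M K2)) = W2sq N Q"
    unfolding K2(2)[symmetric] transport_cost_def
    by (subst K2.nn_integral_fst[symmetric]) (auto simp: K1.emeasure_space_1)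
  finally show ?thesis .
qed

text \<open>
  If the bound of \<open>W2sq_coupling_ge\<close> is attained, both projections \<open>J1\<close> and \<open>J2\<close> of an optimal
  coupling \<open>J\<close> with the Gaussian are optimal. Events about the first and second component of \<open>K\<close> are
  then events about the two independent Gaussian components.
\<close>
lemma product_of_gaussian_additivity:
  fixes M :: "'a::euclidean_space measure" and N :: "'b::euclidean_space measure"
  assumes M: "M \<in> P2" and N: "N \<in> P2" and K: "K \<in> couplings M N"
    and eq: "W2sq K std_gaussian = W2sq M std_gaussian + W2sq N std_gaussian"
  shows "K = M \<Otimes>\<^sub>M N"
proof -
  have KP: "K \<in> P2" by (rule couplings_P2[OF M N K])
  obtain J where J: "J \<in> couplings K std_gaussian" and opt: "transport_cost J = W2sq K std_gaussian"
    using optimal_coupling_exists[OF KP std_gaussian_P2] by blast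
  interpret prob_space J by (rule couplingsD[OF J])
  interpret Gb: prob_space "std_gaussian :: 'b measure" by (rule P2D(1)[OF std_gaussian_P2])
  interpret Mp: prob_space M by (rule P2D(1)[OF M])
  interpret Np: prob_space N by (rule P2D(1)[OF N])
  have sJ: "sets J = sets borel" by (rule couplingsD[OF J])
  have m: "f \<in> borel_measurable J" if "continuous_on UNIV f" for f :: "_ \<Rightarrow> 'c::euclidean_space"
    unfolding measurable_cong_sets[OF sJ refl] by (rule borel_measurable_continuous_onI[OF that])
  have mJ[measurable]: "(\<lambda>w. fst (fst w)) \<in> borel_measurable J" "(\<lambda>w. fst (snd w)) \<in> borel_measurable J"
    "(\<lambda>w. snd (fst w)) \<in> borel_measurable J" "(\<lambda>w. snd (snd w)) \<in> borel_measurable J"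
    "fst \<in> borel_measurable J" "snd \<in> borel_measurable J"
    by (intro m continuous_intros)+
  have G: "(std_gaussian :: ('a \<times> 'b) measure) \<in> couplings std_gaussian std_gaussian"
    by (rule std_gaussian_coupling)
  have laws: "distr J borel (\<lambda>w. fst (fst w)) = M" "distr J borel (\<lambda>w. snd (fst w)) = N"
    "distr J borel (\<lambda>w. fst (snd w)) = std_gaussian" "distr J borel (\<lambda>w. snd (snd w)) = std_gaussian"
    unfolding couplingsD(3)[OF K, symmetric] couplingsD(4)[OF K, symmetric] couplingsD(3)[OF G, symmetric]
      couplingsD(4)[OF G, symmetric] couplingsD(3)[OF J, symmetric] couplingsD(4)[OF J, symmetric]
    by (subst distr_distr; auto simp: comp_def)+
  define J1 where "J1 = distr J borel (\<lambda>w. (fst (fst w), fst (snd w)))"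
  define J2 where "J2 = distr J borel (\<lambda>w. (snd (fst w), snd (snd w)))"
  have J1: "J1 \<in> couplings M std_gaussian"
    using coupling_of_variables[OF prob_space_axioms mJ(1,2)] unfolding J1_def laws .
  have J2: "J2 \<in> couplings N std_gaussian"
    using coupling_of_variables[OF prob_space_axioms mJ(3,4)] unfolding J2_def laws .
  have "transport_cost J1 + transport_cost J2 = transport_cost J"
    unfolding J1_def J2_def transport_cost_of_variables[OF mJ(1,2)] transport_cost_of_variables[OF mJ(3,4)]
    by (subst nn_integral_add[symmetric])
       (auto simp: transport_cost_def norm_prod_def ennreal_plus intro!: nn_integral_cong)
  hence sum: "transport_cost J1 + transport_cost J2 = W2sq M std_gaussian + W2sq N std_gaussian"
    using opt eq by simp
  have ge1: "W2sq M std_gaussian \<le> transport_cost J1" unfolding W2sq_def by (rule INF_lower[OF J1])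
  have ge2: "W2sq N std_gaussian \<le> transport_cost J2" unfolding W2sq_def by (rule INF_lower[OF J2])
  have fin1: "W2sq M std_gaussian < \<infinity>" and fin2: "W2sq N std_gaussian < \<infinity>"
    using W2sq_finite[OF M std_gaussian_P2] W2sq_finite[OF N std_gaussian_P2] by auto
  have opt1: "transport_cost J1 = W2sq M std_gaussian"
  proof (rule antisym[OF _ ge1])
    have "W2sq N std_gaussian + transport_cost J1 \<le> W2sq N std_gaussian + W2sq M std_gaussian"
      using add_mono[OF ge2 order_refl[of "transport_cost J1"]] sum by (simp add: add.commute)
    thus "transport_cost J1 \<le> W2sq M std_gaussian" using fin2 by (auto simp: ennreal_add_left_cancel_le)
  qed
  have opt2: "transport_cost J2 = W2sq N std_gaussian"
  proof (rule antisym[OF _ ge2])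
    have "W2sq M std_gaussian + transport_cost J2 \<le> W2sq M std_gaussian + W2sq N std_gaussian"
      using add_mono[OF ge1 order_refl[of "transport_cost J2"]] sum by simp
    thus "transport_cost J2 \<le> W2sq N std_gaussian" using fin1 by (auto simp: ennreal_add_left_cancel_le)
  qed
  have "M \<Otimes>\<^sub>M N = K"
  proof (rule pair_measure_eqI)
    show "sigma_finite_measure M" "sigma_finite_measure N"
      by (rule Mp.sigma_finite_measure_axioms Np.sigma_finite_measure_axioms)+
    show "sets (M \<Otimes>\<^sub>M N) = sets K"
      using sets_pair_measure_cong[OF P2D(2)[OF M] P2D(2)[OF N]] unfolding borel_prod couplingsD(2)[OF K] .
    fix C D assume "C \<in> sets M" "D \<in> sets N"
    hence C: "C \<in> sets borel" and D: "D \<in> sets borel" using P2D(2)[OF M] P2D(2)[OF N] by auto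
    obtain C' where C'[measurable]: "C' \<in> sets borel" and AE1: "AE w in J1. fst w \<in> C \<longleftrightarrow> snd w \<in> C'"
      using optimal_coupling_events[OF M std_gaussian_P2 J1 opt1 null_sets_std_gaussian C] by blast
    obtain D' where D'[measurable]: "D' \<in> sets borel" and AE2: "AE w in J2. fst w \<in> D \<longleftrightarrow> snd w \<in> D'"
      using optimal_coupling_events[OF N std_gaussian_P2 J2 opt2 null_sets_std_gaussian D] by blast
    have [measurable]: "C \<in> sets borel" "D \<in> sets borel" by (rule C D)+
    have AE1': "AE w in J. fst (fst w) \<in> C \<longleftrightarrow> fst (snd w) \<in> C'"
      using AE_distrD[OF _ AE1[unfolded J1_def]] by simp
    have AE2': "AE w in J. snd (fst w) \<in> D \<longleftrightarrow> snd (snd w) \<in> D'"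
      using AE_distrD[OF _ AE2[unfolded J2_def]] by simp
    have CD: "C \<times> D \<in> sets borel" "C' \<times> D' \<in> sets borel"
      unfolding borel_prod[symmetric] by (auto intro!: pair_measureI)
    have "emeasure K (C \<times> D) = emeasure J (fst -` (C \<times> D) \<inter> space J)"
      unfolding couplingsD(3)[OF J, symmetric] by (rule emeasure_distr) (use CD in auto)
    also have "\<dots> = emeasure J (snd -` (C' \<times> D') \<inter> space J)"
    proof (rule emeasure_eq_AE)
      show "AE w in J. w \<in> fst -` (C \<times> D) \<inter> space J \<longleftrightarrow> w \<in> snd -` (C' \<times> D') \<inter> space J"
        using AE1' AE2' by eventually_elim (auto simp: mem_Times_iff)
      show "fst -` (C \<times> D) \<inter> space J \<in> sets J" by (rule measurable_sets[OF mJ(5) CD(1)])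
      show "snd -` (C' \<times> D') \<inter> space J \<in> sets J" by (rule measurable_sets[OF mJ(6) CD(2)])
    qed
    also have "\<dots> = emeasure (std_gaussian :: ('a \<times> 'b) measure) (C' \<times> D')"
      unfolding couplingsD(4)[OF J, symmetric] by (rule emeasure_distr[symmetric]) (use CD in auto)
    also have "\<dots> = emeasure std_gaussian C' * emeasure std_gaussian D'"
      unfolding std_gaussian_pair[symmetric] by (rule Gb.emeasure_pair_measure_Times) auto
    also have "emeasure std_gaussian C' = emeasure M C"
    proof -
      have "emeasure std_gaussian C' = emeasure J ((\<lambda>w. fst (snd w)) -` C' \<inter> space J)"
        unfolding laws(3)[symmetric] by (rule emeasure_distr) auto
      also have "\<dots> = emeasure J ((\<lambda>w. fst (fst w)) -` C \<inter> space J)"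
        by (rule emeasure_eq_AE, use AE1' in eventually_elim) (auto intro: measurable_sets[OF mJ(1) C] measurable_sets[OF mJ(2) C'])
      also have "\<dots> = emeasure M C"
        unfolding laws(1)[symmetric] by (rule emeasure_distr[symmetric]) auto
      finally show ?thesis .
    qed
    also have "emeasure std_gaussian D' = emeasure N D"
    proof -
      have "emeasure std_gaussian D' = emeasure J ((\<lambda>w. snd (snd w)) -` D' \<inter> space J)"
        unfolding laws(4)[symmetric] by (rule emeasure_distr) auto
      also have "\<dots> = emeasure J ((\<lambda>w. snd (fst w)) -` D \<inter> space J)"
        by (rule emeasure_eq_AE, use AE2' in eventually_elim) (auto intro: measurable_sets[OF mJ(3) D] measurable_sets[OF mJ(4) D'])
      also have "\<dots> = emeasure N D"
        unfolding laws(2)[symmetric] by (rule emeasure_distr[symmetric]) auto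
      finally show ?thesis .
    qed
    finally show "emeasure M C * emeasure N D = emeasure K (C \<times> D)" ..
  qed
  thus ?thesis ..
qed

lemma eq_of_W2sq_zero:
  assumes M: "M \<in> P2" and N: "N \<in> P2" and zero: "W2sq M N = 0"
  shows "M = N"
proof -
  obtain K where K: "K \<in> couplings M N" and cost: "transport_cost K = 0"
    using optimal_coupling_exists[OF M N] zero by auto
  have sK[measurable_cong]: "sets K = sets borel" by (rule couplingsD[OF K])
  have "(\<lambda>p. ennreal ((norm (fst p - snd p))\<^sup>2)) \<in> borel_measurable K"
    unfolding measurable_cong_sets[OF sK refl] by measurable
  hence "AE p in K. ennreal ((norm (fst p - snd p))\<^sup>2) = 0"
    using cost unfolding transport_cost_def by (subst (asm) nn_integral_0_iff_AE)
  hence "AE p in K. fst p = snd p" by eventually_elim simp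
  hence "distr K borel fst = distr K borel snd"
    by (intro distr_cong_AE) (auto simp: measurable_cong_sets[OF sK refl])
  thus ?thesis using couplingsD[OF K] by simp
qed

lemma W2sq_self:
  assumes "M \<in> P2" shows "W2sq M M = 0"
proof -
  have sM: "sets M = sets borel" by (rule P2D(2)[OF assms])
  have "W2sq M M \<le> (\<integral>\<^sup>+ x. ennreal ((norm (x - x))\<^sup>2) \<partial>M)"
    by (rule W2sq_le_of_variables[OF P2D(1)[OF assms]])
       (auto simp: measurable_cong_sets[OF sM refl] sM intro!: distr_id2)
  thus ?thesis by simp
qed

section \<open>Orthogonal maps\<close>

text \<open>
  Applied to the inverse map as well, this inequality becomes an equality.
\<close>
lemma W2sq_distr_orthogonal_le:
  fixes M N :: "'a::euclidean_space measure" and f :: "'a \<Rightarrow> 'a"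
  assumes f: "orthogonal_transformation f"
  shows "W2sq (distr M borel f) (distr N borel f) \<le> W2sq M N"
  unfolding W2sq_def[of M N]
proof (rule INF_greatest)
  fix K assume K: "K \<in> couplings M N"
  have [measurable_cong]: "sets K = sets borel" by (rule couplingsD[OF K])
  have [measurable]: "f \<in> borel_measurable borel" by (rule orthogonal_transformation_borel[OF f])
  have "W2sq (distr M borel f) (distr N borel f) \<le> (\<integral>\<^sup>+ p. ennreal ((norm (f (fst p) - f (snd p)))\<^sup>2) \<partial>K)"
  proof (rule W2sq_le_of_variables[OF couplingsD(1)[OF K]])
    show "distr K borel (\<lambda>p. f (fst p)) = distr M borel f"
      unfolding couplingsD(3)[OF K, symmetric] by (subst distr_distr) (auto simp: comp_def)
    show "distr K borel (\<lambda>p. f (snd p)) = distr N borel f"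
      unfolding couplingsD(4)[OF K, symmetric] by (subst distr_distr) (auto simp: comp_def)
  qed measurable
  also have "\<dots> = transport_cost K"
    unfolding transport_cost_def
    using orthogonal_transformation_norm[OF f] linear_diff[OF orthogonal_transformation_linear[OF f]]
    by (metis (no_types))
  finally show "W2sq (distr M borel f) (distr N borel f) \<le> transport_cost K" .
qed

lemma distr_inverse:
  assumes "sets M = sets borel" "f \<in> borel_measurable borel" "g \<in> borel_measurable borel" "\<And>x. g (f x) = x"
  shows "distr (distr M borel f) borel g = M"
  by (subst distr_distr) (use assms in \<open>auto simp: comp_def measurable_cong_sets[OF assms(1) refl] intro: distr_id2\<close>)

lemma W2_distr_orthogonal:
  fixes M N :: "'a::euclidean_space measure" and f :: "'a \<Rightarrow> 'a"
  assumes f: "orthogonal_transformation f" and s: "sets M = sets borel" "sets N = sets borel"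
  shows "W2 (distr M borel f) (distr N borel f) = W2 M N"
proof -
  obtain g where g: "orthogonal_transformation g" "\<And>x. g (f x) = x" "\<And>x. f (g x) = x"
    using orthogonal_transformation_inverse[OF f] by blast
  have inv: "distr (distr L borel f) borel g = L" if "sets L = sets borel" for L
    by (rule distr_inverse[OF that orthogonal_transformation_borel[OF f] orthogonal_transformation_borel[OF g(1)] g(2)])
  have "W2sq (distr M borel f) (distr N borel f) = W2sq M N"
    using W2sq_distr_orthogonal_le[OF f, of M N]
      W2sq_distr_orthogonal_le[OF g(1), of "distr M borel f" "distr N borel f"]
    by (simp add: inv s)
  thus ?thesis by (simp add: W2_def W2sq_def transport_cost_def case_prod_unfold)
qed

lemma coupling_distr:
  fixes K :: "('a::euclidean_space \<times> 'b::euclidean_space) measure"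
  assumes K: "K \<in> couplings M N" and [measurable]: "f \<in> borel_measurable borel" "g \<in> borel_measurable borel"
  shows "distr K borel (\<lambda>w. (f (fst w), g (snd w))) \<in> couplings (distr M borel f) (distr N borel g)"
proof -
  have [measurable_cong]: "sets K = sets borel" by (rule couplingsD[OF K])
  have "distr K borel (\<lambda>w. (f (fst w), g (snd w))) \<in> couplings (distr K borel (\<lambda>w. f (fst w))) (distr K borel (\<lambda>w. g (snd w)))"
    by (rule coupling_of_variables[OF couplingsD(1)[OF K]]) measurable
  moreover have "distr K borel (\<lambda>w. f (fst w)) = distr M borel f"
    unfolding couplingsD(3)[OF K, symmetric] by (subst distr_distr) (auto simp: comp_def)
  moreover have "distr K borel (\<lambda>w. g (snd w)) = distr N borel g"
    unfolding couplingsD(4)[OF K, symmetric] by (subst distr_distr) (auto simp: comp_def)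
  ultimately show ?thesis by simp
qed

lemma orthogonal_transformation_pair:
  assumes "orthogonal_transformation f" "orthogonal_transformation g"
  shows "orthogonal_transformation (\<lambda>w. (f (fst w), g (snd w)))"
  unfolding orthogonal_transformation_def
proof (intro conjI allI)
  have lin: "linear f" "linear g" using assms by (auto simp: orthogonal_transformation_def)
  show "linear (\<lambda>w. (f (fst w), g (snd w)))"
    by (rule linearI) (simp_all add: linear_add[OF lin(1)] linear_add[OF lin(2)] linear_scale[OF lin(1)] linear_scale[OF lin(2)])
  show "(f (fst v), g (snd v)) \<bullet> (f (fst w), g (snd w)) = v \<bullet> w" for v w
    using assms by (simp add: orthogonal_transformation_def inner_prod_def)
qed

lemma couplings_distr_orthogonal:
  fixes M :: "'a::euclidean_space measure" and N :: "'b::euclidean_space measure"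
    and f :: "'a \<Rightarrow> 'a" and g :: "'b \<Rightarrow> 'b"
  assumes f: "orthogonal_transformation f" and g: "orthogonal_transformation g"
    and s: "sets M = sets borel" "sets N = sets borel"
  shows "couplings (distr M borel f) (distr N borel g) =
    (\<lambda>K. distr K borel (\<lambda>w. (f (fst w), g (snd w)))) ` couplings M N" (is "?L = ?R")
proof
  note fm = orthogonal_transformation_borel[OF f] and gm = orthogonal_transformation_borel[OF g]
  show "?R \<subseteq> ?L" using coupling_distr[OF _ fm gm] by blast
  obtain f' where f': "orthogonal_transformation f'" "\<And>x. f' (f x) = x" "\<And>x. f (f' x) = x"
    using orthogonal_transformation_inverse[OF f] by blast
  obtain g' where g': "orthogonal_transformation g'" "\<And>x. g' (g x) = x" "\<And>x. g (g' x) = x"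
    using orthogonal_transformation_inverse[OF g] by blast
  note fm' = orthogonal_transformation_borel[OF f'(1)] and gm' = orthogonal_transformation_borel[OF g'(1)]
  show "?L \<subseteq> ?R"
  proof
    fix L assume L: "L \<in> ?L"
    define K where "K = distr L borel (\<lambda>w. (f' (fst w), g' (snd w)))"
    have "K \<in> couplings M N"
      using coupling_distr[OF L fm' gm'] unfolding K_def
      by (simp add: distr_inverse[OF s(1) fm fm' f'(2)] distr_inverse[OF s(2) gm gm' g'(2)])
    moreover have "distr K borel (\<lambda>w. (f (fst w), g (snd w))) = L"
      unfolding K_def
      by (rule distr_inverse[OF couplingsD(2)[OF L]
            orthogonal_transformation_borel[OF orthogonal_transformation_pair[OF f'(1) g'(1)]]
            orthogonal_transformation_borel[OF orthogonal_transformation_pair[OF f g]]])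
         (simp add: f' g')
    ultimately show "L \<in> ?R" by (intro image_eqI[of _ _ K]) auto
  qed
qed

lemma wass_dep1_coupling:
  assumes "K \<in> couplings M N"
  shows "wass_dep1 K = ((W2 K std_gaussian)\<^sup>2 - ((W2 M std_gaussian)\<^sup>2 + (W2 N std_gaussian)\<^sup>2)) /
    ((SUP L\<in>couplings M N. (W2 L std_gaussian)\<^sup>2) - ((W2 M std_gaussian)\<^sup>2 + (W2 N std_gaussian)\<^sup>2))"
  unfolding wass_dep1_def Let_def couplingsD(3,4)[OF assms] by (simp add: algebra_simps)

lemma wass_dep2_coupling:
  assumes "K \<in> couplings M N"
  shows "wass_dep2 K = ((W2 K (M \<Otimes>\<^sub>M N))\<^sup>2 - 0) / ((SUP L\<in>couplings M N. (W2 L (M \<Otimes>\<^sub>M N))\<^sup>2) - 0)"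
  unfolding wass_dep2_def Let_def couplingsD(3,4)[OF assms] by simp

lemma wass_dep_invariant:
  fixes K :: "('a::euclidean_space \<times> 'b::euclidean_space) measure"
    and f :: "'a \<Rightarrow> 'a" and g :: "'b \<Rightarrow> 'b"
  assumes K: "K \<in> couplings M N" and f: "orthogonal_transformation f" and g: "orthogonal_transformation g"
  shows "wass_dep1 (distr K borel (\<lambda>(x, y). (f x, g y))) = wass_dep1 K"
    and "wass_dep2 (distr K borel (\<lambda>(x, y). (f x, g y))) = wass_dep2 K"
proof -
  define h where "h w = (f (fst w), g (snd w))" for w
  have h: "orthogonal_transformation h" unfolding h_def by (rule orthogonal_transformation_pair[OF f g])
  note sM = couplings_margins(2)[OF K] and sN = couplings_margins(4)[OF K]
  note meas = orthogonal_transformation_borel[OF f] orthogonal_transformation_borel[OF g]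
  have hK: "distr K borel (\<lambda>(x, y). (f x, g y)) = distr K borel h"
    by (simp add: h_def[abs_def] case_prod_unfold)
  have C: "distr K borel h \<in> couplings (distr M borel f) (distr N borel g)"
    unfolding h_def[abs_def] by (rule coupling_distr[OF K meas])
  have Cs: "couplings (distr M borel f) (distr N borel g) = (\<lambda>L. distr L borel h) ` couplings M N"
    unfolding h_def[abs_def] by (rule couplings_distr_orthogonal[OF f g sM sN])
  have G: "W2 (distr L borel k) std_gaussian = W2 L std_gaussian"
    if "orthogonal_transformation k" "sets L = sets borel" for k :: "'c::euclidean_space \<Rightarrow> 'c" and L
    using W2_distr_orthogonal[OF that(1,2) sets_std_gaussian] unfolding distr_std_gaussian_orthogonal[OF that(1)] .
  have sup1: "(SUP L\<in>couplings (distr M borel f) (distr N borel g). (W2 L std_gaussian)\<^sup>2) =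
      (SUP L\<in>couplings M N. (W2 L std_gaussian)\<^sup>2)"
    unfolding Cs image_image by (rule SUP_cong) (simp_all add: G[OF h] couplingsD(2))
  show "wass_dep1 (distr K borel (\<lambda>(x, y). (f x, g y))) = wass_dep1 K"
    unfolding hK wass_dep1_coupling[OF C] wass_dep1_coupling[OF K] sup1
    by (simp add: G[OF h couplingsD(2)[OF K]] G[OF f sM] G[OF g sN])
  have "f \<in> borel_measurable M" "g \<in> borel_measurable N"
    using meas by (simp_all add: measurable_cong_sets[OF sM refl] measurable_cong_sets[OF sN refl])
  hence prod: "distr M borel f \<Otimes>\<^sub>M distr N borel g = distr (M \<Otimes>\<^sub>M N) borel h"
    unfolding h_def[abs_def] by (rule pair_measure_distr_borel[OF couplings_margins(3)[OF K], symmetric])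
  have sMN: "sets (M \<Otimes>\<^sub>M N) = sets borel"
    using sets_pair_measure_cong[OF sM sN] unfolding borel_prod .
  have sup2: "(SUP L\<in>couplings (distr M borel f) (distr N borel g). (W2 L (distr (M \<Otimes>\<^sub>M N) borel h))\<^sup>2) =
      (SUP L\<in>couplings M N. (W2 L (M \<Otimes>\<^sub>M N))\<^sup>2)"
    unfolding Cs image_image by (rule SUP_cong) (simp_all add: W2_distr_orthogonal[OF h _ sMN] couplingsD(2))
  show "wass_dep2 (distr K borel (\<lambda>(x, y). (f x, g y))) = wass_dep2 K"
    unfolding hK wass_dep2_coupling[OF C] wass_dep2_coupling[OF K] prod sup2
    by (simp add: W2_distr_orthogonal[OF h couplingsD(2)[OF K] sMN])
qed

section \<open>The two coefficients\<close>

text \<open>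
  The common pattern of the two coefficients: \<open>c\<close> is the minimum of \<open>w\<close> on the couplings, attained at
  \<open>P\<close> only, \<open>T\<close> is a maximiser, and \<open>R\<close> keeps the denominator away from 0.
\<close>
lemma normalised_coefficient:
  fixes w :: "'k \<Rightarrow> real"
  assumes ge: "\<And>L. L \<in> S \<Longrightarrow> c \<le> w L" and zero: "\<And>L. L \<in> S \<Longrightarrow> w L = c \<longleftrightarrow> L = P"
    and T: "T \<in> S" and top: "\<And>L. L \<in> S \<Longrightarrow> w L \<le> w T" and R: "R \<in> S" and other: "R \<noteq> P"
    and D: "\<And>L. L \<in> S \<Longrightarrow> D L = (w L - c) / ((SUP L\<in>S. w L) - c)" and K: "K \<in> S"
  shows "(D K \<in> {0..1} \<and> (D K = 0 \<longleftrightarrow> K = P)) \<and> (\<exists>L\<in>S. D L = 1)"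
proof (intro conjI)
  have sup: "(SUP L\<in>S. w L) = w T"
    by (rule cSup_eq_maximum) (use T top in auto)
  have "c < w R" using ge[OF R] zero[OF R] other by linarith
  hence pos: "c < w T" using top[OF R] by linarith
  show "D K \<in> {0..1}" "D K = 0 \<longleftrightarrow> K = P"
    unfolding D[OF K] sup using ge[OF K] top[OF K] zero[OF K] pos by auto
  show "\<exists>L\<in>S. D L = 1"
    using D[OF T] pos T unfolding sup by (intro bexI[of _ T]) auto
qed

lemma W2_power2_mono:
  assumes "W2sq A B \<le> W2sq C D" "C \<in> P2" "D \<in> P2"
  shows "(W2 A B)\<^sup>2 \<le> (W2 C D)\<^sup>2"
  unfolding W2_power2 using W2sq_finite[OF assms(2,3)] assms(1) by (intro enn2real_mono) auto

lemma wass_dep1_normalised: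
  fixes M :: "'a::euclidean_space measure" and N :: "'b::euclidean_space measure"
  assumes M: "M \<in> P2_nondeg" and N: "N \<in> P2_nondeg" and K: "K \<in> couplings M N"
  shows "(wass_dep1 K \<in> {0..1} \<and> (wass_dep1 K = 0 \<longleftrightarrow> K = M \<Otimes>\<^sub>M N)) \<and> (\<exists>L\<in>couplings M N. wass_dep1 L = 1)"
proof -
  have MP: "M \<in> P2" and NP: "N \<in> P2" using M N by (auto simp: P2_nondeg_def)
  let ?c = "(W2 M std_gaussian)\<^sup>2 + (W2 N std_gaussian)\<^sup>2"
  have in_P2: "L \<in> P2" if "L \<in> couplings M N" for L by (rule couplings_P2[OF MP NP that])
  have fin: "W2sq M std_gaussian < \<infinity>" "W2sq N std_gaussian < \<infinity>"
    by (rule W2sq_finite[OF MP std_gaussian_P2] W2sq_finite[OF NP std_gaussian_P2])+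
  have c: "?c = enn2real (W2sq M std_gaussian + W2sq N std_gaussian)"
    unfolding W2_power2 using fin by (simp add: enn2real_plus)
  have ge: "?c \<le> (W2 L std_gaussian)\<^sup>2" if L: "L \<in> couplings M N" for L
    unfolding c unfolding W2_power2
    using W2sq_coupling_ge[OF L std_gaussian_coupling] W2sq_finite[OF in_P2[OF L] std_gaussian_P2]
    by (intro enn2real_mono) auto
  have zero: "(W2 L std_gaussian)\<^sup>2 = ?c \<longleftrightarrow> L = M \<Otimes>\<^sub>M N" if L: "L \<in> couplings M N" for L
  proof
    assume "(W2 L std_gaussian)\<^sup>2 = ?c"
    hence "W2sq L std_gaussian = W2sq M std_gaussian + W2sq N std_gaussian"
      unfolding c unfolding W2_power2
      using W2sq_finite[OF in_P2[OF L] std_gaussian_P2] fin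
      by (metis ennreal_add_eq_top ennreal_enn2real infinity_ennreal_def less_top)
    thus "L = M \<Otimes>\<^sub>M N" by (rule product_of_gaussian_additivity[OF MP NP L])
  next
    assume "L = M \<Otimes>\<^sub>M N"
    hence "W2sq L std_gaussian \<le> W2sq M std_gaussian + W2sq N std_gaussian"
      using W2sq_product_le[OF MP NP std_gaussian_P2 std_gaussian_P2] by (simp add: std_gaussian_pair)
    hence "W2sq L std_gaussian = W2sq M std_gaussian + W2sq N std_gaussian"
      using W2sq_coupling_ge[OF L std_gaussian_coupling] by (rule antisym)
    thus "(W2 L std_gaussian)\<^sup>2 = ?c" unfolding c unfolding W2_power2 by simp
  qed
  obtain T where T: "T \<in> couplings M N"
    and max: "\<And>L. L \<in> couplings M N \<Longrightarrow> W2sq L std_gaussian \<le> W2sq T std_gaussian"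
    using W2sq_maximal_coupling[OF MP NP std_gaussian_P2] by blast
  have top: "(W2 L std_gaussian)\<^sup>2 \<le> (W2 T std_gaussian)\<^sup>2" if "L \<in> couplings M N" for L
    by (rule W2_power2_mono[OF max[OF that] in_P2[OF T] std_gaussian_P2])
  obtain R where R: "R \<in> couplings M N" "R \<noteq> M \<Otimes>\<^sub>M N"
    using non_product_coupling[OF M N] by blast
  show ?thesis
    by (rule normalised_coefficient[where w = "\<lambda>L. (W2 L std_gaussian)\<^sup>2" and c = ?c and T = T and R = R])
       (fact ge zero T top R wass_dep1_coupling K)+
qed

lemma wass_dep2_normalised:
  fixes M :: "'a::euclidean_space measure" and N :: "'b::euclidean_space measure"
  assumes M: "M \<in> P2_nondeg" and N: "N \<in> P2_nondeg" and K: "K \<in> couplings M N"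
  shows "(wass_dep2 K \<in> {0..1} \<and> (wass_dep2 K = 0 \<longleftrightarrow> K = M \<Otimes>\<^sub>M N)) \<and> (\<exists>L\<in>couplings M N. wass_dep2 L = 1)"
proof -
  have MP: "M \<in> P2" and NP: "N \<in> P2" using M N by (auto simp: P2_nondeg_def)
  let ?P = "M \<Otimes>\<^sub>M N"
  have in_P2: "L \<in> P2" if "L \<in> couplings M N" for L by (rule couplings_P2[OF MP NP that])
  have P: "?P \<in> P2"
    using P2D[OF MP] P2D[OF NP] by (intro in_P2 product_coupling)
  have ge: "0 \<le> (W2 L ?P)\<^sup>2" for L by (rule zero_le_power2)
  have zero: "(W2 L ?P)\<^sup>2 = 0 \<longleftrightarrow> L = ?P" if L: "L \<in> couplings M N" for L
  proof
    assume "(W2 L ?P)\<^sup>2 = 0"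
    hence "W2sq L ?P = 0"
      using W2sq_finite[OF in_P2[OF L] P] unfolding W2_power2 enn2real_eq_0_iff by auto
    thus "L = ?P" by (rule eq_of_W2sq_zero[OF in_P2[OF L] P])
  qed (simp add: W2_power2 W2sq_self[OF P])
  obtain T where T: "T \<in> couplings M N" and max: "\<And>L. L \<in> couplings M N \<Longrightarrow> W2sq L ?P \<le> W2sq T ?P"
    using W2sq_maximal_coupling[OF MP NP P] by blast
  have top: "(W2 L ?P)\<^sup>2 \<le> (W2 T ?P)\<^sup>2" if "L \<in> couplings M N" for L
    by (rule W2_power2_mono[OF max[OF that] in_P2[OF T] P])
  obtain R where R: "R \<in> couplings M N" "R \<noteq> ?P"
    using non_product_coupling[OF M N] by blast
  show ?thesis
    by (rule normalised_coefficient[where w = "\<lambda>L. (W2 L ?P)\<^sup>2" and c = 0 and T = T and R = R])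
       (rule ge, (fact zero T top R wass_dep2_coupling K)+)
qed

theorem proposition2p3:
  fixes \<mu> :: "(real ^ 'p) measure"
    and \<nu> :: "(real ^ 'q) measure"
    and \<pi> :: "((real ^ 'p) \<times> (real ^ 'q)) measure"
  assumes "\<mu> \<in> P2_nondeg" and "\<nu> \<in> P2_nondeg" and "\<pi> \<in> couplings \<mu> \<nu>"
  shows "\<forall>D \<in> {wass_dep1, wass_dep2}.
      (D \<pi> \<in> {0..1} \<and> (D \<pi> = 0 \<longleftrightarrow> \<pi> = \<mu> \<Otimes>\<^sub>M \<nu>)) \<and>
      (\<exists>\<pi>'\<in>couplings \<mu> \<nu>. D \<pi>' = 1) \<and>
      (\<forall>O1 O2. orthogonal_transformation O1 \<longrightarrow> orthogonal_transformation O2 \<longrightarrow>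
         D (distr \<pi> borel (\<lambda>(x, y). (O1 x, O2 y))) = D \<pi>)"
proof -
  have invariant: "\<forall>O1 O2. orthogonal_transformation O1 \<longrightarrow> orthogonal_transformation O2 \<longrightarrow>
      D (distr \<pi> borel (\<lambda>(x, y). (O1 x, O2 y))) = D \<pi>" if "D \<in> {wass_dep1, wass_dep2}" for D
    using that by (elim insertE emptyE) (simp_all add: wass_dep_invariant[OF assms(3)])
  show ?thesis
    using wass_dep1_normalised[OF assms] wass_dep2_normalised[OF assms]
    by (intro ballI conjI invariant) (elim insertE emptyE; simp)+
qed

end
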